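(* Let $A$ be a finitely generated (commutative) integral domain of Krull dimension $d$. Then the Cantor-Bendixson rank of $A$ is $\omega^{d-1}$ (with the convention $\omega^{-1}=0$).
   Context: All rings are commutative with unity; finitely generated means finitely generated as a ring; $\omega$ is the smallest infinite ordinal and $\omega^{d-1}$ is an ordinal power. $\mathcal{R}_n$ is the set of pairs $(A,(x_1,\dots,x_n))$ where $A$ is a ring endowed with a family of ring generators $(x_1,\dots,x_n)$, up to marked ring isomorphism. It is a topological space in which a prebasis of neighbourhoods of $(A,(x_1,\dots,x_n))$ is given by the following sets $V_P$, for $P\in\mathbf{Z}[X_1,\dots,X_n]$: if $P=0$ (respectively $P\neq 0$) in $A$ when evaluated at $(x_1,\dots,x_n)$, then $V_P$ is the set of marked rings on $n$ generators in which $P=0$ (respectively $P\neq 0$), where $P$ is evaluated on the $n$-tuple of marked generators. Cantor-Bendixson rank: for a topological space $X$, define by transfinite induction $I_0(X)$ as the set of isolated points of $X$, and $I_\alpha(X)=I_0\big(X-\bigcup_{\beta<\alpha}I_\beta(X)\big)$. A point $x\in X$ has Cantor-Bendixson rank $\alpha$ if $x\in I_\alpha(X)$, and rank $\infty$ if $x\notin\bigcup_\alpha I_\alpha(X)$. The Cantor-Bendixson rank of a finitely generated ring $A$ is the rank of $(A,(x_1,\dots,x_n))$ in $\mathcal{R}_n$ for any $n$ and any ring generators $x_1,\dots,x_n$ of $A$; it does not depend on these choices. *)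

theory Defs
  imports
    "HOL-Analysis.Function_Topology"
    "HOL-Algebra.Generated_Rings"
    "HOL-Algebra.Weak_Morphisms"
    "HOL-Library.Poly_Mapping"
    "HOL-Library.Extended_Nat"
begin

subsection \<open>Ordinals and Cantor-Bendixson rank\<close>

text \<open>
  Ordinals are represented by well-orders up to isomorphism, in the style of the BNF library:
  \<open>Well_order r\<close> says that \<open>r\<close> is an ordinal, and \<open>(s, r) \<in> ordLess\<close> is the strict comparison of
  ordinals. The empty relation is the ordinal 0. As every ordinal below that of \<open>r :: 'b rel\<close> is the
  type of an initial segment of \<open>r\<close>, the union over all well-orders \<open>s :: 'b rel\<close> below \<open>r\<close> is the
  union over all ordinals below \<open>r\<close>.
\<close>

definition isolated_points :: "'a topology \<Rightarrow> 'a set" where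
  "isolated_points X = {x \<in> topspace X. openin X {x}}"

function CB_level :: "'a topology \<Rightarrow> 'b rel \<Rightarrow> 'a set" where
  "CB_level X r =
     isolated_points (subtopology X (topspace X - (\<Union>s\<in>{s. (s, r) \<in> ordLess}. CB_level X s)))"
  by auto
termination
  by (relation "inv_image ordLess snd") (auto intro: wf_ordLess)

declare CB_level.simps [simp del]

definition has_CB_rank :: "'a topology \<Rightarrow> 'a \<Rightarrow> 'b rel \<Rightarrow> bool" where
  "has_CB_rank X x r \<longleftrightarrow> Well_order r \<and> x \<in> CB_level X r"

text \<open>
  Finite powers of \<open>\<omega>\<close>, by \<open>\<omega> ^ 0 = 1\<close> and \<open>\<omega> ^ (k + 1) = \<omega> ^ k \<cdot> \<omega>\<close> (that is,
  \<open>\<omega>\<close> consecutive copies of \<open>\<omega> ^ k\<close>; the head of the list is the index of the copy).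
\<close>

fun omega_power :: "nat \<Rightarrow> nat list rel" where
  "omega_power 0 = {([], [])}"
| "omega_power (Suc k) =
     {(m # u, n # v) | m n u v.
        m < n \<and> u \<in> Field (omega_power k) \<and> v \<in> Field (omega_power k)
        \<or> m = n \<and> (u, v) \<in> omega_power k}"

lemma omega_power_iff:
  "(u, v) \<in> omega_power k \<longleftrightarrow> length u = k \<and> length v = k \<and> (u = v \<or> (u, v) \<in> lex less_than)"
proof (induction k arbitrary: u v)
  case 0
  then show ?case by auto
next
  case (Suc k)
  have F: "Field (omega_power k) = {w. length w = k}"
    using Suc by (auto simp: Field_def Domain_iff Range_iff)
  show ?case
    unfolding omega_power.simps F
    by (cases u; cases v) (auto simp: Suc)
qed

lemma Field_omega_power: "Field (omega_power k) = {u. length u = k}"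
  by (auto simp: omega_power_iff Field_def Domain_iff Range_iff)

lemma Well_order_omega_power: "Well_order (omega_power k)"
proof -
  have wf: "wf (lex less_than)" by (simp add: wf_lex)
  have tot: "(u, v) \<in> lex less_than \<or> u = v \<or> (v, u) \<in> lex less_than"
    if "length u = k" "length v = k" for u v :: "nat list"
    using that
  proof (induction k arbitrary: u v)
    case (Suc k)
    then obtain m n u' v' where "u = m # u'" "v = n # v'" "length u' = k" "length v' = k"
      by (auto simp: length_Suc_conv)
    then show ?case
      using Suc.IH[of u' v'] linorder_less_linear[of m n] by auto
  qed simp
  have tr: "trans (lex less_than)" by (rule lex_transI) (simp add: trans_less_than)
  have "Refl (omega_power k)"
    unfolding refl_on_def by (auto simp: Field_omega_power omega_power_iff)
  moreover have "trans (omega_power k)"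
    using tr unfolding trans_def by (auto simp: omega_power_iff)
  moreover have "antisym (omega_power k)"
    using wf unfolding antisym_def by (auto simp: omega_power_iff dest: wf_asym)
  moreover have "Total (omega_power k)"
    using tot unfolding total_on_def by (auto simp: Field_omega_power omega_power_iff)
  moreover have "wf (omega_power k - Id)"
    by (rule wf_subset[OF wf]) (auto simp: omega_power_iff)
  ultimately show ?thesis
    unfolding well_order_on_def linear_order_on_def partial_order_on_def preorder_on_def
    by (auto simp: Field_def)
qed

subsection \<open>Finitely generated rings and Krull dimension\<close>

definition ring_generators :: "('a, 'm) ring_scheme \<Rightarrow> 'a list \<Rightarrow> bool" where
  "ring_generators A xs \<longleftrightarrow> set xs \<subseteq> carrier A \<and> generate_ring A (set xs) = carrier A"

definition finitely_generated_ring :: "('a, 'm) ring_scheme \<Rightarrow> bool" where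
  "finitely_generated_ring A \<longleftrightarrow> (\<exists>xs. ring_generators A xs)"

text \<open>The supremum in \<^typ>\<open>enat\<close> gives the zero ring dimension 0.\<close>

definition krull_dim :: "('a, 'm) ring_scheme \<Rightarrow> enat" where
  "krull_dim A =
     Sup {enat n | n. \<exists>P. (\<forall>i\<le>n. primeideal (P i) A) \<and> (\<forall>i<n. P i \<subset> P (Suc i))}"

subsection \<open>The space of marked rings on \<open>n\<close> generators\<close>

text \<open>
  Integer polynomials: \<open>P\<close> maps a monomial to its coefficient, a monomial maps (the index of)
  a variable to its exponent. The variables are indexed from 0.
\<close>

type_synonym int_mpoly = "(nat \<Rightarrow>\<^sub>0 nat) \<Rightarrow>\<^sub>0 int"

definition int_mpolys :: "nat \<Rightarrow> int_mpoly set" where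
  "int_mpolys n = {P. \<forall>m\<in>Poly_Mapping.keys P. Poly_Mapping.keys m \<subseteq> {..<n}}"

definition eval_mpoly :: "('a, 'm) ring_scheme \<Rightarrow> 'a list \<Rightarrow> int_mpoly \<Rightarrow> 'a" where
  "eval_mpoly A xs P =
     (\<Oplus>\<^bsub>A\<^esub>m\<in>Poly_Mapping.keys P. [Poly_Mapping.lookup P m] \<cdot>\<^bsub>A\<^esub>
        (\<Otimes>\<^bsub>A\<^esub>i\<in>Poly_Mapping.keys m. (xs ! i) [^]\<^bsub>A\<^esub> Poly_Mapping.lookup m i))"

definition marked_iso ::
    "('a, 'm) ring_scheme \<times> 'a list \<Rightarrow> ('b, 'k) ring_scheme \<times> 'b list \<Rightarrow> bool" where
  "marked_iso = (\<lambda>(A, xs) (B, ys). \<exists>h \<in> ring_iso A B. map h xs = ys)"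

text \<open>
  A finitely generated ring is countable, hence isomorphic to a ring whose carrier is a set of
  natural numbers; so the marked rings with carrier in \<^typ>\<open>nat\<close> meet all isomorphism classes
  (lemma \<open>marked_class_in_marked_ring_classes\<close> below).
\<close>

definition marked_rings :: "nat \<Rightarrow> (nat ring \<times> nat list) set" where
  "marked_rings n = {(B, ys). cring B \<and> length ys = n \<and> ring_generators B ys}"

definition marked_ring_classes :: "nat \<Rightarrow> (nat ring \<times> nat list) set set" where
  "marked_ring_classes n =
     marked_rings n // {(p, q). p \<in> marked_rings n \<and> q \<in> marked_rings n \<and> marked_iso p q}"

definition marked_class :: "('a, 'm) ring_scheme \<Rightarrow> 'a list \<Rightarrow> (nat ring \<times> nat list) set" where
  "marked_class A xs = {q \<in> marked_rings (length xs). marked_iso (A, xs) q}"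

definition vanishing_set :: "nat \<Rightarrow> int_mpoly \<Rightarrow> (nat ring \<times> nat list) set set" where
  "vanishing_set n P = {c \<in> marked_ring_classes n. \<forall>(B, ys)\<in>c. eval_mpoly B ys P = \<zero>\<^bsub>B\<^esub>}"

definition nonvanishing_set :: "nat \<Rightarrow> int_mpoly \<Rightarrow> (nat ring \<times> nat list) set set" where
  "nonvanishing_set n P = {c \<in> marked_ring_classes n. \<forall>(B, ys)\<in>c. eval_mpoly B ys P \<noteq> \<zero>\<^bsub>B\<^esub>}"

definition marked_ring_space :: "nat \<Rightarrow> (nat ring \<times> nat list) set topology" where
  "marked_ring_space n =
     topology_generated_by (vanishing_set n ` int_mpolys n \<union> nonvanishing_set n ` int_mpolys n)"

text \<open>
  The rank is the same for all choices of generators. The definition asks for the given rank at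
  every choice, and for the existence of one, so that it does not hold vacuously.
\<close>

definition ring_has_CB_rank :: "('a, 'm) ring_scheme \<Rightarrow> 'b rel \<Rightarrow> bool" where
  "ring_has_CB_rank A r \<longleftrightarrow>
     finitely_generated_ring A \<and>
     (\<forall>xs. ring_generators A xs \<longrightarrow>
        has_CB_rank (marked_ring_space (length xs)) (marked_class A xs) r)"

subsection \<open>Adequacy of the carrier type \<open>nat\<close>\<close>

lemma marked_iso_refl: "marked_iso p p"
proof -
  have "id \<in> ring_iso (fst p) (fst p)" by (rule ring_iso_set_refl)
  then show ?thesis unfolding marked_iso_def by (auto simp: case_prod_beta intro: bexI[of _ id])
qed

lemma marked_iso_sym:
  assumes "ring A" "set xs \<subseteq> carrier A" "marked_iso (A, xs) q"
  shows "marked_iso q (A, xs)"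
proof -
  obtain B ys where q: "q = (B, ys)" by (cases q)
  then obtain h where h: "h \<in> ring_iso A B" "map h xs = ys"
    using assms(3) by (auto simp: marked_iso_def)
  have "inv_into (carrier A) h \<in> ring_iso B A"
    using ring_iso_set_sym[OF assms(1) h(1)] .
  moreover have "inj_on h (carrier A)" using h(1) by (auto simp: ring_iso_def bij_betw_def)
  then have "map (inv_into (carrier A) h) ys = xs"
    using assms(2) by (auto simp: h(2)[symmetric] intro!: map_idI)
  ultimately show ?thesis unfolding q marked_iso_def by auto
qed

lemma marked_iso_trans:
  assumes "marked_iso p q" "marked_iso q s"
  shows "marked_iso p s"
proof -
  obtain h g where h: "h \<in> ring_iso (fst p) (fst q)" "map h (snd p) = snd q"
    and g: "g \<in> ring_iso (fst q) (fst s)" "map g (snd q) = snd s"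
    using assms unfolding marked_iso_def by (auto simp: case_prod_beta)
  have "g \<circ> h \<in> ring_iso (fst p) (fst s)" using ring_iso_set_trans[OF h(1) g(1)] .
  moreover have "map (g \<circ> h) (snd p) = snd s" using h g by (metis map_map)
  ultimately show ?thesis unfolding marked_iso_def by (auto simp: case_prod_beta)
qed

lemma equiv_marked_iso:
  "equiv (marked_rings n) {(p, q). p \<in> marked_rings n \<and> q \<in> marked_rings n \<and> marked_iso p q}"
proof (rule equivI)
  show "sym {(p, q). p \<in> marked_rings n \<and> q \<in> marked_rings n \<and> marked_iso p q}"
    unfolding sym_def
    by (auto simp: marked_rings_def ring_generators_def cring_def intro: marked_iso_sym)
  show "trans {(p, q). p \<in> marked_rings n \<and> q \<in> marked_rings n \<and> marked_iso p q}"
    unfolding trans_def using marked_iso_trans by blast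
qed (auto simp: refl_on_def marked_iso_refl)

lemma topspace_marked_ring_space: "topspace (marked_ring_space n) = marked_ring_classes n"
proof -
  have "eval_mpoly B ys 0 = \<zero>\<^bsub>B\<^esub>" if "c \<in> marked_ring_classes n" "(B, ys) \<in> c" for c B ys
  proof -
    have "(B, ys) \<in> marked_rings n"
      using that by (auto simp: marked_ring_classes_def quotient_def)
    then interpret cring B by (simp add: marked_rings_def)
    show ?thesis by (simp add: eval_mpoly_def)
  qed
  then have "vanishing_set n 0 = marked_ring_classes n"
    by (auto simp: vanishing_set_def)
  moreover have "0 \<in> int_mpolys n" by (simp add: int_mpolys_def)
  ultimately have "marked_ring_classes n \<in> vanishing_set n ` int_mpolys n" by (metis imageI)
  moreover have "\<Union>(vanishing_set n ` int_mpolys n \<union> nonvanishing_set n ` int_mpolys n)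
      \<subseteq> marked_ring_classes n"
    by (auto simp: vanishing_set_def nonvanishing_set_def)
  ultimately show ?thesis
    unfolding marked_ring_space_def topology_generated_by_topspace by blast
qed

lemma countable_generate_ring:
  assumes "countable H"
  shows "countable (generate_ring A H)"
proof -
  define step where "step S = S \<union> a_inv A ` S \<union> (\<lambda>(a, b). a \<oplus>\<^bsub>A\<^esub> b) ` (S \<times> S)
      \<union> (\<lambda>(a, b). a \<otimes>\<^bsub>A\<^esub> b) ` (S \<times> S)" for S
  define T where "T k = (step ^^ k) (insert \<one>\<^bsub>A\<^esub> H)" for k
  have T_Suc: "T (Suc k) = step (T k)" for k by (simp add: T_def)
  have cT: "countable (T k)" for k
    by (induction k) (use assms in \<open>auto simp: T_Suc step_def intro!: countable_Un\<close>, simp add: T_def)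
  have mono: "T i \<subseteq> T j" if "i \<le> j" for i j
    using that by (rule lift_Suc_mono_le[rotated]) (auto simp: T_Suc step_def)
  have "x \<in> (\<Union>k. T k)" if "x \<in> generate_ring A H" for x
    using that
  proof induction
    case one
    have "\<one>\<^bsub>A\<^esub> \<in> T 0" by (simp add: T_def)
    then show ?case by blast
  next
    case (incl h)
    then have "h \<in> T 0" by (simp add: T_def)
    then show ?case by blast
  next
    case (a_inv h)
    then obtain k where "h \<in> T k" by blast
    then have "\<ominus>\<^bsub>A\<^esub> h \<in> T (Suc k)" by (auto simp: T_Suc step_def)
    then show ?case by blast
  next
    case (eng_add a b)
    then obtain i j where "a \<in> T i" "b \<in> T j" by blast
    then have "a \<in> T (max i j)" "b \<in> T (max i j)" using mono by (meson max.cobounded1 max.cobounded2 subsetD)+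
    then have "a \<oplus>\<^bsub>A\<^esub> b \<in> T (Suc (max i j))" by (auto simp: T_Suc step_def)
    then show ?case by blast
  next
    case (eng_mult a b)
    then obtain i j where "a \<in> T i" "b \<in> T j" by blast
    then have "a \<in> T (max i j)" "b \<in> T (max i j)" using mono by (meson max.cobounded1 max.cobounded2 subsetD)+
    then have "a \<otimes>\<^bsub>A\<^esub> b \<in> T (Suc (max i j))" by (auto simp: T_Suc step_def)
    then show ?case by blast
  qed
  then have "generate_ring A H \<subseteq> (\<Union>k. T k)" by blast
  then show ?thesis using cT by (meson countable_UN countable_subset UNIV_I countableI_type)
qed

lemma ring_iso_generators:
  assumes "ring A" "ring B" "h \<in> ring_iso A B" "ring_generators A xs"
  shows "ring_generators B (map h xs)"
proof -
  interpret A: ring A by fact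
  interpret B: ring B by fact
  interpret h: ring_hom_ring A B h
    using assms by (auto intro!: ring_hom_ringI2 simp: ring_iso_def)
  have im: "h ` carrier A = carrier B" using assms(3) by (auto simp: ring_iso_def bij_betw_def)
  have xs: "set xs \<subseteq> carrier A" "generate_ring A (set xs) = carrier A"
    using assms(4) by (auto simp: ring_generators_def)
  have sub: "set (map h xs) \<subseteq> carrier B" using xs im by auto
  have "h x \<in> generate_ring B (set (map h xs))" if "x \<in> generate_ring A (set xs)" for x
    using that
  proof induction
    case one
    then show ?case using generate_ring.one[of B] by simp
  next
    case (incl x)
    then show ?case by (intro generate_ring.incl) auto
  next
    case (a_inv x)
    then have "x \<in> carrier A" using xs by simp
    then show ?case using generate_ring.a_inv[OF a_inv.IH] by simp
  next
    case (eng_add x y)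
    then have "x \<in> carrier A" "y \<in> carrier A" using xs by auto
    then show ?case using generate_ring.eng_add[OF eng_add.IH] by simp
  next
    case (eng_mult x y)
    then have "x \<in> carrier A" "y \<in> carrier A" using xs by auto
    then show ?case using generate_ring.eng_mult[OF eng_mult.IH] by simp
  qed
  then have "carrier B \<subseteq> generate_ring B (set (map h xs))"
    unfolding im[symmetric] xs(2)[symmetric] by (rule image_subsetI)
  then show ?thesis
    using B.generate_ring_incl[OF sub] sub by (auto simp: ring_generators_def)
qed

lemma marked_class_in_marked_ring_classes:
  assumes "cring A" "ring_generators A xs"
  shows "marked_class A xs \<in> marked_ring_classes (length xs)"
proof -
  interpret A: cring A by fact
  have xs: "set xs \<subseteq> carrier A" using assms by (simp add: ring_generators_def)
  have "countable (carrier A)"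
    using assms(2) countable_generate_ring[OF countable_finite, of "set xs" A]
    by (simp add: ring_generators_def)
  then obtain f :: "_ \<Rightarrow> nat" where "inj_on f (carrier A)" by (auto simp: countable_def)
  then have f: "f \<in> ring_iso A (image_ring f A)" by (rule inj_imp_image_ring_iso)
  have cr: "cring (image_ring f A)"
    using A.ring_iso_imp_img_cring[OF f] by (simp add: image_ring_def image_group_def monoid.defs)
  let ?p = "(image_ring f A, map f xs)"
  have p: "?p \<in> marked_rings (length xs)"
    using cr ring_iso_generators[OF A.ring_axioms cring.axioms(1)[OF cr] f assms(2)]
    by (simp add: marked_rings_def)
  have Ap: "marked_iso (A, xs) ?p" using f by (auto simp: marked_iso_def)
  have pA: "marked_iso ?p (A, xs)" using marked_iso_sym[OF A.ring_axioms xs Ap] .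
  have "marked_class A xs =
      {(p, q). p \<in> marked_rings (length xs) \<and> q \<in> marked_rings (length xs) \<and> marked_iso p q} `` {?p}"
    using p marked_iso_trans[OF Ap] marked_iso_trans[OF pA] by (auto simp: marked_class_def)
  then show ?thesis
    unfolding marked_ring_classes_def by (simp only: quotientI[OF p])
qed

end

theory Submission
  imports Defs "HOL-Computational_Algebra.Polynomial"
begin

text \<open>
  Write \<open>A\<close> as a quotient of \<open>R = \<int>[X\<^sub>1, \<dots>, X\<^sub>n]\<close>. By Hilbert's basis theorem the marked quotients of \<open>A\<close>
  form an open set, and they correspond to the ideals \<open>J\<close> of \<open>R\<close> above the kernel \<open>N\<close>; a neighborhood
  of \<open>J\<close> is given by the ideals above \<open>J\<close> that avoid a finite subset of \<open>R - J\<close>. Let \<open>\<sigma>(J)\<close> be the ordinal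
  length of \<open>R/J\<close>, that is, the rank of \<open>J\<close> among the ideals ordered by reverse inclusion. As the
  residue fields are finite, the Cantor-Bendixson rank of \<open>J\<close> is the quotient of \<open>\<sigma>(J)\<close> by \<open>\<omega>\<close>:
  avoiding the finite part of \<open>R/J\<close> forces \<open>J'/J\<close> to have an infinite descending chain of
  submodules, so \<open>\<sigma>\<close> drops by at least \<open>\<omega>\<close>; conversely, an infinite \<open>J'/J\<close> contains some \<open>R/Q\<close> with \<open>Q\<close> prime
  and not maximal, hence by Krull's intersection theorem arbitrarily small nonzero submodules.
  Finally \<open>\<sigma>(N) = \<omega>\<^sup>d\<close>. The upper bound is an induction on \<open>d\<close> with \<open>\<sigma>(J) \<le> \<sigma>(J + aR) \<oplus> \<sigma>(J : a)\<close> for the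
  natural sum, which is pointwise addition in the representation of ordinals below \<open>\<omega>\<^sup>d\<close> by lists; the
  lower bound follows from the chains of the ideals \<open>N + g\<^sup>k R\<close>, whose steps have length at least \<open>\<omega>\<^sup>d\<^sup>-\<^sup>1\<close>.
\<close>

subsection \<open>Cantor-Bendixson levels\<close>

text \<open>A list of \<open>d\<close> entries names only ordinals below omega^d, so the length of
  \<open>N\<close> itself has no name. The ideals strictly above \<open>N\<close> therefore get
  exact lengths, \<open>N\<close> only gets the information that these lengths are cofinal in
  omega^d, and its rank omega^(d-1) is assigned separately. For \<open>d = 0\<close> there is
  nothing to divide by omega: \<open>N\<close> is maximal, and forbidding the polynomial 1 isolates
  it.

  Finiteness of residue fields resists a direct induction on the generators, since a subring of a
  field need not be a field. What descends from \<open>S[x]\<close> to \<open>S\<close> is the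
  weaker property of becoming a field modulo \<open>M\<close> once a single element is inverted. It
  reaches the integers, where it forces positive characteristic, and finiteness then climbs back up.

  The polynomial type has infinitely many variables and is not noetherian. Hence all ideals are
  taken above an \<open>N\<close> that contains the variables beyond the first \<open>n\<close>, and
  noetherianity is proved for finitely generated subrings.\<close>

lemma in_isolated_points_subtopology_iff:
  "x \<in> isolated_points (subtopology X Y) \<longleftrightarrow>
     x \<in> topspace X \<and> x \<in> Y \<and> (\<exists>U. openin X U \<and> U \<inter> Y = {x})"
  unfolding isolated_points_def by (auto simp: openin_subtopology)

text \<open>Induction on \<open>r\<close> shows that the points of \<open>S\<close> left after
  removing the levels below \<open>r\<close> are those of rank at least \<open>r\<close>. Among
  these, a point of rank \<open>r\<close> is isolated by \<open>upper\<close>, and a point of larger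
  rank is a limit of others by \<open>lower\<close>. Openness of \<open>S\<close> makes it harmless
  that nothing is known about the levels outside \<open>S\<close>.\<close>

lemma CB_level_rank_function:
  fixes \<rho> :: "'a \<Rightarrow> 'b rel"
  assumes S: "openin X S"
    and wo: "\<And>x. x \<in> S \<Longrightarrow> Well_order (\<rho> x)"
    and upper: "\<And>x. x \<in> S \<Longrightarrow>
      \<exists>U. openin X U \<and> x \<in> U \<and> U \<subseteq> S \<and> (\<forall>y\<in>U - {x}. (\<rho> y, \<rho> x) \<in> ordLess)"
    and lower: "\<And>x (r :: 'b rel) U. x \<in> S \<Longrightarrow> (r, \<rho> x) \<in> ordLess \<Longrightarrow> openin X U \<Longrightarrow> x \<in> U \<Longrightarrow>
      \<exists>y\<in>U \<inter> S - {x}. (\<rho> y, r) \<notin> ordLess"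
    and x: "x \<in> S"
  shows "x \<in> CB_level X (\<rho> x)"
proof -
  have main: "\<forall>y\<in>S. Well_order r \<longrightarrow> (y \<in> CB_level X r \<longleftrightarrow> (r, \<rho> y) \<in> ordIso)" for r :: "'b rel"
    using wf_ordLess
  proof (induction r rule: wf_induct_rule)
    case (less r)
    define Y where "Y = topspace X - (\<Union>s\<in>{s :: 'b rel. (s, r) \<in> ordLess}. CB_level X s)"
    have ST: "S \<subseteq> topspace X" using S by (rule openin_subset)
    have Y: "y \<in> Y \<longleftrightarrow> (\<rho> y, r) \<notin> ordLess" if y: "y \<in> S" for y
    proof
      assume yY: "y \<in> Y"
      show "(\<rho> y, r) \<notin> ordLess"
      proof
        assume lt: "(\<rho> y, r) \<in> ordLess"
        have "y \<in> CB_level X (\<rho> y)"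
          using less.IH[OF lt, THEN bspec, OF y] wo[OF y] ordIso_reflexive[OF wo[OF y]] by simp
        then show False using yY lt unfolding Y_def by blast
      qed
    next
      assume *: "(\<rho> y, r) \<notin> ordLess"
      show "y \<in> Y"
      proof (rule ccontr)
        assume "y \<notin> Y"
        then obtain s :: "'b rel" where s: "(s, r) \<in> ordLess" "y \<in> CB_level X s"
          using y ST unfolding Y_def by blast
        moreover have "Well_order s" using s(1) by (simp add: ordLess_def)
        ultimately have "(s, \<rho> y) \<in> ordIso"
          using less.IH[OF s(1), THEN bspec, OF y] by simp
        then show False
          using s(1) * ordIso_symmetric[of s "\<rho> y"] ordIso_ordLess_trans[of "\<rho> y" s r] by blast
      qed
    qed
    show ?case
    proof (intro ballI impI)
      fix y assume y: "y \<in> S" and r: "Well_order r"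
      have iff: "y \<in> CB_level X r \<longleftrightarrow> y \<in> Y \<and> (\<exists>U. openin X U \<and> U \<inter> Y = {y})"
        unfolding CB_level.simps[of X r] Y_def[symmetric] in_isolated_points_subtopology_iff
        using y ST by blast
      show "y \<in> CB_level X r \<longleftrightarrow> (r, \<rho> y) \<in> ordIso"
      proof
        assume iso: "(r, \<rho> y) \<in> ordIso"
        then have "y \<in> Y"
          using Y[OF y] not_ordLess_ordIso[of "\<rho> y" r] ordIso_symmetric[of r "\<rho> y"] by blast
        moreover obtain U where U: "openin X U" "y \<in> U" "U \<subseteq> S"
            "\<And>z. z \<in> U - {y} \<Longrightarrow> (\<rho> z, \<rho> y) \<in> ordLess"
          using upper[OF y] by blast
        have "z \<notin> Y" if "z \<in> U - {y}" for z
          using U(3) U(4)[OF that] Y[of z] that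
            ordIso_symmetric[OF iso] ordLess_ordIso_trans[of "\<rho> z" "\<rho> y" r] by blast
        then have "U \<inter> Y = {y}" using U(2) \<open>y \<in> Y\<close> by blast
        ultimately show "y \<in> CB_level X r" using iff U(1) by blast
      next
        assume "y \<in> CB_level X r"
        then have "y \<in> Y \<and> (\<exists>U. openin X U \<and> U \<inter> Y = {y})" by (simp only: iff)
        then obtain U where U: "y \<in> Y" "openin X U" "U \<inter> Y = {y}" by blast
        show "(r, \<rho> y) \<in> ordIso"
        proof (rule ccontr)
          assume "(r, \<rho> y) \<notin> ordIso"
          then have "(r, \<rho> y) \<in> ordLess"
            using U(1) Y[OF y] ordLess_or_ordLeq[OF wo[OF y] r]
            by (simp add: ordLeq_iff_ordLess_or_ordIso)
          moreover have "y \<in> U" using U(3) by blast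
          ultimately obtain z where "z \<in> U \<inter> S - {y}" "(\<rho> z, r) \<notin> ordLess"
            using lower[OF y _ U(2)] by metis
          then show False using Y[of z] U(3) by auto
        qed
      qed
    qed
  qed
  show ?thesis using main[of "\<rho> x"] x wo[OF x] ordIso_reflexive[OF wo[OF x]] by blast
qed

subsection \<open>Initial segments of powers of omega\<close>

abbreviation list_less :: "nat list \<Rightarrow> nat list \<Rightarrow> bool" (infix "\<lless>" 50) where
  "u \<lless> v \<equiv> (u, v) \<in> lex less_than"

lemma list_less_length: "u \<lless> v \<Longrightarrow> length u = length v"
  by (auto simp: lex_conv)

lemma list_less_trans: "u \<lless> v \<Longrightarrow> v \<lless> w \<Longrightarrow> u \<lless> w"
  using lex_transI[OF trans_less_than] by (meson transD)

lemma list_less_irrefl [simp]: "\<not> u \<lless> u"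
  by (rule wf_not_refl[OF wf_lex[OF wf_less_than]])

lemma list_less_linear: "length u = length v \<Longrightarrow> u \<lless> v \<or> u = v \<or> v \<lless> u"
proof (induction u v rule: list_induct2)
  case (Cons a u b v)
  then show ?case using linorder_less_linear[of a b] by (elim disjE) simp_all
qed simp

text \<open>The last entry is the remainder of an ordinal modulo omega and the other entries form
  the quotient; this is how two such divisions compare.\<close>

lemma list_less_snoc:
  "length u = length v \<Longrightarrow> u @ [m] \<lless> v @ [n] \<longleftrightarrow> u \<lless> v \<or> u = v \<and> m < n"
  by (induction u v rule: list_induct2) (simp_all, metis)

lemma list_less_least:
  assumes "P u" "length u = k"
  obtains v where "P v" "length v = k" "\<And>w. w \<lless> v \<Longrightarrow> \<not> P w"
proof -
  define Q where "Q = {u. P u \<and> length u = k}"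
  have "u \<in> Q" using assms by (simp add: Q_def)
  then obtain v where v: "v \<in> Q" "\<And>w. w \<lless> v \<Longrightarrow> w \<notin> Q"
    using wf_lex[OF wf_less_than] unfolding wf_eq_minimal by metis
  show ?thesis
  proof (rule that[of v])
    show "\<not> P w" if "w \<lless> v" for w
      using v(1) v(2)[OF that] list_less_length[OF that] by (simp add: Q_def)
  qed (use v(1) in \<open>simp_all add: Q_def\<close>)
qed

text \<open>The ordinal named by a list, in Cantor normal form with the most significant coefficient
  first: the head counts copies of omega^(k-1), the last entry counts units.\<close>

definition omega_segment :: "nat \<Rightarrow> nat list \<Rightarrow> nat list rel" where
  "omega_segment k u = Restr (omega_power k) (underS (omega_power k) u)"

lemma Well_order_omega_segment: "Well_order (omega_segment k u)"
  unfolding omega_segment_def by (rule Well_order_Restr[OF Well_order_omega_power])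

lemma omega_segment_less_power: "(omega_segment k u, omega_power k) \<in> ordLess"
  unfolding omega_segment_def
  by (rule underS_Restr_ordLess[OF Well_order_omega_power])
    (auto simp: Field_omega_power intro: exI[of _ "replicate k 0"])

lemma underS_omega_power: "length u = k \<Longrightarrow> underS (omega_power k) u = {v. v \<lless> u}"
  unfolding underS_def omega_power_iff by (auto dest: list_less_length simp: list_less_irrefl)

lemma omega_segment_mono:
  assumes "u \<lless> v" "length v = k"
  shows "(omega_segment k u, omega_segment k v) \<in> ordLess"
proof -
  interpret wo_rel "omega_power k" by (simp add: wo_rel_def Well_order_omega_power)
  have "length u = k" using assms list_less_length by metis
  then have "Order_Relation.underS (omega_power k) u \<subset> Order_Relation.underS (omega_power k) v"
    unfolding underS_omega_power[OF \<open>length u = k\<close>] underS_omega_power[OF assms(2)]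
    using assms(1) list_less_trans list_less_irrefl by blast
  then show ?thesis
    unfolding omega_segment_def
    using ofilter_subset_ordLess[OF WELL underS_ofilter underS_ofilter] by blast
qed

lemma less_omega_power_segment:
  assumes "(r, omega_power k) \<in> ordLess"
  obtains u where "length u = k" "(r, omega_segment k u) \<in> ordIso"
proof -
  have "Well_order r" using assms by (simp add: ordLess_def)
  then show ?thesis
    using ordLess_iff_ordIso_Restr[OF Well_order_omega_power] assms that
    unfolding omega_segment_def Field_omega_power by blast
qed

lemma less_omega_segment:
  assumes "(r, omega_segment k v) \<in> ordLess" "length v = k"
  obtains u where "u \<lless> v" "(r, omega_segment k u) \<in> ordIso"
proof -
  have "(r, omega_power k) \<in> ordLess"
    by (rule ordLess_transitive[OF assms(1) omega_segment_less_power])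
  then obtain u where u: "length u = k" "(r, omega_segment k u) \<in> ordIso"
    by (rule less_omega_power_segment)
  have "u \<lless> v"
  proof (rule ccontr)
    assume "\<not> u \<lless> v"
    then have "v = u \<or> (omega_segment k v, omega_segment k u) \<in> ordLess"
      using list_less_linear[of u v] u(1) assms(2) omega_segment_mono[of v u k] by auto
    moreover have "(omega_segment k u, omega_segment k v) \<in> ordLess"
      by (rule ordIso_ordLess_trans[OF ordIso_symmetric[OF u(2)] assms(1)])
    ultimately show False
      using ordLess_transitive ordLess_irreflexive by blast
  qed
  then show ?thesis using u(2) that by blast
qed

lemma not_less_omega_segment:
  assumes "(r, omega_segment k u) \<in> ordIso" "length u = k" "length v = k" "\<not> v \<lless> u"
  shows "(omega_segment k v, r) \<notin> ordLess"
proof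
  assume "(omega_segment k v, r) \<in> ordLess"
  then have vu: "(omega_segment k v, omega_segment k u) \<in> ordLess"
    by (rule ordLess_ordIso_trans[OF _ assms(1)])
  have "u = v \<or> u \<lless> v" using assms(2-4) list_less_linear by metis
  then show False
    using vu omega_segment_mono[of u v k] assms(3) ordLess_irreflexive ordLess_transitive by blast
qed

subsection \<open>Hilbert's basis theorem\<close>

definition is_subring :: "'r::comm_ring_1 set \<Rightarrow> bool" where
  "is_subring S \<longleftrightarrow> 1 \<in> S \<and> (\<forall>a\<in>S. \<forall>b\<in>S. a - b \<in> S \<and> a * b \<in> S)"

definition is_ideal :: "'r::comm_ring_1 set \<Rightarrow> 'r set \<Rightarrow> bool" where
  "is_ideal S I \<longleftrightarrow> I \<subseteq> S \<and> 0 \<in> I \<and> (\<forall>a\<in>I. \<forall>b\<in>I. a + b \<in> I) \<and> (\<forall>s\<in>S. \<forall>a\<in>I. s * a \<in> I)"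

text \<open>Generation by \<open>G\<close> is expressed through the ideals that contain
  \<open>G\<close>, which avoids linear combinations.\<close>

definition noetherian_on :: "'r::comm_ring_1 set \<Rightarrow> bool" where
  "noetherian_on S \<longleftrightarrow> (\<forall>I. is_ideal S I \<longrightarrow>
     (\<exists>G. finite G \<and> G \<subseteq> I \<and> (\<forall>J. is_ideal S J \<longrightarrow> G \<subseteq> J \<longrightarrow> I \<subseteq> J)))"

definition polys_over :: "'r::comm_ring_1 set \<Rightarrow> 'r poly set" where
  "polys_over S = {p. \<forall>i. coeff p i \<in> S}"

text \<open>The elements are values and not polynomials, so \<open>x\<close> may satisfy relations
  over \<open>S\<close>; arguments about degrees have to choose representing polynomials.\<close>

definition adjoin :: "'r::comm_ring_1 set \<Rightarrow> 'r \<Rightarrow> 'r set" where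
  "adjoin S x = (\<lambda>p. poly p x) ` polys_over S"

lemma is_subringD:
  assumes "is_subring S"
  shows "0 \<in> S" "1 \<in> S" "a \<in> S \<Longrightarrow> b \<in> S \<Longrightarrow> a + b \<in> S" "a \<in> S \<Longrightarrow> b \<in> S \<Longrightarrow> a - b \<in> S"
    "a \<in> S \<Longrightarrow> b \<in> S \<Longrightarrow> a * b \<in> S" "a \<in> S \<Longrightarrow> - a \<in> S" "a \<in> S \<Longrightarrow> a ^ n \<in> S"
proof -
  have d: "a - b \<in> S" if "a \<in> S" "b \<in> S" for a b
    using that assms by (simp add: is_subring_def)
  show one: "1 \<in> S" using assms by (simp add: is_subring_def)
  show zero: "0 \<in> S" using d[OF one one] by simp
  have m: "- a \<in> S" if "a \<in> S" for a using d[OF zero that] by simp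
  show "a + b \<in> S" if "a \<in> S" "b \<in> S" using d[OF that(1) m[OF that(2)]] by simp
  show "a \<in> S \<Longrightarrow> b \<in> S \<Longrightarrow> a - b \<in> S" by (rule d)
  show mult: "a * b \<in> S" if "a \<in> S" "b \<in> S" for a b
    using that assms by (simp add: is_subring_def)
  show "a \<in> S \<Longrightarrow> - a \<in> S" by (rule m)
  show "a \<in> S \<Longrightarrow> a ^ n \<in> S" by (induction n) (auto simp: one mult)
qed

lemma is_subring_sum:
  assumes "is_subring S" "\<And>i. i \<in> A \<Longrightarrow> f i \<in> S"
  shows "(\<Sum>i\<in>A. f i) \<in> S"
  using assms(2)
  by (induction A rule: infinite_finite_induct) (auto simp: is_subringD[OF assms(1)])

lemma is_idealD:
  assumes "is_ideal S I"
  shows "0 \<in> I" "a \<in> I \<Longrightarrow> a \<in> S" "a \<in> I \<Longrightarrow> b \<in> I \<Longrightarrow> a + b \<in> I"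
    "s \<in> S \<Longrightarrow> a \<in> I \<Longrightarrow> s * a \<in> I" "s \<in> S \<Longrightarrow> a \<in> I \<Longrightarrow> a * s \<in> I"
  using assms by (auto simp: is_ideal_def mult.commute)

lemma is_ideal_diff:
  assumes "is_subring S" "is_ideal S I" "a \<in> I" "b \<in> I"
  shows "a - b \<in> I"
proof -
  have "- 1 \<in> S" using is_subringD(2,6)[OF assms(1)] by blast
  then have "- 1 * b \<in> I" by (rule is_idealD(4)[OF assms(2) _ assms(4)])
  then show ?thesis using is_idealD(3)[OF assms(2,3), of "- b"] by simp
qed

lemma polys_over_closed:
  assumes "is_subring S"
  shows "0 \<in> polys_over S" "p \<in> polys_over S \<Longrightarrow> q \<in> polys_over S \<Longrightarrow> p + q \<in> polys_over S"
    "p \<in> polys_over S \<Longrightarrow> q \<in> polys_over S \<Longrightarrow> p - q \<in> polys_over S"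
    "p \<in> polys_over S \<Longrightarrow> q \<in> polys_over S \<Longrightarrow> p * q \<in> polys_over S"
    "s \<in> S \<Longrightarrow> p \<in> polys_over S \<Longrightarrow> smult s p \<in> polys_over S"
    "s \<in> S \<Longrightarrow> p \<in> polys_over S \<Longrightarrow> pCons s p \<in> polys_over S"
    "s \<in> S \<Longrightarrow> monom s n \<in> polys_over S"
  by (auto simp: polys_over_def is_subringD[OF assms] coeff_mult coeff_pCons coeff_monom
      intro!: is_subring_sum[OF assms] split: nat.splits)

lemma subset_adjoin: "is_subring S \<Longrightarrow> S \<subseteq> adjoin S x"
  unfolding adjoin_def
  by (auto intro!: image_eqI[of _ _ "[:s:]" for s] polys_over_closed)

lemma gen_in_adjoin: "is_subring S \<Longrightarrow> x \<in> adjoin S x"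
  unfolding adjoin_def
  by (rule image_eqI[of _ _ "[:0, 1:]"]) (auto intro!: polys_over_closed simp: is_subringD)

lemma is_subring_adjoin:
  assumes "is_subring S"
  shows "is_subring (adjoin S x)"
proof -
  have "poly p x - poly q x \<in> adjoin S x" "poly p x * poly q x \<in> adjoin S x"
    if "p \<in> polys_over S" "q \<in> polys_over S" for p q
    unfolding adjoin_def poly_diff[symmetric] poly_mult[symmetric]
    using polys_over_closed[OF assms] that by blast+
  then show ?thesis
    using subset_adjoin[OF assms, of x] is_subringD(2)[OF assms]
    unfolding is_subring_def by (auto simp: adjoin_def)
qed

text \<open>Since \<open>of_int\<close> need not be injective, the ideal is pulled back to an ideal
  \<open>D\<close> of the integers, which is principal by division with remainder.\<close>

lemma noetherian_on_ints: "noetherian_on (range of_int :: 'r::comm_ring_1 set)"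
  unfolding noetherian_on_def
proof (intro allI impI)
  fix I :: "'r set"
  assume I: "is_ideal (range of_int) I"
  define D where "D = {k. of_int k \<in> I}"
  have closed: "a + c * b \<in> D" if "a \<in> D" "b \<in> D" for a b c
    using that is_idealD[OF I] unfolding D_def by simp
  have zero: "0 \<in> D" using is_idealD(1)[OF I] by (simp add: D_def)
  obtain d where d: "d \<in> D" "\<And>k. k \<in> D \<Longrightarrow> d dvd k"
  proof (cases "\<exists>n::nat. n > 0 \<and> int n \<in> D")
    case False
    have "k = 0" if "k \<in> D" for k
    proof (rule ccontr)
      assume "k \<noteq> 0"
      moreover have "- k \<in> D" using closed[OF zero that, of "- 1"] by simp
      ultimately have "nat \<bar>k\<bar> > 0 \<and> int (nat \<bar>k\<bar>) \<in> D" using that by (auto simp: abs_if)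
      then show False using False by blast
    qed
    then show ?thesis using zero that[of 0] by auto
  next
    case True
    define n where "n = (LEAST n. n > 0 \<and> int n \<in> D)"
    have n: "n > 0" "int n \<in> D" using LeastI_ex[OF True] by (simp_all add: n_def)
    have "int n dvd k" if "k \<in> D" for k
    proof -
      have "k mod int n \<in> D"
        using closed[OF that n(2), of "- (k div int n)"] by (simp add: minus_div_mult_eq_mod[symmetric])
      then have "\<not> 0 < nat (k mod int n)"
        using not_less_Least[of "nat (k mod int n)" "\<lambda>n. n > 0 \<and> int n \<in> D"] n(1)
        by (auto simp: n_def[symmetric] nat_less_iff)
      then have "k mod int n = 0" using n(1) by (simp add: order_antisym)
      then show ?thesis by auto
    qed
    then show ?thesis using n that by blast
  qed
  have "I \<subseteq> J" if "is_ideal (range of_int) J" "of_int d \<in> J" for J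
  proof
    fix a assume "a \<in> I"
    then obtain k where k: "a = of_int k" "k \<in> D"
      using is_idealD(2)[OF I] by (auto simp: D_def)
    then obtain c where "k = d * c" using d(2) by blast
    then show "a \<in> J" using k(1) is_idealD(5)[OF that(1) _ that(2)] by simp
  qed
  then show "\<exists>G. finite G \<and> G \<subseteq> I \<and> (\<forall>J. is_ideal (range of_int) J \<longrightarrow> G \<subseteq> J \<longrightarrow> I \<subseteq> J)"
    using d(1) by (intro exI[of _ "{of_int d}"]) (auto simp: D_def)
qed

lemma finite_subset_chain_union:
  fixes A :: "nat \<Rightarrow> 'a set"
  assumes "finite F" "F \<subseteq> (\<Union>k. A k)" "\<And>k. A k \<subseteq> A (Suc k)"
  obtains K where "F \<subseteq> A K"
proof -
  have mono: "A k \<subseteq> A l" if "k \<le> l" for k l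
    by (rule lift_Suc_mono_le[of A, OF assms(3) that])
  have "\<exists>K. F \<subseteq> A K"
    using assms(1,2)
  proof (induction F)
    case (insert a F)
    then obtain K L where "F \<subseteq> A K" "a \<in> A L" by auto
    then have "insert a F \<subseteq> A (max K L)" using mono[of K "max K L"] mono[of L "max K L"] by auto
    then show ?case by blast
  qed simp
  then show ?thesis using that by blast
qed

text \<open>Two ideals \<open>J \<subseteq> I\<close> of \<open>S[x]\<close> with the same ideals of \<open>k\<close>-th leading coefficients, for all \<open>k\<close>, agree.\<close>

theorem noetherian_on_adjoin:
  assumes S: "is_subring S" and noeth: "noetherian_on S"
  shows "noetherian_on (adjoin S x)"
  unfolding noetherian_on_def
proof (intro allI impI)
  fix I assume I: "is_ideal (adjoin S x) I"
  note T = is_subring_adjoin[OF S, of x]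
  \<comment> \<open>Degree at most \<open>k\<close>, with a possibly vanishing coefficient at
    \<open>k\<close>, makes each \<open>lc J k\<close> an ideal; multiplication by \<open>x\<close>
    makes these ideals increase with \<open>k\<close>.\<close>
  define lc where "lc J k = (\<lambda>p. coeff p k) ` {p \<in> polys_over S. degree p \<le> k \<and> poly p x \<in> J}" for J k
  have lc_ideal: "is_ideal S (lc J k)" if J: "is_ideal (adjoin S x) J" for J k
    unfolding is_ideal_def
  proof (intro conjI ballI)
    show "lc J k \<subseteq> S" by (auto simp: lc_def polys_over_def)
    show "0 \<in> lc J k"
      unfolding lc_def by (rule image_eqI[of _ _ 0]) (auto simp: polys_over_closed[OF S] is_idealD[OF J])
  next
    fix a b assume "a \<in> lc J k" "b \<in> lc J k"
    then obtain p q where "a = coeff p k" "b = coeff q k" "p \<in> polys_over S" "q \<in> polys_over S"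
        "degree p \<le> k" "degree q \<le> k" "poly p x \<in> J" "poly q x \<in> J"
      by (auto simp: lc_def)
    then show "a + b \<in> lc J k"
      unfolding lc_def
      by (intro image_eqI[of _ _ "p + q"])
        (auto simp: polys_over_closed[OF S] is_idealD[OF J] degree_add_le)
  next
    fix s a assume s: "s \<in> S" and "a \<in> lc J k"
    then obtain p where p: "a = coeff p k" "p \<in> polys_over S" "degree p \<le> k" "poly p x \<in> J"
      by (auto simp: lc_def)
    have "s \<in> adjoin S x" using s subset_adjoin[OF S] by blast
    then show "s * a \<in> lc J k"
      unfolding lc_def using p s
      by (intro image_eqI[of _ _ "smult s p"])
        (auto simp: polys_over_closed[OF S] is_idealD[OF J] order_trans[OF degree_smult_le])
  qed
  have lc_Suc: "lc J k \<subseteq> lc J (Suc k)" if J: "is_ideal (adjoin S x) J" for J k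
  proof
    fix a assume "a \<in> lc J k"
    then obtain p where "a = coeff p k" "p \<in> polys_over S" "degree p \<le> k" "poly p x \<in> J"
      by (auto simp: lc_def)
    then show "a \<in> lc J (Suc k)"
      unfolding lc_def
      by (intro image_eqI[of _ _ "pCons 0 p"])
        (auto simp: polys_over_closed[OF S] is_idealD[OF J] gen_in_adjoin[OF S] is_subringD[OF S]
          order_trans[OF degree_pCons_le])
  qed
  have lc_mono: "lc J k \<subseteq> lc J l" if "is_ideal (adjoin S x) J" "k \<le> l" for J k l
    by (rule lift_Suc_mono_le[of "lc J", OF lc_Suc[OF that(1)] that(2)])
  define L where "L = (\<Union>k. lc I k)"
  have "is_ideal S L"
    unfolding is_ideal_def
  proof (intro conjI ballI)
    show "L \<subseteq> S" "0 \<in> L" using lc_ideal[OF I] unfolding L_def is_ideal_def by blast+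
  next
    fix a b assume "a \<in> L" "b \<in> L"
    then have "{a, b} \<subseteq> (\<Union>k. lc I k)" by (simp add: L_def)
    then obtain k where "{a, b} \<subseteq> lc I k"
      by (rule finite_subset_chain_union[of "{a, b}" "lc I", rotated]) (auto intro: lc_Suc[OF I, THEN subsetD])
    then show "a + b \<in> L" unfolding L_def using is_idealD(3)[OF lc_ideal[OF I, of k], of a b] by auto
  next
    fix s a assume "s \<in> S" "a \<in> L"
    then show "s * a \<in> L" unfolding L_def using is_idealD(4)[OF lc_ideal[OF I]] by blast
  qed
  then obtain F where F: "finite F" "F \<subseteq> L" "\<And>J. is_ideal S J \<Longrightarrow> F \<subseteq> J \<Longrightarrow> L \<subseteq> J"
    using noeth unfolding noetherian_on_def by meson
  \<comment> \<open>The union \<open>L\<close> is finitely generated, so the chain is constant from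
    \<open>K\<close> on and only finitely many generating sets have to be collected.\<close>
  obtain K where "F \<subseteq> lc I K"
    using finite_subset_chain_union[OF F(1) F(2)[unfolded L_def]] lc_Suc[OF I] by blast
  then have LK: "L \<subseteq> lc I K" using F(3) lc_ideal[OF I] by blast
  have "\<forall>k. \<exists>G. finite G \<and> G \<subseteq> lc I k \<and> (\<forall>J. is_ideal S J \<longrightarrow> G \<subseteq> J \<longrightarrow> lc I k \<subseteq> J)"
    using noeth lc_ideal[OF I] unfolding noetherian_on_def by simp
  then obtain G where G: "\<And>k. finite (G k)" "\<And>k. G k \<subseteq> lc I k"
      "\<And>k J. is_ideal S J \<Longrightarrow> G k \<subseteq> J \<Longrightarrow> lc I k \<subseteq> J"
    by metis
  have "\<forall>k. \<exists>q. \<forall>f\<in>G k. f = coeff (q f) k \<and> q f \<in> polys_over S \<and> degree (q f) \<le> k \<and> poly (q f) x \<in> I"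
    using G(2) unfolding lc_def by (intro allI bchoice) blast
  then obtain q where q: "\<And>k f. f \<in> G k \<Longrightarrow>
      f = coeff (q k f) k \<and> q k f \<in> polys_over S \<and> degree (q k f) \<le> k \<and> poly (q k f) x \<in> I"
    by metis
  define B where "B = (\<Union>k\<in>{..K}. (\<lambda>f. poly (q k f) x) ` G k)"
  have "I \<subseteq> J" if J: "is_ideal (adjoin S x) J" and BJ: "B \<subseteq> J" for J
  proof -
    \<comment> \<open>Comparing \<open>I\<close> with \<open>I \<inter> J\<close> provides
      polynomials whose values lie in both ideals, so the differences formed below stay in
      \<open>I\<close>.\<close>
    have IJ: "is_ideal (adjoin S x) (I \<inter> J)" using I J by (auto simp: is_ideal_def)
    have low: "lc I k \<subseteq> lc (I \<inter> J) k" if k: "k \<le> K" for k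
    proof (rule G(3)[OF lc_ideal[OF IJ]])
      show "G k \<subseteq> lc (I \<inter> J) k"
      proof
        fix f assume f: "f \<in> G k"
        have "poly (q k f) x \<in> J" using BJ k f by (auto simp: B_def)
        then show "f \<in> lc (I \<inter> J) k"
          unfolding lc_def using q[OF f] by (intro image_eqI[of _ _ "q k f"]) auto
      qed
    qed
    have lcs: "lc I k \<subseteq> lc (I \<inter> J) k" for k
    proof (cases "k \<le> K")
      case False
      have "lc I k \<subseteq> lc I K" using LK by (auto simp: L_def)
      then show ?thesis using low[of K] lc_mono[OF IJ, of K k] False by auto
    qed (rule low)
    have "poly p x \<in> J" if "\<forall>i\<ge>n. coeff p i = 0" "p \<in> polys_over S" "poly p x \<in> I" for p n
      using that
    proof (induction n arbitrary: p)
      case 0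
      then have "p = 0" by (simp add: poly_eq_iff)
      then show ?case using is_idealD(1)[OF J] by simp
    next
      case (Suc n)
      have "degree p \<le> n" using Suc.prems(1) by (intro degree_le) auto
      then have "coeff p n \<in> lc I n" using Suc.prems by (auto simp: lc_def)
      then obtain p' where p': "coeff p n = coeff p' n" "p' \<in> polys_over S" "degree p' \<le> n"
          "poly p' x \<in> I" "poly p' x \<in> J"
        using lcs unfolding lc_def by blast
      have "coeff (p - p') i = 0" if "i \<ge> n" for i
        using that p'(1,3) \<open>degree p \<le> n\<close> by (cases "i = n") (auto simp: coeff_eq_0)
      moreover have "poly (p - p') x \<in> I"
        using is_ideal_diff[OF T I] Suc.prems p' by simp
      ultimately have "poly (p - p') x \<in> J"
        using Suc.IH polys_over_closed(3)[OF S] Suc.prems(2) p'(2) by blast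
      then show ?case using is_idealD(3)[OF J _ p'(5)] by fastforce
    qed
    then have *: "poly p x \<in> J" if "p \<in> polys_over S" "poly p x \<in> I" for p
      using that coeff_eq_0[of p] by (metis Suc_le_eq)
    show ?thesis
    proof
      fix a assume a: "a \<in> I"
      then obtain p where "p \<in> polys_over S" "a = poly p x"
        using is_idealD(2)[OF I] unfolding adjoin_def by blast
      then show "a \<in> J" using * a by blast
    qed
  qed
  moreover have "finite B" "B \<subseteq> I" using G(1) q by (auto simp: B_def)
  ultimately show "\<exists>G. finite G \<and> G \<subseteq> I \<and> (\<forall>J. is_ideal (adjoin S x) J \<longrightarrow> G \<subseteq> J \<longrightarrow> I \<subseteq> J)"
    by blast
qed

fun int_adjoin :: "'r::comm_ring_1 list \<Rightarrow> 'r set" where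
  "int_adjoin [] = range of_int"
| "int_adjoin (x # xs) = adjoin (int_adjoin xs) x"

lemma is_subring_int_adjoin: "is_subring (int_adjoin xs)"
proof (induction xs)
  case Nil
  have "of_int a - of_int b \<in> (range of_int :: 'a set)" "of_int a * of_int b \<in> (range of_int :: 'a set)" for a b
    unfolding of_int_diff[symmetric] of_int_mult[symmetric] by blast+
  moreover have "(1 :: 'a) \<in> range of_int" by (metis of_int_1 rangeI)
  ultimately show ?case by (auto simp: is_subring_def)
qed (simp add: is_subring_adjoin)

lemma noetherian_on_int_adjoin: "noetherian_on (int_adjoin xs)"
  by (induction xs) (simp_all add: noetherian_on_ints noetherian_on_adjoin is_subring_int_adjoin)

lemma set_subset_int_adjoin: "set xs \<subseteq> int_adjoin xs"
proof (induction xs)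
  case (Cons x xs)
  then show ?case
    using subset_adjoin[OF is_subring_int_adjoin, of xs x] gen_in_adjoin[OF is_subring_int_adjoin, of x xs]
    by auto
qed simp

subsection \<open>Finitely generated rings modulo maximal ideals are finite\<close>

definition is_prime :: "'r::comm_ring_1 set \<Rightarrow> bool" where
  "is_prime P \<longleftrightarrow> is_ideal UNIV P \<and> 1 \<notin> P \<and> (\<forall>a b. a * b \<in> P \<longrightarrow> a \<in> P \<or> b \<in> P)"

text \<open>For an ideal \<open>M\<close>, the image of \<open>A\<close> in R/M is finite. Neither
  set has to contain the other, so the notion serves for subrings as well as for quotients of
  ideals.\<close>

definition finite_mod :: "'r::comm_ring_1 set \<Rightarrow> 'r set \<Rightarrow> bool" where
  "finite_mod M A \<longleftrightarrow> (\<exists>F. finite F \<and> (\<forall>a\<in>A. \<exists>f\<in>F. a - f \<in> M))"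

lemma is_subring_UNIV: "is_subring UNIV"
  by (simp add: is_subring_def)

text \<open>The leading coefficient of \<open>u\<close> need not be invertible, so \<open>p\<close>
  is multiplied by it once for each cancelled coefficient. Bounding the remainder by vanishing
  coefficients instead of by its degree includes \<open>degree u = 0\<close>, where it is 0.\<close>

lemma pseudo_division:
  assumes S: "is_subring S" and u: "u \<in> polys_over S" and p: "p \<in> polys_over S"
  shows "\<exists>e. \<exists>q\<in>polys_over S. \<exists>r\<in>polys_over S.
    smult (lead_coeff u ^ e) p = q * u + r \<and> (\<forall>i\<ge>degree u. coeff r i = 0)"
proof -
  note cl = polys_over_closed[OF S]
  let ?l = "lead_coeff u" and ?d = "degree u"
  have l: "?l \<in> S" using u by (simp add: polys_over_def)
  have "\<exists>e. \<exists>q\<in>polys_over S. \<exists>r\<in>polys_over S.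
      smult (?l ^ e) p = q * u + r \<and> (\<forall>i\<ge>?d. coeff r i = 0)"
    if "\<forall>i\<ge>n. coeff p i = 0" "p \<in> polys_over S" for n p
    using that
  proof (induction n arbitrary: p)
    case 0
    then have "p = 0" by (simp add: poly_eq_iff)
    then show ?case by (intro exI[of _ 0] bexI[of _ 0]) (auto simp: cl)
  next
    case (Suc n)
    show ?case
    proof (cases "n < ?d")
      case True
      then show ?thesis
        using Suc.prems by (intro exI[of _ 0] bexI[of _ 0] bexI[of _ p]) (auto simp: cl)
    next
      case False
      define m where "m = monom (coeff p n) (n - ?d)"
      have m: "m \<in> polys_over S"
        using Suc.prems(2) unfolding m_def by (intro cl(7)) (simp add: polys_over_def)
      define p1 where "p1 = smult ?l p - m * u"
      have "coeff p1 i = 0" if "i \<ge> n" for i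
      proof -
        have "coeff (m * u) i = coeff p n * coeff u (i - (n - ?d))"
          using that by (simp add: m_def coeff_monom_mult)
        moreover have "i - (n - ?d) > ?d" if "i \<noteq> n" using that \<open>i \<ge> n\<close> False by simp
        ultimately show ?thesis
          using that False Suc.prems(1) by (cases "i = n") (auto simp: p1_def coeff_eq_0)
      qed
      moreover have "p1 \<in> polys_over S" unfolding p1_def using Suc.prems(2) l m u by (intro cl)
      ultimately obtain e q r where r: "q \<in> polys_over S" "r \<in> polys_over S"
          "smult (?l ^ e) p1 = q * u + r" "\<forall>i\<ge>?d. coeff r i = 0"
        using Suc.IH[of p1] by blast
      have "smult (?l ^ Suc e) p = smult (?l ^ e) (p1 + m * u)"
        by (simp add: p1_def mult.commute)
      also have "\<dots> = (q + smult (?l ^ e) m) * u + r"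
        by (simp add: smult_add_right r(3) algebra_simps)
      finally show ?thesis
        using r cl(2)[OF r(1) cl(5)[OF is_subringD(7)[OF S l] m]] by blast
    qed
  qed
  then show ?thesis using p coeff_eq_0[of p] by (metis Suc_le_eq)
qed

section \<open>Congruences modulo a prime ideal\<close>

locale prime_modulus =
  fixes M :: "'r::comm_ring_1 set"
  assumes prime: "is_prime M"
begin

abbreviation cong_mod (infix "\<doteq>" 50) where "a \<doteq> b \<equiv> a - b \<in> M"

lemma ideal: "is_ideal UNIV M" and one_notin: "1 \<notin> M"
  using prime by (auto simp: is_prime_def)

lemma zero_in: "0 \<in> M"
  and add_in: "a \<in> M \<Longrightarrow> b \<in> M \<Longrightarrow> a + b \<in> M"
  and diff_in: "a \<in> M \<Longrightarrow> b \<in> M \<Longrightarrow> a - b \<in> M"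
  and mult_in: "a \<in> M \<Longrightarrow> c * a \<in> M" "a \<in> M \<Longrightarrow> a * c \<in> M"
  using is_idealD[OF ideal] is_ideal_diff[OF is_subring_UNIV ideal] by simp_all

lemma prime_mult: "a * b \<in> M \<longleftrightarrow> a \<in> M \<or> b \<in> M"
  using prime mult_in by (auto simp: is_prime_def)

lemma power_in_iff: "a ^ n \<in> M \<longleftrightarrow> n > 0 \<and> a \<in> M"
  by (induction n) (auto simp: one_notin prime_mult)

lemma cong_refl: "a \<doteq> a" by (simp add: zero_in)

lemma cong_sym: "a \<doteq> b \<Longrightarrow> b \<doteq> a"
  using diff_in[OF zero_in, of "a - b"] by simp

lemma cong_trans [trans]: "a \<doteq> b \<Longrightarrow> b \<doteq> c \<Longrightarrow> a \<doteq> c"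
  using add_in[of "a - b" "b - c"] by simp

lemma cong_eq_trans [trans]: "a \<doteq> b \<Longrightarrow> b = c \<Longrightarrow> a \<doteq> c" "a = b \<Longrightarrow> b \<doteq> c \<Longrightarrow> a \<doteq> c"
  by simp_all

lemma cong_in_iff: "a \<doteq> b \<Longrightarrow> a \<in> M \<longleftrightarrow> b \<in> M"
  using add_in[of "a - b" b] diff_in[of a "a - b"] by auto

lemma cong_mult: "a \<doteq> b \<Longrightarrow> c \<doteq> d \<Longrightarrow> a * c \<doteq> b * d"
  using add_in[OF mult_in(2)[of "a - b" c] mult_in(1)[of "c - d" b]] by (simp add: algebra_simps)

lemma cong_diff: "a \<doteq> b \<Longrightarrow> c \<doteq> d \<Longrightarrow> a - c \<doteq> b - d"
  using diff_in[of "a - b" "c - d"] by (simp add: algebra_simps)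

lemma cong_power: "a \<doteq> b \<Longrightarrow> a ^ n \<doteq> b ^ n"
  by (induction n) (auto simp: zero_in intro: cong_mult)

lemma sum_in: "(\<And>i. i \<in> A \<Longrightarrow> f i \<in> M) \<Longrightarrow> (\<Sum>i\<in>A. f i) \<in> M"
  by (induction A rule: infinite_finite_induct) (auto simp: zero_in intro: add_in)

lemma cong_sum: "(\<And>i. i \<in> A \<Longrightarrow> f i \<doteq> g i) \<Longrightarrow> (\<Sum>i\<in>A. f i) \<doteq> (\<Sum>i\<in>A. g i)"
  unfolding sum_subtractf[symmetric] by (rule sum_in)

lemma polys_over_mult: "p \<in> polys_over M \<Longrightarrow> q * p \<in> polys_over M"
  by (auto simp: polys_over_def coeff_mult intro!: sum_in mult_in(1))

lemma polys_over_add: "p \<in> polys_over M \<Longrightarrow> q \<in> polys_over M \<Longrightarrow> p + q \<in> polys_over M"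
  by (simp add: polys_over_def add_in)

lemma polys_over_diff: "p \<in> polys_over M \<Longrightarrow> q \<in> polys_over M \<Longrightarrow> p - q \<in> polys_over M"
  by (simp add: polys_over_def diff_in)

lemma poly_in: "p \<in> polys_over M \<Longrightarrow> poly p x \<in> M"
  unfolding polys_over_def poly_altdef by (auto intro!: sum_in mult_in)

lemma poly_cong: "p - q \<in> polys_over M \<Longrightarrow> poly p x \<doteq> poly q x"
  using poly_in[of "p - q" x] by simp

text \<open>Dropping leading coefficients that lie in \<open>M\<close> gives a representative with
  the degree of the image in (R/M)[X]. Degree arguments modulo \<open>M\<close> then work without a
  quotient ring.\<close>

lemma truncate:
  assumes S: "is_subring S" and "p \<in> polys_over S"
  shows "\<exists>p'\<in>polys_over S. p - p' \<in> polys_over M \<and> (p' = 0 \<or> lead_coeff p' \<notin> M)"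
proof -
  note cl = polys_over_closed[OF S]
  have "\<exists>p'\<in>polys_over S. p - p' \<in> polys_over M \<and> (p' = 0 \<or> lead_coeff p' \<notin> M)"
    if "\<forall>i\<ge>n. coeff p i = 0" "p \<in> polys_over S" for n p
    using that
  proof (induction n arbitrary: p)
    case 0
    then have "p = 0" by (simp add: poly_eq_iff)
    then show ?case by (intro bexI[of _ 0]) (auto simp: cl, auto simp: polys_over_def zero_in)
  next
    case (Suc n)
    show ?case
    proof (cases "coeff p n \<in> M")
      case True
      define m where "m = monom (coeff p n) n"
      have m: "m \<in> polys_over S" "m \<in> polys_over M"
        using Suc.prems(2) True by (auto simp: m_def polys_over_def coeff_monom zero_in is_subringD[OF S])
      have "\<forall>i\<ge>n. coeff (p - m) i = 0" using Suc.prems(1) by (auto simp: m_def coeff_monom)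
      then obtain p' where p': "p' \<in> polys_over S" "p - m - p' \<in> polys_over M" "p' = 0 \<or> lead_coeff p' \<notin> M"
        using Suc.IH[of "p - m"] cl(3)[OF Suc.prems(2) m(1)] by blast
      have "p - p' = (p - m - p') + m" by simp
      also have "\<dots> \<in> polys_over M" using polys_over_add[OF p'(2) m(2)] .
      finally have "p - p' \<in> polys_over M" .
      then show ?thesis using p' by blast
    next
      case False
      then have "degree p = n"
        using Suc.prems(1) zero_in by (intro order_antisym degree_le) (auto intro: le_degree)
      then show ?thesis using False Suc.prems(2) by (intro bexI[of _ p]) (auto simp: polys_over_def zero_in)
    qed
  qed
  then show ?thesis using assms(2) coeff_eq_0[of p] by (metis Suc_le_eq)
qed

lemma coeff_cong: "p - q \<in> polys_over M \<Longrightarrow> coeff p i \<doteq> coeff q i"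
  by (simp add: polys_over_def)

text \<open>Over the domain R/M degrees add up, so a multiple of the nonconstant \<open>Y\<close>
  can be constant only if it vanishes.\<close>

lemma not_unit_mod:
  assumes Y: "lead_coeff Y \<notin> M" "degree Y > 0" and W: "Y * W - [:c:] \<in> polys_over M"
  shows "c \<in> M"
proof -
  have "W \<in> polys_over UNIV" by (simp add: polys_over_def)
  then obtain W' where W': "W - W' \<in> polys_over M" "W' = 0 \<or> lead_coeff W' \<notin> M"
    using truncate[OF is_subring_UNIV] by blast
  have "Y * W' - [:c:] = (Y * W - [:c:]) - Y * (W - W')" by (simp add: algebra_simps)
  also have "\<dots> \<in> polys_over M" by (rule polys_over_diff[OF W polys_over_mult[OF W'(1)]])
  finally have *: "Y * W' - [:c:] \<in> polys_over M" .
  show ?thesis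
  proof (cases "W' = 0")
    case True
    then show ?thesis using coeff_cong[OF *, of 0] diff_in[OF zero_in, of "- c"] by simp
  next
    case False
    have "coeff (Y * W') (degree Y + degree W') \<doteq> coeff [:c:] (degree Y + degree W')"
      by (rule coeff_cong[OF *])
    then have "lead_coeff Y * lead_coeff W' \<in> M"
      using Y(2) by (simp add: coeff_mult_degree_sum coeff_pCons split: nat.splits)
    then show ?thesis using False W' Y(1) by (simp add: prime_mult)
  qed
qed

text \<open>
  If \<open>x\<close> were transcendental modulo \<open>M\<close>, then \<open>1 + x t\<close>, being a divisor of a power
  of \<open>t\<close>, would be a unit of a polynomial ring, although it is not constant.
\<close>

lemma algebraic_if_localization_field:
  assumes S: "is_subring S" and t: "t \<in> adjoin S x" "t \<notin> M"
    and field: "\<And>y. y \<in> adjoin S x \<Longrightarrow> y \<notin> M \<Longrightarrow> \<exists>z\<in>adjoin S x. \<exists>m. y * z \<doteq> t ^ m"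
  shows "\<exists>p\<in>polys_over S. lead_coeff p \<notin> M \<and> poly p x \<in> M"
proof (rule ccontr)
  assume none: "\<not> ?thesis"
  note cl = polys_over_closed[OF S]
  \<comment> \<open>Without an algebraic equation, evaluation at \<open>x\<close> is injective
    modulo \<open>M\<close> on polynomials over \<open>S\<close>, so congruences of values lift to
    congruences of polynomials.\<close>
  have transc: "p \<in> polys_over M" if p: "p \<in> polys_over S" "poly p x \<in> M" for p
  proof -
    obtain p' where p': "p' \<in> polys_over S" "p - p' \<in> polys_over M" "p' = 0 \<or> lead_coeff p' \<notin> M"
      using truncate[OF S p(1)] by blast
    have "poly p' x \<in> M" using poly_in[OF p'(2), of x] p(2) cong_in_iff[of "poly p x"] by simp
    then have "p' = 0" using none p' by blast
    then show ?thesis using p'(2) by simp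
  qed
  obtain tp0 where "tp0 \<in> polys_over S" "t = poly tp0 x" using t(1) by (auto simp: adjoin_def)
  then obtain tp where tp: "tp \<in> polys_over S" "t \<doteq> poly tp x" "tp = 0 \<or> lead_coeff tp \<notin> M"
    using truncate[OF S] poly_in by (metis poly_diff)
  have "poly tp x \<notin> M" using t(2) cong_in_iff[OF tp(2)] by simp
  then have "tp \<noteq> 0" using zero_in by auto
  then have ltp: "lead_coeff tp \<notin> M" using tp(3) by blast
  define Y where "Y = pCons 1 tp"
  have Y: "Y \<in> polys_over S" "lead_coeff Y \<notin> M" "degree Y > 0"
    using ltp \<open>tp \<noteq> 0\<close> tp(1) by (auto simp: Y_def is_subringD[OF S] intro: cl)
  have "Y \<notin> polys_over M" using Y(2) by (auto simp: polys_over_def)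
  then have "poly Y x \<notin> M" using transc Y(1) by blast
  then obtain z m where z: "z \<in> adjoin S x" "poly Y x * z \<doteq> t ^ m"
    using field[of "poly Y x"] Y(1) by (auto simp: adjoin_def)
  then obtain w where w: "w \<in> polys_over S" "z = poly w x" by (auto simp: adjoin_def)
  have pow: "q ^ n \<in> polys_over S" if "q \<in> polys_over S" for q n
    by (induction n) (auto simp: that cl one_pCons is_subringD[OF S])
  have "poly (Y * w - tp ^ m) x \<in> M"
    using cong_trans[OF z(2) cong_power[OF tp(2)]] by (simp add: w(2))
  then have 1: "Y * w - tp ^ m \<in> polys_over M"
    using w(1) Y(1) tp(1) by (intro transc cl pow)
  \<comment> \<open>Hence X^m t^m = (Y - 1)^m, which is (-1)^m modulo \<open>Y\<close>. As
    \<open>Y\<close> divides t^m modulo \<open>M\<close>, it also divides this constant.\<close>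
  have "Y - 1 = monom 1 1 * tp"
    by (simp add: Y_def monom_altdef one_pCons)
  then have 2: "monom 1 1 ^ m * tp ^ m = (Y - 1) ^ m" by (simp add: power_mult_distrib)
  obtain Q where Q: "(Y - 1) ^ m - (- 1) ^ m = Y * Q"
    using power_diff_sumr2[of "Y - 1" m "- 1"] by auto
  have "Y * (monom 1 1 ^ m * w - Q) - [:(- 1) ^ m:] = monom 1 1 ^ m * (Y * w - tp ^ m)"
  proof -
    have "[:(- 1) ^ m:] = (- 1 :: 'r poly) ^ m" by (simp add: one_pCons flip: poly_const_pow)
    then show ?thesis using 2 Q by (simp add: algebra_simps)
  qed
  then have "(- 1) ^ m \<in> M"
    using not_unit_mod[OF Y(2,3)] polys_over_mult[OF 1] by metis
  then have "- 1 \<in> M" by (simp add: power_in_iff)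
  then show False using diff_in[OF zero_in, of "- 1"] one_notin by simp
qed

text \<open>
  Let \<open>k\<close> be the least degree of an algebraic equation of \<open>x\<close>. Some power of its leading coefficient
  brings every element of \<open>S[x]\<close> to the form \<open>z\<^sub>0 + \<dots> + z\<^sub>k\<^sub>-\<^sub>1 x\<^sup>k\<^sup>-\<^sup>1\<close>, and these forms are unique.
  So an equation \<open>y z \<doteq> a\<close> with \<open>y, a \<in> S\<close> can be solved in \<open>S\<close> by comparing coefficients of \<open>x\<^sup>0\<close>.
\<close>

lemma localization_field_descends:
  assumes S: "is_subring S" and t: "t \<in> adjoin S x" "t \<notin> M"
    and field: "\<And>y. y \<in> adjoin S x \<Longrightarrow> y \<notin> M \<Longrightarrow> \<exists>z\<in>adjoin S x. \<exists>m. y * z \<doteq> t ^ m"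
  shows "\<exists>s\<in>S. s \<notin> M \<and> (\<forall>y\<in>S. y \<notin> M \<longrightarrow> (\<exists>z\<in>S. \<exists>m. y * z \<doteq> s ^ m))"
proof -
  note cl = polys_over_closed[OF S]
  note T = is_subring_adjoin[OF S, of x]
  have inT: "poly p x \<in> adjoin S x" if "p \<in> polys_over S" for p
    using that by (auto simp: adjoin_def)
  define R where "R p \<longleftrightarrow> p \<in> polys_over S \<and> lead_coeff p \<notin> M \<and> poly p x \<in> M" for p
  have "\<exists>p. R p" using algebraic_if_localization_field[OF assms] by (auto simp: R_def)
  then obtain p where p: "R p" "\<And>q. R q \<Longrightarrow> degree p \<le> degree q"
    using ex_has_least_nat[of R _ degree] by blast
  have pS: "p \<in> polys_over S" and lp: "lead_coeff p \<notin> M" and px: "poly p x \<in> M"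
    using p(1) by (auto simp: R_def)
  have "degree p > 0"
  proof (rule ccontr)
    assume "\<not> degree p > 0"
    then show False using px lp by (auto elim: degree_eq_zeroE)
  qed
  have small: "\<exists>q'. R q' \<and> q - q' \<in> polys_over M" if q: "q \<in> polys_over S" "poly q x \<in> M" "q \<notin> polys_over M" for q
  proof -
    obtain q' where q': "q' \<in> polys_over S" "q - q' \<in> polys_over M" "q' = 0 \<or> lead_coeff q' \<notin> M"
      using truncate[OF S q(1)] by blast
    have "poly q' x \<in> M" using cong_in_iff[OF poly_cong[OF q'(2)]] q(2) by simp
    then show ?thesis using q' q(3) by (auto simp: R_def)
  qed
  have indep: "q \<in> polys_over M"
    if q: "q \<in> polys_over S" "poly q x \<in> M" "\<forall>i\<ge>degree p. coeff q i = 0" for q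
  proof (rule ccontr)
    assume "q \<notin> polys_over M"
    then obtain q' where q': "R q'" "q - q' \<in> polys_over M" using small q by blast
    have "lead_coeff q' \<in> M"
      using coeff_cong[OF q'(2), of "degree q'"] q(3) p(2)[OF q'(1)] diff_in[OF zero_in, of "- lead_coeff q'"]
      by simp
    then show False using q'(1) by (simp add: R_def)
  qed
  \<comment> \<open>The aim is a nonzero element of \<open>S\<close> that is a multiple of
    \<open>t\<close> modulo \<open>M\<close>. It arises as a polynomial of least degree among those
    whose value is such a multiple, once this degree is shown to be 0.\<close>
  define U where "U u \<longleftrightarrow> u \<in> polys_over S \<and> lead_coeff u \<notin> M \<and> (\<exists>w\<in>adjoin S x. poly u x \<doteq> t * w)" for u
  obtain tp where tp: "tp \<in> polys_over S" "t = poly tp x" using t(1) by (auto simp: adjoin_def)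
  obtain tp' where tp': "tp' \<in> polys_over S" "tp - tp' \<in> polys_over M" "tp' = 0 \<or> lead_coeff tp' \<notin> M"
    using truncate[OF S tp(1)] by blast
  have "poly tp' x \<notin> M" using cong_in_iff[OF poly_cong[OF tp'(2)]] t(2) tp(2) by simp
  then have "lead_coeff tp' \<notin> M" using tp'(3) zero_in by auto
  moreover have "poly tp' x \<doteq> t * 1" using cong_sym[OF poly_cong[OF tp'(2)]] tp(2) by simp
  ultimately have "U tp'" using tp'(1) is_subringD(2)[OF T] unfolding U_def by blast
  then obtain u where u: "U u" "\<And>v. U v \<Longrightarrow> degree u \<le> degree v"
    using ex_has_least_nat[of U _ degree] by blast
  then obtain w where uS: "u \<in> polys_over S" and lu: "lead_coeff u \<notin> M"
    and w: "w \<in> adjoin S x" "poly u x \<doteq> t * w"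
    by (auto simp: U_def)
  have rem: "r \<in> polys_over M" if r: "r \<in> polys_over S" "\<forall>i\<ge>degree u. coeff r i = 0"
    "v \<in> adjoin S x" "poly r x \<doteq> t * v" for r v
  proof -
    obtain r' where r': "r' \<in> polys_over S" "r - r' \<in> polys_over M" "r' = 0 \<or> lead_coeff r' \<notin> M"
      using truncate[OF S r(1)] by blast
    have "r' = 0"
    proof (rule ccontr)
      assume "r' \<noteq> 0"
      then have lr': "lead_coeff r' \<notin> M" using r'(3) by simp
      have "poly r' x \<doteq> t * v"
        using cong_trans[OF cong_sym[OF poly_cong[OF r'(2)]] r(4)] .
      then have "degree u \<le> degree r'" using r'(1) lr' r(3) by (intro u(2)) (auto simp: U_def)
      then have "lead_coeff r' \<in> M"
        using coeff_cong[OF r'(2), of "degree r'"] r(2) diff_in[OF zero_in, of "- lead_coeff r'"] by simp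
      then show False using lr' by simp
    qed
    then show ?thesis using r'(2) by simp
  qed
  \<comment> \<open>The remainder vanishes modulo \<open>M\<close> by minimality of
    \<open>u\<close>, so \<open>q * u\<close> is \<open>p\<close> up to a nonzero constant. As
    \<open>poly u x\<close> will be nonzero, \<open>q\<close> gives an equation of \<open>x\<close>,
    and minimality of \<open>p\<close> leaves no room for a nonconstant \<open>u\<close>.\<close>
  obtain e q r where qr: "q \<in> polys_over S" "r \<in> polys_over S"
      "smult (lead_coeff u ^ e) p = q * u + r" "\<forall>i\<ge>degree u. coeff r i = 0"
    using pseudo_division[OF S uS pS] by blast
  have lue: "lead_coeff u ^ e \<notin> M" for e using lu by (simp add: power_in_iff)
  have "r \<in> polys_over M"
  proof (rule rem[OF qr(2,4)])
    show "- (poly q x * w) \<in> adjoin S x"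
      by (intro is_subringD(5,6)[OF T] inT qr(1) w(1))
    have "poly (q * u + r) x \<in> M" unfolding qr(3)[symmetric] using mult_in(1)[OF px] by simp
    then show "poly r x \<doteq> t * - (poly q x * w)"
      using diff_in[OF _ mult_in(1)[OF w(2), of "poly q x"], of "poly (q * u + r) x"]
      by (simp add: algebra_simps)
  qed
  \<comment> \<open>Otherwise the remainder of \<open>tp\<close> by \<open>u\<close> would have the
    value \<open>lead_coeff u ^ e' * t\<close> modulo \<open>M\<close>. This value is a multiple of
    \<open>t\<close>, so the remainder would vanish modulo \<open>M\<close> by minimality of
    \<open>u\<close>, and \<open>t\<close> would lie in \<open>M\<close>.\<close>
  have "poly u x \<notin> M"
  proof
    assume ux: "poly u x \<in> M"
    obtain e' q' r' where qr': "q' \<in> polys_over S" "r' \<in> polys_over S"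
        "smult (lead_coeff u ^ e') tp = q' * u + r'" "\<forall>i\<ge>degree u. coeff r' i = 0"
      using pseudo_division[OF S uS tp(1)] by blast
    have eq: "lead_coeff u ^ e' * t = poly q' x * poly u x + poly r' x"
      using arg_cong[OF qr'(3), of "\<lambda>p. poly p x"] by (simp add: tp(2))
    have "r' \<in> polys_over M"
    proof (rule rem[OF qr'(2,4)])
      have "lead_coeff u \<in> adjoin S x" using uS subset_adjoin[OF S, of x] by (auto simp: polys_over_def)
      then show "lead_coeff u ^ e' - poly q' x * w \<in> adjoin S x"
        by (intro is_subringD(4,5,7)[OF T] inT qr'(1) w(1))
      show "poly r' x \<doteq> t * (lead_coeff u ^ e' - poly q' x * w)"
        using diff_in[OF zero_in mult_in(1)[OF w(2), of "poly q' x"]] eq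
        by (simp add: algebra_simps)
    qed
    then have "lead_coeff u ^ e' * t \<in> M"
      unfolding eq by (rule add_in[OF mult_in(1)[OF ux] poly_in])
    then show False using lue t(2) by (simp add: prime_mult)
  qed
  moreover have "poly q x * poly u x \<in> M"
    using diff_in[OF mult_in(1)[OF px, of "lead_coeff u ^ e"] poly_in[OF \<open>r \<in> polys_over M\<close>, of x]]
      arg_cong[OF qr(3), of "\<lambda>p. poly p x"] by simp
  ultimately have qx: "poly q x \<in> M" by (simp add: prime_mult)
  have "q \<notin> polys_over M"
  proof
    assume "q \<in> polys_over M"
    then have "smult (lead_coeff u ^ e) p \<in> polys_over M"
      unfolding qr(3) using polys_over_add polys_over_mult[of q u] \<open>r \<in> polys_over M\<close>
      by (simp add: mult.commute)
    then have "lead_coeff u ^ e * lead_coeff p \<in> M" by (simp add: polys_over_def)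
    then show False using lue lp by (simp add: prime_mult)
  qed
  then obtain q' where q': "R q'" "q - q' \<in> polys_over M" using small[OF qr(1) qx] by blast
  have "degree u = 0"
  proof (rule ccontr)
    assume "degree u \<noteq> 0"
    then have "degree q' + degree u > degree p" using p(2)[OF q'(1)] by simp
    then have "coeff (q * u + r) (degree q' + degree u) = 0"
      unfolding qr(3)[symmetric] by (simp add: coeff_eq_0)
    moreover have "(q * u + r) - q' * u = u * (q - q') + r" by (simp add: algebra_simps)
    then have "(q * u + r) - q' * u \<in> polys_over M"
      using polys_over_add[OF polys_over_mult[OF q'(2)] \<open>r \<in> polys_over M\<close>] by metis
    ultimately have "lead_coeff q' * lead_coeff u \<in> M"
      using coeff_cong[of "q * u + r" "q' * u" "degree q' + degree u"]
        diff_in[OF zero_in, of "- (lead_coeff q' * lead_coeff u)"]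
      by (simp add: coeff_mult_degree_sum)
    then show False using q'(1) lu by (simp add: prime_mult R_def)
  qed
  then obtain s0 where s0: "u = [:s0:]" by (auto elim: degree_eq_zeroE)
  have s0': "s0 \<in> S" "s0 \<notin> M" "t * w \<doteq> s0"
    using uS lu cong_sym[OF w(2)] by (auto simp: s0 polys_over_def dest: spec[of _ 0])
  \<comment> \<open>The element to be inverted in \<open>S\<close> is \<open>c * s0\<close>: a power
    of \<open>s0\<close> replaces the power of \<open>t\<close>, and a power of \<open>c\<close>
    pays for the pseudo-division by \<open>p\<close>.\<close>
  define c where "c = lead_coeff p"
  have c: "c \<in> S" "c \<notin> M" using pS lp by (auto simp: c_def polys_over_def)
  have "\<exists>z\<in>S. \<exists>m. y * z \<doteq> (c * s0) ^ m" if y: "y \<in> S" "y \<notin> M" for y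
  proof -
    have "y \<in> adjoin S x" using y(1) subset_adjoin[OF S, of x] by blast
    then obtain z m where z: "z \<in> adjoin S x" "y * z \<doteq> t ^ m" using field y(2) by blast
    have "z * w ^ m \<in> adjoin S x" by (intro is_subringD(5,7)[OF T] z w)
    then obtain v where v: "v \<in> polys_over S" "z * w ^ m = poly v x" by (auto simp: adjoin_def)
    have "y * z * w ^ m \<doteq> t ^ m * w ^ m" by (rule cong_mult[OF z(2) cong_refl])
    also have "t ^ m * w ^ m = (t * w) ^ m" by (simp add: power_mult_distrib)
    also have "\<dots> \<doteq> s0 ^ m" by (rule cong_power[OF s0'(3)])
    finally have yv: "y * poly v x \<doteq> s0 ^ m" by (simp add: v(2)[symmetric] mult.assoc)
    obtain e q r where qr: "q \<in> polys_over S" "r \<in> polys_over S"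
        "smult (c ^ e) v = q * p + r" "\<forall>i\<ge>degree p. coeff r i = 0"
      using pseudo_division[OF S pS v(1)] unfolding c_def by blast
    define g where "g = smult y r - [:c ^ e * s0 ^ m:]"
    have eq: "poly r x = c ^ e * poly v x - poly q x * poly p x"
      using arg_cong[OF qr(3), of "\<lambda>p. poly p x"] by (simp add: algebra_simps)
    have "poly g x = c ^ e * (y * poly v x - s0 ^ m) - y * poly q x * poly p x"
      unfolding g_def by (simp add: eq) (simp add: algebra_simps)
    then have "poly g x \<in> M"
      using diff_in[OF mult_in(1)[OF yv, of "c ^ e"] mult_in(1)[OF px, of "y * poly q x"]] by simp
    moreover have "g \<in> polys_over S"
      unfolding g_def using qr(2) y(1) c(1) s0'(1)
      by (intro cl is_subringD(5,7)[OF S])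
    moreover have "\<forall>i\<ge>degree p. coeff g i = 0"
      using qr(4) \<open>degree p > 0\<close> by (auto simp: g_def coeff_pCons split: nat.splits)
    ultimately have "coeff g 0 \<in> M" using indep[of g] by (simp add: polys_over_def)
    then have "y * coeff r 0 \<doteq> c ^ e * s0 ^ m" by (simp add: g_def)
    \<comment> \<open>The missing factors bring both exponents to \<open>e + m\<close>, which yields
      a power of the single element \<open>c * s0\<close>.\<close>
    then have "y * coeff r 0 * (c ^ m * s0 ^ e) \<doteq> c ^ e * s0 ^ m * (c ^ m * s0 ^ e)"
      by (rule cong_mult[OF _ cong_refl])
    also have "c ^ e * s0 ^ m * (c ^ m * s0 ^ e) = (c * s0) ^ (e + m)" by (simp add: power_add power_mult_distrib)
    finally have "y * (coeff r 0 * (c ^ m * s0 ^ e)) \<doteq> (c * s0) ^ (e + m)" by (simp add: mult.assoc)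
    moreover have "coeff r 0 * (c ^ m * s0 ^ e) \<in> S"
      using qr(2) c(1) s0'(1) by (intro is_subringD(5,7)[OF S]) (auto simp: polys_over_def)
    ultimately show ?thesis by blast
  qed
  then show ?thesis
    using c s0' is_subringD(5)[OF S] by (intro bexI[of _ "c * s0"]) (auto simp: prime_mult)
qed

text \<open>Two powers of \<open>c\<close> agree modulo \<open>M\<close>; cancelling the smaller one
  leaves a positive power of \<open>c\<close> congruent to 1.\<close>

lemma inverse_mod_finite:
  assumes S: "is_subring S" and fin: "finite_mod M S" and c: "c \<in> S" "c \<notin> M"
  obtains d where "d \<in> S" "d * c \<doteq> 1"
proof -
  obtain F where F: "finite F" "\<forall>a\<in>S. \<exists>f\<in>F. a \<doteq> f" using fin by (auto simp: finite_mod_def)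
  then have "\<forall>i. \<exists>f. f \<in> F \<and> c ^ i \<doteq> f" using is_subringD(7)[OF S c(1)] by blast
  then obtain g where g: "\<And>i. g i \<in> F \<and> c ^ i \<doteq> g i" by metis
  have "\<not> inj g"
    using F(1) g finite_subset[of "range g" F] finite_imageD[of g UNIV] by auto
  then obtain i j where ij: "i < j" "g i = g j" by (metis linorder_injI)
  have "c ^ i \<doteq> c ^ j" using g[of i] g[of j] ij(2) cong_trans cong_sym by metis
  then have "c ^ j - c ^ i \<in> M" by (rule cong_sym)
  moreover obtain k where "j = i + Suc k" using ij(1) less_iff_Suc_add by auto
  then have "c ^ j - c ^ i = c ^ i * (c ^ k * c - 1)"
    by (simp add: algebra_simps power_add)
  ultimately have "c ^ k * c \<doteq> 1" using c(2) by (simp add: prime_mult power_in_iff)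
  then show ?thesis using that is_subringD(7)[OF S c(1)] by blast
qed

text \<open>The leading coefficient of \<open>p\<close> is invertible modulo \<open>M\<close>
  because \<open>S\<close> is finite there. So the powers of \<open>x\<close> below
  \<open>degree p\<close> span, with coefficients from a finite set of representatives.\<close>

lemma finite_mod_adjoin_algebraic:
  assumes S: "is_subring S" and fin: "finite_mod M S"
    and p: "p \<in> polys_over S" "lead_coeff p \<notin> M" "poly p x \<in> M"
  shows "finite_mod M (adjoin S x)"
proof -
  note cl = polys_over_closed[OF S]
  obtain F where F: "finite F" "\<forall>a\<in>S. \<exists>f\<in>F. a \<doteq> f" using fin by (auto simp: finite_mod_def)
  obtain d where d: "d \<in> S" "d * lead_coeff p \<doteq> 1"
    using inverse_mod_finite[OF S fin] p by (auto simp: polys_over_def)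
  define B where "B = (\<lambda>g. \<Sum>i<degree p. g i * x ^ i) ` ({..<degree p} \<rightarrow>\<^sub>E F)"
  have "finite B" unfolding B_def using F(1) by (intro finite_imageI finite_PiE) auto
  moreover have "\<exists>b\<in>B. a \<doteq> b" if a: "a \<in> adjoin S x" for a
  proof -
    obtain v where v: "v \<in> polys_over S" "a = poly v x" using a by (auto simp: adjoin_def)
    obtain e q r where qr: "q \<in> polys_over S" "r \<in> polys_over S"
        "smult (lead_coeff p ^ e) v = q * p + r" "\<forall>i\<ge>degree p. coeff r i = 0"
      using pseudo_division[OF S p(1) v(1)] by blast
    \<comment> \<open>The factor \<open>d ^ e\<close> undoes, modulo \<open>M\<close>, the power of
      the leading coefficient introduced by the pseudo-division.\<close>
    define h where "h = smult (d ^ e) r"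
    have h: "h \<in> polys_over S" "\<forall>i\<ge>degree p. coeff h i = 0"
      unfolding h_def using cl(5)[OF is_subringD(7)[OF S d(1)] qr(2)] qr(4) by auto
    have eq: "poly r x = lead_coeff p ^ e * a - poly q x * poly p x"
      using arg_cong[OF qr(3), of "\<lambda>p. poly p x"] by (simp add: v(2) algebra_simps)
    have "poly h x = (d * lead_coeff p) ^ e * a - d ^ e * poly q x * poly p x"
      unfolding h_def by (simp add: eq) (simp add: algebra_simps power_mult_distrib)
    also have "\<dots> \<doteq> 1 ^ e * a - 0"
      by (rule cong_diff[OF cong_mult[OF cong_power[OF d(2)] cong_refl]]) (simp add: mult_in p(3))
    finally have ah: "a \<doteq> poly h x" using cong_sym by simp
    have "\<forall>i. \<exists>f. f \<in> F \<and> coeff h i \<doteq> f" using h(1) F(2) unfolding polys_over_def by blast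
    then obtain g0 where g0: "\<And>i. g0 i \<in> F \<and> coeff h i \<doteq> g0 i" by metis
    define g where "g = restrict g0 {..<degree p}"
    have "poly h x = (\<Sum>i<degree p. coeff h i * x ^ i)"
    proof -
      have "poly h x = (\<Sum>i\<le>degree h. coeff h i * x ^ i)" by (rule poly_altdef)
      also have "\<dots> = (\<Sum>i<max (Suc (degree h)) (degree p). coeff h i * x ^ i)"
        by (rule sum.mono_neutral_left) (auto simp: coeff_eq_0)
      also have "\<dots> = (\<Sum>i<degree p. coeff h i * x ^ i)"
        by (rule sum.mono_neutral_right) (auto simp: h(2))
      finally show ?thesis .
    qed
    also have "\<dots> \<doteq> (\<Sum>i<degree p. g i * x ^ i)"
      by (rule cong_sum) (use g0 in \<open>auto simp: g_def intro: cong_mult[OF _ cong_refl]\<close>)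
    finally have "a \<doteq> (\<Sum>i<degree p. g i * x ^ i)" by (rule cong_trans[OF ah])
    moreover have "g \<in> {..<degree p} \<rightarrow>\<^sub>E F" using g0 by (auto simp: g_def)
    ultimately show ?thesis unfolding B_def by blast
  qed
  ultimately show ?thesis unfolding finite_mod_def by blast
qed

text \<open>In characteristic 0 this would make a field by inverting a single integer
  \<open>\<tau>\<close>. But \<open>\<tau>\<^sup>2 + 1\<close> is coprime to \<open>\<tau>\<close>
  and can divide a power of it only if \<open>\<tau> = 0\<close>.\<close>

lemma finite_mod_ints:
  assumes t: "t \<in> range of_int" "t \<notin> M"
    and field: "\<And>y. y \<in> range of_int \<Longrightarrow> y \<notin> M \<Longrightarrow> \<exists>z\<in>range of_int. \<exists>m. y * z \<doteq> t ^ m"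
  shows "finite_mod M (range of_int)"
proof (cases "\<exists>n::int. n > 0 \<and> of_int n \<in> M")
  case True
  then obtain n :: int where n: "n > 0" "of_int n \<in> M" by blast
  have "\<exists>f\<in>of_int ` {0..<n}. of_int k \<doteq> f" for k
  proof (rule bexI)
    have "of_int k - of_int (k mod n) = (of_int n * of_int (k div n) :: 'r)"
      unfolding of_int_mult[symmetric] of_int_diff[symmetric] by (simp add: minus_mod_eq_mult_div)
    then show "of_int k \<doteq> of_int (k mod n)" using mult_in(2)[OF n(2)] by simp
  qed (use n in auto)
  then show ?thesis unfolding finite_mod_def by (intro exI[of _ "of_int ` {0..<n}"]) auto
next
  case False
  then have z: "k = 0" if "of_int k \<in> M" for k
    using that diff_in[OF zero_in that] by (cases k "0 :: int" rule: linorder_cases) (auto dest: spec[of _ "- k"])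
  obtain \<tau> where \<tau>: "t = of_int \<tau>" using t(1) by blast
  have "of_int (\<tau>\<^sup>2 + 1) \<notin> M" using z[of "\<tau>\<^sup>2 + 1"] by (metis add_pos_nonneg less_irrefl add.commute zero_less_one zero_le_power2)
  then obtain \<zeta> m where "of_int (\<tau>\<^sup>2 + 1) * of_int \<zeta> \<doteq> of_int \<tau> ^ m"
    using field[OF rangeI[of of_int "\<tau>\<^sup>2 + 1"]] unfolding \<tau> by blast
  then have "of_int ((\<tau>\<^sup>2 + 1) * \<zeta> - \<tau> ^ m) \<in> M" by simp
  then have "\<tau>\<^sup>2 + 1 dvd \<tau> ^ m" using z by (metis dvd_triv_left eq_iff_diff_eq_0)
  moreover have "coprime (\<tau>\<^sup>2 + 1) \<tau>"
    by (rule coprimeI) (metis dvd_add_right_iff dvd_mult2 power2_eq_square)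
  then have "coprime (\<tau>\<^sup>2 + 1) (\<tau> ^ m)" by simp
  ultimately have "is_unit (\<tau>\<^sup>2 + 1)" by (meson coprime_common_divisor dvd_refl)
  then have "\<tau> = 0" using zero_le_power2[of \<tau>] by (simp add: zdvd1_eq)
  then show ?thesis using t(2) zero_in by (simp add: \<tau>)
qed

text \<open>The field property descends along the generators with a changing \<open>t\<close>. The
  same hypothesis makes each generator algebraic over the previous subring, so finiteness
  ascends.\<close>

lemma finite_mod_int_adjoin:
  assumes "t \<in> int_adjoin xs" "t \<notin> M"
    and "\<And>y. y \<in> int_adjoin xs \<Longrightarrow> y \<notin> M \<Longrightarrow> \<exists>z\<in>int_adjoin xs. \<exists>m. y * z \<doteq> t ^ m"
  shows "finite_mod M (int_adjoin xs)"
  using assms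
proof (induction xs arbitrary: t)
  case Nil
  then show ?case using finite_mod_ints[of t] by simp
next
  case (Cons x xs)
  note S = is_subring_int_adjoin[of xs]
  obtain s where "s \<in> int_adjoin xs" "s \<notin> M"
      "\<And>y. y \<in> int_adjoin xs \<Longrightarrow> y \<notin> M \<Longrightarrow> \<exists>z\<in>int_adjoin xs. \<exists>m. y * z \<doteq> s ^ m"
    using localization_field_descends[OF S, of t x] Cons.prems by auto
  then have "finite_mod M (int_adjoin xs)" by (rule Cons.IH)
  then show ?case
    using algebraic_if_localization_field[OF S, of t x] Cons.prems
      finite_mod_adjoin_algebraic[OF S] by auto
qed

end

subsection \<open>Ideals above a fixed ideal\<close>

definition colon :: "'r::comm_ring_1 set \<Rightarrow> 'r \<Rightarrow> 'r set" where
  "colon J h = {x. h * x \<in> J}"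

definition ideal_add :: "'r::comm_ring_1 set \<Rightarrow> 'r \<Rightarrow> 'r set \<Rightarrow> 'r set" where
  "ideal_add W h J = {w + h * j | w j. w \<in> W \<and> j \<in> J}"

lemma ideal_addI: "w \<in> W \<Longrightarrow> j \<in> J \<Longrightarrow> w + h * j \<in> ideal_add W h J"
  by (auto simp: ideal_add_def)

lemma ideal_addE:
  assumes "x \<in> ideal_add W h J"
  obtains w j where "x = w + h * j" "w \<in> W" "j \<in> J"
  using assms by (auto simp: ideal_add_def)

lemma ideal_add_mono: "W \<subseteq> W' \<Longrightarrow> J \<subseteq> J' \<Longrightarrow> ideal_add W h J \<subseteq> ideal_add W' h J'"
  by (auto simp: ideal_add_def)

lemma finite_mod_mono: "finite_mod I K \<Longrightarrow> I \<subseteq> I' \<Longrightarrow> K' \<subseteq> K \<Longrightarrow> finite_mod I' K'"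
  unfolding finite_mod_def by (meson subsetD)

lemma finite_mod_trans:
  assumes "finite_mod I K" "finite_mod K L"
  shows "finite_mod I L"
proof -
  obtain F G where F: "finite F" "\<forall>a\<in>K. \<exists>f\<in>F. a - f \<in> I"
    and G: "finite G" "\<forall>a\<in>L. \<exists>g\<in>G. a - g \<in> K"
    using assms by (auto simp: finite_mod_def)
  have "\<exists>h\<in>(\<lambda>(f, g). f + g) ` (F \<times> G). a - h \<in> I" if a: "a \<in> L" for a
  proof -
    obtain g where g: "g \<in> G" "a - g \<in> K" using G a by blast
    then obtain f where "f \<in> F" "a - g - f \<in> I" using F by blast
    then show ?thesis using g by (intro bexI[of _ "f + g"]) (auto simp: algebra_simps)
  qed
  then show ?thesis
    unfolding finite_mod_def using F(1) G(1)
    by (intro exI[of _ "(\<lambda>(f, g). f + g) ` (F \<times> G)"]) auto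
qed

text \<open>Multiplication by \<open>x\<close> identifies R/(J : x) with (J + xR)/J.\<close>

lemma finite_mod_ideal_add:
  assumes "finite_mod (colon J x) UNIV" "is_ideal UNIV J"
  shows "finite_mod J (ideal_add J x UNIV)"
proof -
  obtain F where F: "finite F" "\<And>a. \<exists>f\<in>F. a - f \<in> colon J x"
    using assms(1) by (auto simp: finite_mod_def)
  have "\<exists>f\<in>(*) x ` F. a - f \<in> J" if a: "a \<in> ideal_add J x UNIV" for a
  proof -
    obtain j r where jr: "a = j + x * r" "j \<in> J" using a by (auto elim: ideal_addE)
    obtain f where f: "f \<in> F" "r - f \<in> colon J x" using F(2) by blast
    have "a - x * f = j + x * (r - f)" by (simp add: jr(1) algebra_simps)
    then have "a - x * f \<in> J" using f(2) jr(2) is_idealD(3)[OF assms(2)] by (simp add: colon_def)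
    then show ?thesis using f(1) by blast
  qed
  then show ?thesis unfolding finite_mod_def using F(1) by (intro exI[of _ "(*) x ` F"]) auto
qed

text \<open>Multiplication by \<open>x\<close> embeds R/(J : x) into K/J.\<close>

lemma finite_mod_colon:
  assumes "finite_mod J K" "is_ideal UNIV J" "is_ideal UNIV K" "x \<in> K"
  shows "finite_mod (colon J x) UNIV"
proof -
  obtain F where F: "finite F" "\<And>a. a \<in> K \<Longrightarrow> \<exists>f\<in>F. a - f \<in> J"
    using assms(1) by (auto simp: finite_mod_def)
  define g where "g f = (SOME r. x * r - f \<in> J)" for f
  have "\<exists>f\<in>g ` F. r - f \<in> colon J x" for r
  proof -
    obtain f where f: "f \<in> F" "x * r - f \<in> J"
      using F(2)[OF is_idealD(5)[OF assms(3) UNIV_I assms(4)]] by blast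
    then have "x * g f - f \<in> J" unfolding g_def by (rule_tac someI)
    then have "x * r - f - (x * g f - f) \<in> J"
      by (rule is_ideal_diff[OF is_subring_UNIV assms(2) f(2)])
    then show ?thesis using f(1) by (intro bexI[of _ "g f"]) (auto simp: colon_def algebra_simps)
  qed
  then show ?thesis unfolding finite_mod_def using F(1) by (intro exI[of _ "g ` F"]) auto
qed

primrec prime_chain :: "nat \<Rightarrow> 'r::comm_ring_1 set \<Rightarrow> bool" where
  "prime_chain 0 Q = True"
| "prime_chain (Suc k) Q = (\<exists>Q'. is_prime Q' \<and> Q \<subset> Q' \<and> prime_chain k Q')"

definition vadd :: "nat list \<Rightarrow> nat list \<Rightarrow> nat list" where
  "vadd u v = map2 (+) u v"

lemma length_vadd [simp]: "length (vadd u v) = min (length u) (length v)"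
  by (simp add: vadd_def)

text \<open>Strict monotonicity in both arguments is the reason for the natural sum: ordinary
  ordinal addition is not strictly monotone on the left, as 1 + omega = omega shows.\<close>

lemma vadd_mono:
  assumes "u' \<lless> u" "length v = length u"
  shows "vadd u' v \<lless> vadd u v" "vadd v u' \<lless> vadd v u"
proof -
  have "vadd u' v \<lless> vadd u v \<and> vadd v u' \<lless> vadd v u"
    using list_less_length[OF assms(1)] assms(2)[symmetric] assms(1)
    by (induction u' u v rule: list_induct3) (auto simp: vadd_def)
  then show "vadd u' v \<lless> vadd u v" "vadd v u' \<lless> vadd v u" by auto
qed

lemma not_list_less_zero: "\<not> v \<lless> replicate k 0"
proof (induction k arbitrary: v)
  case (Suc k)
  then show ?case by (cases v) auto
qed simp

text \<open>Generation is asked only modulo \<open>N\<close>, since the polynomial ring to which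
  this is applied has infinitely many variables.\<close>

locale finitely_generated_mod =
  fixes N :: "'r::comm_ring_1 set" and xs :: "'r list"
  assumes N: "is_ideal UNIV N" and generated: "\<exists>q\<in>int_adjoin xs. r - q \<in> N"
begin

definition Ideals :: "'r set set" where
  "Ideals = {J. is_ideal UNIV J \<and> N \<subseteq> J}"

lemma IdealsD:
  assumes "J \<in> Ideals"
  shows "is_ideal UNIV J" "N \<subseteq> J" "0 \<in> J" "a \<in> J \<Longrightarrow> b \<in> J \<Longrightarrow> a + b \<in> J"
    "a \<in> J \<Longrightarrow> b \<in> J \<Longrightarrow> a - b \<in> J" "a \<in> J \<Longrightarrow> c * a \<in> J" "a \<in> J \<Longrightarrow> a * c \<in> J"
proof -
  show J: "is_ideal UNIV J" "N \<subseteq> J" using assms by (auto simp: Ideals_def)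
  show "0 \<in> J" "a \<in> J \<Longrightarrow> b \<in> J \<Longrightarrow> a + b \<in> J" "a \<in> J \<Longrightarrow> c * a \<in> J" "a \<in> J \<Longrightarrow> a * c \<in> J"
    using is_idealD[OF J(1)] by auto
  show "a \<in> J \<Longrightarrow> b \<in> J \<Longrightarrow> a - b \<in> J" by (rule is_ideal_diff[OF is_subring_UNIV J(1)])
qed

lemma IdealsI:
  assumes "N \<subseteq> J" "\<And>a b. a \<in> J \<Longrightarrow> b \<in> J \<Longrightarrow> a + b \<in> J" "\<And>a c. a \<in> J \<Longrightarrow> c * a \<in> J"
  shows "J \<in> Ideals"
  using assms is_idealD(1)[OF N] unfolding Ideals_def is_ideal_def by auto

lemma N_in: "N \<in> Ideals" and UNIV_in: "UNIV \<in> Ideals"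
  using N by (auto simp: Ideals_def is_ideal_def)

lemma Ideals_cancel:
  assumes "J \<in> Ideals"
  shows "a \<in> J \<Longrightarrow> a + b \<in> J \<longleftrightarrow> b \<in> J" "a - b \<in> J \<Longrightarrow> a \<in> J \<longleftrightarrow> b \<in> J"
  using IdealsD(4)[OF assms, of "a - b" b] IdealsD(5)[OF assms, of a "a - b"]
    IdealsD(4)[OF assms, of a b] IdealsD(5)[OF assms, of "a + b" a] by auto

lemma one_in_iff: "J \<in> Ideals \<Longrightarrow> 1 \<in> J \<longleftrightarrow> J = UNIV"
  using IdealsD(6)[of J 1] by auto

lemma colon_in:
  assumes "J \<in> Ideals"
  shows "colon J h \<in> Ideals"
proof (rule IdealsI)
  show "N \<subseteq> colon J h" using IdealsD(2,6)[OF assms] by (auto simp: colon_def)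
  show "c * a \<in> colon J h" if "a \<in> colon J h" for a c
    using that IdealsD(6)[OF assms, of "h * a" c] by (simp add: colon_def mult.left_commute)
qed (simp add: colon_def distrib_left IdealsD(4)[OF assms])

lemma subset_colon: "J \<in> Ideals \<Longrightarrow> J \<subseteq> colon J h"
  by (auto simp: colon_def IdealsD)

lemma ideal_add_in:
  assumes "W \<in> Ideals" "J \<in> Ideals"
  shows "ideal_add W h J \<in> Ideals"
proof (rule IdealsI)
  show "N \<subseteq> ideal_add W h J"
    using IdealsD(2,3)[OF assms(1)] IdealsD(3)[OF assms(2)] by (force simp: ideal_add_def)
next
  fix a b assume "a \<in> ideal_add W h J" "b \<in> ideal_add W h J"
  then obtain w j w' j' where "a = w + h * j" "b = w' + h * j'" "w \<in> W" "j \<in> J" "w' \<in> W" "j' \<in> J"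
    by (auto elim!: ideal_addE)
  then show "a + b \<in> ideal_add W h J"
    using ideal_addI[OF IdealsD(4)[OF assms(1)] IdealsD(4)[OF assms(2)], of w w' j j' h]
    by (simp add: algebra_simps)
next
  fix a c assume "a \<in> ideal_add W h J"
  then obtain w j where "a = w + h * j" "w \<in> W" "j \<in> J" by (auto elim!: ideal_addE)
  then show "c * a \<in> ideal_add W h J"
    using ideal_addI[OF IdealsD(6)[OF assms(1)] IdealsD(6)[OF assms(2)], of w j c h c]
    by (simp add: algebra_simps)
qed

lemma subset_ideal_add: "J \<in> Ideals \<Longrightarrow> W \<subseteq> ideal_add W h J"
  using ideal_addI[of _ W 0 J h] IdealsD(3) by fastforce

lemma gen_in_ideal_add: "W \<in> Ideals \<Longrightarrow> h * r \<in> ideal_add W h UNIV"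
  using ideal_addI[of 0 W r UNIV h] IdealsD(3) by simp

lemma ideal_add_subset: "K \<in> Ideals \<Longrightarrow> W \<subseteq> K \<Longrightarrow> h \<in> K \<Longrightarrow> ideal_add W h J \<subseteq> K"
  by (auto elim!: ideal_addE intro!: IdealsD(4) IdealsD(7))

lemma psubset_ideal_add: "W \<in> Ideals \<Longrightarrow> h \<notin> W \<Longrightarrow> W \<subset> ideal_add W h UNIV"
  using subset_ideal_add[OF UNIV_in, of W h] gen_in_ideal_add[of W h 1] by auto

text \<open>Every element of \<open>J\<close> is congruent modulo \<open>N\<close> to one in the
  noetherian subring \<open>int_adjoin xs\<close>, so generators of the trace of \<open>J\<close> on
  it suffice. They are chosen there because the topology will only speak of polynomials in the first
  \<open>n\<close> variables.\<close>

lemma generators: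
  assumes "J \<in> Ideals"
  obtains G where "finite G" "G \<subseteq> J \<inter> int_adjoin xs" "\<And>J'. J' \<in> Ideals \<Longrightarrow> G \<subseteq> J' \<Longrightarrow> J \<subseteq> J'"
proof -
  have trace: "is_ideal (int_adjoin xs) (J \<inter> int_adjoin xs)" if "J \<in> Ideals" for J
    using IdealsD(3,4,6)[OF that] is_subringD(1,3,5)[OF is_subring_int_adjoin[of xs]]
    by (auto simp: is_ideal_def)
  obtain G where G: "finite G" "G \<subseteq> J \<inter> int_adjoin xs"
      "\<And>I. is_ideal (int_adjoin xs) I \<Longrightarrow> G \<subseteq> I \<Longrightarrow> J \<inter> int_adjoin xs \<subseteq> I"
    using noetherian_on_int_adjoin[of xs] trace[OF assms] unfolding noetherian_on_def by metis
  have "J \<subseteq> J'" if J': "J' \<in> Ideals" "G \<subseteq> J'" for J'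
  proof
    fix a assume a: "a \<in> J"
    obtain q where q: "q \<in> int_adjoin xs" "a - q \<in> N" using generated by blast
    then have "q \<in> J" using a Ideals_cancel(2)[OF assms] IdealsD(2)[OF assms] by blast
    then have "q \<in> J'" using G(3)[OF trace[OF J'(1)]] G(2) J'(2) q(1) by blast
    then show "a \<in> J'" using q(2) Ideals_cancel(2)[OF J'(1)] IdealsD(2)[OF J'(1)] by blast
  qed
  then show ?thesis using G(1,2) that by blast
qed

lemma wf_Ideals: "wf {(J', J). J \<in> Ideals \<and> J' \<in> Ideals \<and> J \<subset> J'}"
  unfolding wf_iff_no_infinite_down_chain
proof
  assume "\<exists>f. \<forall>i. (f (Suc i), f i) \<in> {(J', J). J \<in> Ideals \<and> J' \<in> Ideals \<and> J \<subset> J'}"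
  then obtain f where "\<forall>i. (f (Suc i), f i) \<in> {(J', J). J \<in> Ideals \<and> J' \<in> Ideals \<and> J \<subset> J'}"
    by blast
  then have f: "\<And>i. f i \<in> Ideals" "\<And>i. f i \<subset> f (Suc i)" by auto
  have mono: "f i \<subseteq> f j" if "i \<le> j" for i j
    by (rule lift_Suc_mono_le[of f, OF _ that]) (use f(2) in blast)
  have "(\<Union>i. f i) \<in> Ideals"
  proof (rule IdealsI)
    show "N \<subseteq> (\<Union>i. f i)" using IdealsD(2)[OF f(1)] by blast
  next
    fix a b assume "a \<in> (\<Union>i. f i)" "b \<in> (\<Union>i. f i)"
    then obtain i j where "a \<in> f i" "b \<in> f j" by blast
    then have "a \<in> f (max i j)" "b \<in> f (max i j)"
      using mono[of i "max i j"] mono[of j "max i j"] by auto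
    then show "a + b \<in> (\<Union>i. f i)" using IdealsD(4)[OF f(1)] by blast
  next
    fix a c assume "a \<in> (\<Union>i. f i)"
    then show "c * a \<in> (\<Union>i. f i)" using IdealsD(6)[OF f(1)] by blast
  qed
  then obtain G where G: "finite G" "G \<subseteq> (\<Union>i. f i)" "\<And>J'. J' \<in> Ideals \<Longrightarrow> G \<subseteq> J' \<Longrightarrow> (\<Union>i. f i) \<subseteq> J'"
    by (rule generators) blast
  have "f k \<subseteq> f (Suc k)" for k using f(2) by blast
  then obtain K where "G \<subseteq> f K" using finite_subset_chain_union[OF G(1,2)] by blast
  then show False using G(3)[OF f(1)] f(2)[of K] by blast
qed

lemma Ideals_induct [consumes 1, case_names less]:
  assumes "J \<in> Ideals" "\<And>J. J \<in> Ideals \<Longrightarrow> (\<And>J'. J' \<in> Ideals \<Longrightarrow> J \<subset> J' \<Longrightarrow> P J') \<Longrightarrow> P J"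
  shows "P J"
  using wf_Ideals assms(1)
proof (induction J rule: wf_induct_rule)
  case (less J)
  then show ?case using assms(2)[of J] by simp
qed

lemma Ideals_maximal:
  assumes "J \<in> \<S>" "\<S> \<subseteq> Ideals"
  obtains K where "K \<in> \<S>" "\<And>K'. K' \<in> \<S> \<Longrightarrow> \<not> K \<subset> K'"
proof -
  obtain K where "K \<in> \<S>" "\<And>K'. (K', K) \<in> {(J', J). J \<in> Ideals \<and> J' \<in> Ideals \<and> J \<subset> J'} \<Longrightarrow> K' \<notin> \<S>"
    using wf_Ideals assms(1) unfolding wf_eq_minimal by meson
  then show ?thesis using that[of K] assms(2) by blast
qed

text \<open>The quotient is already a field, so the criterion for subrings applies with
  \<open>t = 1\<close>; inverses can be taken in \<open>int_adjoin xs\<close>, which meets every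
  class modulo \<open>N\<close>.\<close>

lemma finite_mod_maximal:
  assumes M: "M \<in> Ideals" "M \<noteq> UNIV" and inv: "\<And>r. r \<notin> M \<Longrightarrow> \<exists>r'. r * r' - 1 \<in> M"
  shows "finite_mod M UNIV"
proof -
  have "is_prime M"
    unfolding is_prime_def
  proof (intro conjI allI impI)
    fix a b assume ab: "a * b \<in> M"
    show "a \<in> M \<or> b \<in> M"
    proof (cases "a \<in> M")
      case False
      then obtain r where r: "a * r - 1 \<in> M" using inv by blast
      have "b = r * (a * b) - b * (a * r - 1)" by (simp add: algebra_simps)
      also have "\<dots> \<in> M" by (rule IdealsD(5)[OF M(1) IdealsD(6)[OF M(1) ab] IdealsD(6)[OF M(1) r]])
      finally show ?thesis by simp
    qed simp
  qed (use IdealsD(1)[OF M(1)] one_in_iff[OF M(1)] M(2) in auto)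
  then interpret prime_modulus M by unfold_locales
  have one: "1 \<in> int_adjoin xs" using is_subringD(2)[OF is_subring_int_adjoin] .
  have fin: "finite_mod M (int_adjoin xs)"
  proof (rule finite_mod_int_adjoin[OF one one_notin])
    fix y assume "y \<in> int_adjoin xs" "y \<notin> M"
    then obtain r where r: "y * r - 1 \<in> M" using inv by blast
    obtain q where q: "q \<in> int_adjoin xs" "r - q \<in> N" using generated by blast
    have eq: "y * q - 1 ^ 1 = (y * r - 1) - y * (r - q)" by (simp add: algebra_simps)
    have "r - q \<in> M" using q(2) IdealsD(2)[OF M(1)] by blast
    then have "y * q - 1 ^ 1 \<in> M"
      unfolding eq by (intro IdealsD(5)[OF M(1) r] IdealsD(6)[OF M(1)])
    then show "\<exists>z\<in>int_adjoin xs. \<exists>m. y * z - 1 ^ m \<in> M" using q(1) by blast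
  qed
  then obtain F where F: "finite F" "\<And>a. a \<in> int_adjoin xs \<Longrightarrow> \<exists>f\<in>F. a - f \<in> M"
    by (auto simp: finite_mod_def)
  have "\<exists>f\<in>F. r - f \<in> M" for r
  proof -
    obtain q where q: "q \<in> int_adjoin xs" "r - q \<in> N" using generated by blast
    then obtain f where f: "f \<in> F" "q - f \<in> M" using F(2) by blast
    have "r - f = (r - q) + (q - f)" by simp
    then show ?thesis using f q(2) IdealsD(2)[OF M(1)] IdealsD(4)[OF M(1)] by (metis subsetD)
  qed
  then show ?thesis using F(1) unfolding finite_mod_def by blast
qed

subsection \<open>The ordinal length of an ideal\<close>

text \<open>
  \<open>bounded_by J u\<close> and \<open>bounding J u\<close> say that the rank of \<open>J\<close> in the well-founded order of reverse
  inclusion is at most, respectively at least, the ordinal of \<open>u\<close>. This is the ordinal length of the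
  module \<open>R/J\<close>.
\<close>

inductive bounded_by :: "'r set \<Rightarrow> nat list \<Rightarrow> bool" where
  bounded_byI: "(\<And>J'. J' \<in> Ideals \<Longrightarrow> J \<subset> J' \<Longrightarrow> \<exists>v. v \<lless> u \<and> bounded_by J' v) \<Longrightarrow> bounded_by J u"

inductive bounding :: "'r set \<Rightarrow> nat list \<Rightarrow> bool" where
  boundingI: "(\<And>v. v \<lless> u \<Longrightarrow> \<exists>J'. J' \<in> Ideals \<and> J \<subset> J' \<and> bounding J' v) \<Longrightarrow> bounding J u"

lemma bounded_byE:
  assumes "bounded_by J u" "J' \<in> Ideals" "J \<subset> J'"
  obtains v where "v \<lless> u" "bounded_by J' v"
proof -
  from assms(1) have "\<exists>v. v \<lless> u \<and> bounded_by J' v"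
    by cases (use assms(2,3) in blast)
  then show ?thesis using that by blast
qed

lemma boundingE:
  assumes "bounding J u" "v \<lless> u"
  obtains J' where "J' \<in> Ideals" "J \<subset> J'" "bounding J' v"
proof -
  from assms(1) have "\<exists>J'. J' \<in> Ideals \<and> J \<subset> J' \<and> bounding J' v"
    by cases (use assms(2) in blast)
  then show ?thesis using that by blast
qed

lemma bounding_mono: "bounding J u \<Longrightarrow> v \<lless> u \<Longrightarrow> bounding J v"
  by (rule boundingI) (metis boundingE list_less_trans)

lemma bounding_antimono: "bounding J u \<Longrightarrow> J' \<subseteq> J \<Longrightarrow> bounding J' u"
  by (rule boundingI) (metis boundingE order_le_less_trans)

lemma not_bounded_by_less_bounding:
  assumes "bounded_by J u" "bounding J v"
  shows "\<not> u \<lless> v"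
  using assms
proof (induction arbitrary: v rule: bounded_by.induct)
  case (bounded_byI J u)
  show ?case
  proof
    assume "u \<lless> v"
    then obtain J' where J': "J' \<in> Ideals" "J \<subset> J'" "bounding J' u"
      using boundingE[OF bounded_byI.prems] by metis
    then show False using bounded_byI.IH by blast
  qed
qed

text \<open>Change of list length: a new leading entry can only enlarge the ordinal, which preserves
  an upper bound. A lower bound survives in general only for the entry 0, which leaves the ordinal
  unchanged.\<close>

lemma bounded_by_Cons: "bounded_by J u \<Longrightarrow> bounded_by J (n # u)"
proof (induction rule: bounded_by.induct)
  case (bounded_byI J u)
  show ?case
  proof (rule bounded_by.bounded_byI)
    fix J' assume "J' \<in> Ideals" "J \<subset> J'"
    then obtain v where "v \<lless> u" "bounded_by J' (n # v)" using bounded_byI.IH by blast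
    then show "\<exists>v. v \<lless> n # u \<and> bounded_by J' v" by (intro exI[of _ "n # v"]) simp
  qed
qed

lemma bounding_Cons_zero: "bounding J u \<Longrightarrow> bounding J (0 # u)"
proof (induction rule: bounding.induct)
  case (boundingI u J)
  show ?case
  proof (rule bounding.boundingI)
    fix v assume v: "v \<lless> 0 # u"
    then obtain v' where "v = 0 # v'" "v' \<lless> u" by (cases v) auto
    then show "\<exists>J'. J' \<in> Ideals \<and> J \<subset> J' \<and> bounding J' v" using boundingI.IH[of v'] by auto
  qed
qed

text \<open>
  An ideal \<open>J' \<supset> J\<close> is strictly larger than \<open>J\<close> after adding \<open>a\<close> or after taking the quotient by \<open>a\<close>.
\<close>

lemma bounded_by_vadd:
  assumes "J \<in> Ideals" "bounded_by (ideal_add J a UNIV) u" "bounded_by (colon J a) v" "length u = length v"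
  shows "bounded_by J (vadd u v)"
  using assms
proof (induction J arbitrary: u v rule: Ideals_induct)
  case (less J)
  show ?case
  proof (rule bounded_byI)
    fix J' assume J': "J' \<in> Ideals" "J \<subset> J'"
    note J = less.hyps(1)
    have sub: "ideal_add J a UNIV \<subseteq> ideal_add J' a UNIV" "colon J a \<subseteq> colon J' a"
      using J'(2) ideal_add_mono[of J J'] by (auto simp: colon_def)
    obtain u' where u': "u' = u \<and> ideal_add J' a UNIV = ideal_add J a UNIV \<or> u' \<lless> u"
        "bounded_by (ideal_add J' a UNIV) u'"
      using bounded_byE[OF less.prems(1) ideal_add_in[OF J'(1) UNIV_in]] sub(1) less.prems(1) by (metis psubsetI)
    obtain v' where v': "v' = v \<and> colon J' a = colon J a \<or> v' \<lless> v" "bounded_by (colon J' a) v'"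
      using bounded_byE[OF less.prems(2) colon_in[OF J'(1)]] sub(2) less.prems(2) by (metis psubsetI)
    have len: "length u' = length u" "length v' = length v" using u' v' list_less_length by auto
    have "u' \<lless> u \<or> v' \<lless> v"
    proof (rule ccontr)
      assume "\<not> ?thesis"
      then have eq: "ideal_add J' a UNIV = ideal_add J a UNIV" "colon J' a = colon J a"
        using u' v' by auto
      \<comment> \<open>An element of \<open>J'\<close> is \<open>j + a * r\<close> with
        \<open>j\<close> in \<open>J\<close>; then \<open>a * r\<close> lies in \<open>J'\<close>,
        and \<open>r\<close> lies in the common colon ideal, which puts \<open>a * r\<close> into
        \<open>J\<close>.\<close>
      have "J' \<subseteq> J"
      proof
        fix x assume x: "x \<in> J'"
        then have "x \<in> ideal_add J a UNIV" using subset_ideal_add[OF UNIV_in] eq(1) by blast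
        then obtain j r where jr: "x = j + a * r" "j \<in> J" by (auto elim: ideal_addE)
        then have "a * r \<in> J'" using x J'(2) Ideals_cancel(1)[OF J'(1), of j "a * r"] by blast
        then have "a * r \<in> J" using eq(2) by (auto simp: colon_def)
        then show "x \<in> J" using jr IdealsD(4)[OF J] by blast
      qed
      then show False using J'(2) by blast
    qed
    then have "vadd u' v' \<lless> vadd u v"
      using u'(1) v'(1) vadd_mono(1)[of u' u v] vadd_mono(1)[of u' u v'] vadd_mono(2)[of v' v u]
        list_less_trans len less.prems(3) by metis
    moreover have "bounded_by J' (vadd u' v')"
      using less.IH[OF J' u'(2) v'(2)] len less.prems(3) by simp
    ultimately show "\<exists>w. w \<lless> vadd u v \<and> bounded_by J' w" by blast
  qed
qed

text \<open>The hypothesis says that R/J has dimension below \<open>k\<close>, the conclusion that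
  its length is below omega^k. If \<open>J\<close> is prime, each larger ideal has smaller
  dimension, so \<open>J\<close> has length at most omega^(k-1). If a * b lies in \<open>J\<close>
  and neither factor does, then J + aR and (J : a) are both larger than \<open>J\<close>, and
  noetherian induction applies.\<close>

lemma bounded_by_dimension:
  assumes "J \<in> Ideals" "\<And>Q. is_prime Q \<Longrightarrow> J \<subseteq> Q \<Longrightarrow> \<not> prime_chain k Q"
  shows "\<exists>u. length u = k \<and> bounded_by J u"
  using assms
proof (induction k arbitrary: J rule: less_induct)
  case (less k)
  note outer = less.IH
  from less.prems show ?case
  proof (induction J rule: Ideals_induct)
    case (less J)
    note J = less.hyps(1)
    consider "J = UNIV" | "is_prime J" | a b where "a * b \<in> J" "a \<notin> J" "b \<notin> J"
      using IdealsD(1)[OF J] one_in_iff[OF J] unfolding is_prime_def by blast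
    then show ?case
    proof cases
      case 1
      then show ?thesis by (intro exI[of _ "replicate k 0"]) (auto intro: bounded_byI)
    next
      case 2
      then obtain k' where k: "k = Suc k'" using less.prems by (cases k) auto
      have "bounded_by J (1 # replicate k' 0)"
      proof (rule bounded_byI)
        fix J' assume J': "J' \<in> Ideals" "J \<subset> J'"
        have "\<not> prime_chain k' Q" if "is_prime Q" "J' \<subseteq> Q" for Q
          using less.prems[OF 2] that J'(2) by (auto simp: k)
        then obtain u where "length u = k'" "bounded_by J' u" using outer[of k' J'] J'(1) k by auto
        then show "\<exists>v. v \<lless> 1 # replicate k' 0 \<and> bounded_by J' v"
          by (intro exI[of _ "0 # u"]) (auto intro: bounded_by_Cons)
      qed
      then show ?thesis by (intro exI[of _ "1 # replicate k' 0"]) (simp add: k)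
    next
      case 3
      have add: "ideal_add J a UNIV \<in> Ideals" "J \<subset> ideal_add J a UNIV"
        using ideal_add_in[OF J UNIV_in] psubset_ideal_add[OF J 3(2)] by auto
      have col: "colon J a \<in> Ideals" "J \<subset> colon J a"
        using colon_in[OF J] subset_colon[OF J, of a] 3 by (auto simp: colon_def)
      obtain u where u: "length u = k" "bounded_by (ideal_add J a UNIV) u"
        using less.IH[OF add] less.prems add(2) by (meson order_trans psubset_imp_subset)
      obtain v where v: "length v = k" "bounded_by (colon J a) v"
        using less.IH[OF col] less.prems col(2) by (meson order_trans psubset_imp_subset)
      show ?thesis
        using bounded_by_vadd[OF J u(2) v(2)] u(1) v(1) by (intro exI[of _ "vadd u v"]) simp
    qed
  qed
qed

text \<open>The ideals above (W : h) embed below W + hR through W + hJ, so a chain above W + hR is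
  prolonged by a copy of one above (W : h). The lengths add up as ordinals; since the upper part
  contributes a multiple of omega^k, only the leading entries are added.\<close>

lemma bounding_ideal_add:
  assumes W: "W \<in> Ideals" and top: "bounding (ideal_add W h UNIV) (n # replicate k 0)"
    and J: "J \<in> Ideals" "colon W h \<subseteq> J" "bounding J u" and u: "u = m # w" "length w = k"
  shows "bounding (ideal_add W h J) ((n + m) # w)"
  using J u
proof (induction u arbitrary: J m w rule: wf_induct_rule[OF wf_lex[OF wf_less_than]])
  case (1 u)
  show ?case
  proof (rule boundingI)
    fix v assume v: "v \<lless> (n + m) # w"
    then obtain a v' where av: "v = a # v'" by (cases v) auto
    have len: "length v' = k" using list_less_length[OF v] 1(6) by (simp add: av)
    show "\<exists>J'. J' \<in> Ideals \<and> ideal_add W h J \<subset> J' \<and> bounding J' v"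
    proof (cases "a < n")
      case True
      then have "v \<lless> n # replicate k 0" using len by (simp add: av)
      then obtain J' where "J' \<in> Ideals" "ideal_add W h UNIV \<subset> J'" "bounding J' v"
        using boundingE[OF top] by metis
      then show ?thesis using ideal_add_mono[of W W J UNIV h] by blast
    next
      case False
      \<comment> \<open>From \<open>n\<close> times omega^k on, this multiple is subtracted and the
        rest is realized by an ideal above (W : h).\<close>
      define m' where "m' = a - n"
      have less: "m' # v' \<lless> u" using v False len 1(5,6) by (auto simp: av m'_def)
      then obtain J' where J': "J' \<in> Ideals" "J \<subset> J'" "bounding J' (m' # v')"
        using boundingE[OF 1(4)] by metis
      have "bounding (ideal_add W h J') ((n + m') # v')"
        using 1(1)[OF less J'(1) _ J'(3) refl len] 1(3) J'(2) by blast
      moreover have "ideal_add W h J \<noteq> ideal_add W h J'"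
      proof
        assume eq: "ideal_add W h J = ideal_add W h J'"
        have "J' \<subseteq> J"
        proof
          fix x assume "x \<in> J'"
          then have "h * x \<in> ideal_add W h J'" using ideal_addI[of 0 W x J' h] IdealsD(3)[OF W] by simp
          then have "h * x \<in> ideal_add W h J" using eq by simp
          then obtain y j where "h * x = y + h * j" "y \<in> W" "j \<in> J" by (rule ideal_addE)
          then have "h * (x - j) \<in> W" by (simp add: algebra_simps)
          then have "x - j \<in> J" using 1(3) by (auto simp: colon_def)
          then show "x \<in> J" using \<open>j \<in> J\<close> Ideals_cancel(2)[OF 1(2)] by blast
        qed
        then show False using J'(2) by blast
      qed
      then have "ideal_add W h J \<subset> ideal_add W h J'" using ideal_add_mono[of W W J J' h] J'(2) by blast
      ultimately show ?thesis
        using ideal_add_in[OF W J'(1)] False by (intro exI[of _ "ideal_add W h J'"]) (simp add: av m'_def)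
    qed
  qed
qed

text \<open>Lengths cofinal in omega^k stand for a lower bound omega^k on \<open>P\<close>, which no
  list of length \<open>k\<close> expresses. The strict inclusion lets the induction pass from the
  next prime \<open>Q\<close> to any ideal inside \<open>Q\<close>.\<close>

lemma bounding_dimension:
  assumes "P \<in> Ideals" "is_prime P" "prime_chain k P" "length v = k"
  shows "\<exists>J\<in>Ideals. P \<subset> J \<and> bounding J v"
  using assms
proof (induction k arbitrary: P v)
  case 0
  have "bounding UNIV []" by (rule boundingI) simp
  moreover have "P \<subset> UNIV" using 0(2) by (auto simp: is_prime_def)
  ultimately show ?case using UNIV_in 0(4) by auto
next
  case (Suc k)
  obtain Q where Q: "is_prime Q" "P \<subset> Q" "prime_chain k Q" using Suc.prems(3) by auto
  have QI: "Q \<in> Ideals" using Q IdealsD(2)[OF Suc.prems(1)] by (auto simp: Ideals_def is_prime_def)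
  obtain g where g: "g \<in> Q" "g \<notin> P" using Q(2) by blast
  interpret P: prime_modulus P using Suc.prems(2) by unfold_locales
  define W where "W n = ideal_add P (g ^ n) UNIV" for n
  have W: "W n \<in> Ideals" for n unfolding W_def by (rule ideal_add_in[OF Suc.prems(1) UNIV_in])
  have PW: "P \<subset> W n" for n
    unfolding W_def by (rule psubset_ideal_add[OF Suc.prems(1)]) (use g(2) in \<open>simp add: P.power_in_iff\<close>)
  \<comment> \<open>\<open>W 1\<close> lies in \<open>Q\<close>, and the ideals strictly above
    \<open>Q\<close> have lengths cofinal in omega^k.\<close>
  have W1: "bounding (W 1) (1 # replicate k 0)"
  proof (rule boundingI)
    fix v assume v: "v \<lless> 1 # replicate k 0"
    then obtain w where w: "v = 0 # w" using not_list_less_zero[of _ k] by (cases v) auto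
    then have "length w = k" using list_less_length[OF v] by simp
    then obtain J where J: "J \<in> Ideals" "Q \<subset> J" "bounding J w" using Suc.IH[OF QI Q(1,3)] by blast
    have "W 1 \<subseteq> Q" unfolding W_def by (rule ideal_add_subset[OF QI]) (use Q(2) g(1) in auto)
    then show "\<exists>J'. J' \<in> Ideals \<and> W 1 \<subset> J' \<and> bounding J' v"
      using J bounding_Cons_zero w by blast
  qed
  have Wn: "bounding (W (Suc n)) (Suc n # replicate k 0)" for n
  proof (induction n)
    case 0
    then show ?case using W1 by simp
  next
    case (Suc n)
    have sub: "ideal_add (W (Suc (Suc n))) g UNIV \<subseteq> W 1"
    proof (rule ideal_add_subset[OF W])
      show "W (Suc (Suc n)) \<subseteq> W 1"
        unfolding W_def
        using gen_in_ideal_add[OF \<open>P \<in> Ideals\<close>, of "g ^ 1" "g ^ Suc n"]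
        by (intro ideal_add_subset[OF W[of 1, unfolded W_def]] subset_ideal_add[OF UNIV_in]) simp
      show "g \<in> W 1" using gen_in_ideal_add[OF \<open>P \<in> Ideals\<close>, of "g ^ 1" 1] by (simp add: W_def)
    qed
    \<comment> \<open>Cancelling \<open>g\<close> modulo the prime \<open>P\<close> shows that the
      step from \<open>W (Suc (Suc n))\<close> to \<open>W 1\<close> is at least as long as the
      quotient by \<open>W (Suc n)\<close>, which the induction hypothesis bounds from
      below.\<close>
    have col: "colon (W (Suc (Suc n))) g \<subseteq> W (Suc n)"
    proof
      fix x assume "x \<in> colon (W (Suc (Suc n))) g"
      then obtain p r where "g * x = p + g ^ Suc (Suc n) * r" "p \<in> P"
        by (auto simp: colon_def W_def elim: ideal_addE)
      then have "g * (x - g ^ Suc n * r) \<in> P" by (simp add: algebra_simps)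
      then have "x - g ^ Suc n * r \<in> P" using g(2) by (simp add: P.prime_mult)
      then show "x \<in> W (Suc n)"
        using ideal_addI[of "x - g ^ Suc n * r" P r UNIV "g ^ Suc n"] by (simp add: W_def)
    qed
    have "bounding (ideal_add (W (Suc (Suc n))) g (W (Suc n))) ((1 + Suc n) # replicate k 0)"
      by (rule bounding_ideal_add[OF W bounding_antimono[OF W1 sub] W col Suc.IH refl]) simp
    then have "bounding (W (Suc (Suc n))) ((1 + Suc n) # replicate k 0)"
      by (rule bounding_antimono[OF _ subset_ideal_add[OF W]])
    then show ?case by simp
  qed
  obtain n w where v: "v = n # w" "length w = k" using Suc.prems(4) by (cases v) auto
  have "bounding (W (Suc n)) v"
    by (rule bounding_mono[OF Wn]) (use v in simp)
  then show ?case using W[of "Suc n"] PW[of "Suc n"] by blast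
qed

end

section \<open>Dividing the ordinal length by omega\<close>

context finitely_generated_mod
begin

text \<open>The exact ordinal length, as the least upper bound of \<open>d\<close> entries;
  meaningful only under \<open>has_len d J\<close>, which demands that such a bound exists.\<close>

definition len :: "nat \<Rightarrow> 'r set \<Rightarrow> nat list" where
  "len d J = (SOME u. length u = d \<and> bounded_by J u \<and> (\<forall>w. w \<lless> u \<longrightarrow> \<not> bounded_by J w))"

definition has_len :: "nat \<Rightarrow> 'r set \<Rightarrow> bool" where
  "has_len d J \<longleftrightarrow> J \<in> Ideals \<and> (\<exists>u. length u = d \<and> bounded_by J u)"

lemma len:
  assumes "has_len d J"
  shows "length (len d J) = d" "bounded_by J (len d J)" "w \<lless> len d J \<Longrightarrow> \<not> bounded_by J w"
proof -
  obtain u where "length u = d" "bounded_by J u" using assms by (auto simp: has_len_def)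
  then obtain v where "bounded_by J v" "length v = d" "\<And>w. w \<lless> v \<Longrightarrow> \<not> bounded_by J w"
    using list_less_least[of "bounded_by J" u d] by metis
  then have "\<exists>u. length u = d \<and> bounded_by J u \<and> (\<forall>w. w \<lless> u \<longrightarrow> \<not> bounded_by J w)" by blast
  from someI_ex[OF this]
  show "length (len d J) = d" "bounded_by J (len d J)" "w \<lless> len d J \<Longrightarrow> \<not> bounded_by J w"
    unfolding len_def by blast+
qed

lemma len_mono:
  assumes J: "has_len d J" and J': "J' \<in> Ideals" "J \<subset> J'"
  shows "has_len d J'" "len d J' \<lless> len d J"
proof -
  obtain v where v: "v \<lless> len d J" "bounded_by J' v" using bounded_byE[OF len(2)[OF J] J'] by metis
  then have l: "length v = d" using list_less_length len(1)[OF J] by metis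
  show "has_len d J'" using v l J'(1) by (auto simp: has_len_def)
  note J' = this
  have "len d J' = v \<or> len d J' \<lless> v"
    using len(1,3)[OF J'] list_less_linear[of v "len d J'"] v(2) l by auto
  then show "len d J' \<lless> len d J" using v(1) list_less_trans by metis
qed

lemma len_mono_le:
  assumes "has_len d J" "J' \<in> Ideals" "J \<subseteq> J'" "len d J \<lless> u"
  shows "len d J' \<lless> u"
  using len_mono[OF assms(1,2)] assms(3,4) list_less_trans by (cases "J = J'") auto

lemma len_not_less_bounding:
  assumes "has_len d J" "bounding J v"
  shows "\<not> len d J \<lless> v"
  using not_bounded_by_less_bounding len(2)[OF assms(1)] assms(2) by blast

text \<open>A maximal \<open>K\<close> with finite K/J absorbs each \<open>x\<close> with finite
  R/(J : x), because adding \<open>x\<close> to \<open>K\<close> would keep the quotient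
  finite.\<close>

lemma finite_part:
  assumes "J \<in> Ideals"
  obtains K where "K \<in> Ideals" "J \<subseteq> K" "finite_mod J K"
    "\<And>x. finite_mod (colon J x) UNIV \<Longrightarrow> x \<in> K"
proof -
  define \<S> where "\<S> = {K \<in> Ideals. J \<subseteq> K \<and> finite_mod J K}"
  have "finite_mod J J" unfolding finite_mod_def by (intro exI[of _ "{0}"]) auto
  then have "J \<in> \<S>" using assms by (simp add: \<S>_def)
  then obtain K where K: "K \<in> \<S>" "\<And>K'. K' \<in> \<S> \<Longrightarrow> \<not> K \<subset> K'"
    using Ideals_maximal[of J \<S>] by (auto simp: \<S>_def)
  have "x \<in> K" if "finite_mod (colon J x) UNIV" for x
  proof (rule ccontr)
    assume "x \<notin> K"
    have KI: "K \<in> Ideals" "J \<subseteq> K" "finite_mod J K" using K(1) by (auto simp: \<S>_def)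
    have "colon J x \<subseteq> colon K x" using KI(2) by (auto simp: colon_def)
    then have "finite_mod (colon K x) UNIV" by (rule finite_mod_mono[OF that]) simp
    then have "finite_mod K (ideal_add K x UNIV)"
      using finite_mod_ideal_add IdealsD(1)[OF KI(1)] by blast
    then have "ideal_add K x UNIV \<in> \<S>"
      using finite_mod_trans[OF KI(3)] ideal_add_in[OF KI(1) UNIV_in] KI(2)
        psubset_ideal_add[OF KI(1) \<open>x \<notin> K\<close>] by (auto simp: \<S>_def)
    then show False using K(2) psubset_ideal_add[OF KI(1) \<open>x \<notin> K\<close>] by blast
  qed
  then show ?thesis using K(1) that by (auto simp: \<S>_def)
qed

text \<open>
  An ideal \<open>W\<close> that is minimal over \<open>J\<close> has a simple, hence finite, quotient \<open>W/J\<close>. So it lies in the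
  largest \<open>K\<close> with finite \<open>K/J\<close>, and \<open>F\<close> represents the nonzero elements of \<open>K/J\<close>.
\<close>

lemma avoid_minimal_ideals:
  assumes J: "J \<in> Ideals"
  obtains F where "finite F" "F \<inter> J = {}"
    "\<And>J' W. J' \<inter> F = {} \<Longrightarrow> W \<in> Ideals \<Longrightarrow> J \<subset> W \<Longrightarrow> W \<subseteq> J' \<Longrightarrow> \<exists>W'\<in>Ideals. J \<subset> W' \<and> W' \<subset> W"
proof -
  obtain K where K: "K \<in> Ideals" "J \<subseteq> K" "finite_mod J K" "\<And>x. finite_mod (colon J x) UNIV \<Longrightarrow> x \<in> K"
    by (rule finite_part[OF J]) blast
  obtain F where F: "finite F" "\<And>a. a \<in> K \<Longrightarrow> \<exists>f\<in>F. a - f \<in> J"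
    using K(3) by (auto simp: finite_mod_def)
  have "\<exists>W'\<in>Ideals. J \<subset> W' \<and> W' \<subset> W"
    if J': "J' \<inter> (F - J) = {}" and W: "W \<in> Ideals" "J \<subset> W" "W \<subseteq> J'" for J' W
  proof (rule ccontr)
    assume none: "\<not> ?thesis"
    obtain w where w: "w \<in> W" "w \<notin> J" using W(2) by blast
    have "finite_mod (colon J w) UNIV"
    proof (rule finite_mod_maximal[OF colon_in[OF J]])
      have "1 \<notin> colon J w" using w(2) by (simp add: colon_def)
      then show "colon J w \<noteq> UNIV" by blast
      fix r assume r: "r \<notin> colon J w"
      then have wr: "w * r \<notin> J" by (simp add: colon_def)
      \<comment> \<open>With nothing strictly between \<open>J\<close> and \<open>W\<close>, this
        ideal equals \<open>W\<close>. So \<open>w\<close> is a multiple of \<open>w * r\<close>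
        modulo \<open>J\<close>, and \<open>r\<close> is invertible modulo (J : w).\<close>
      have "ideal_add J (w * r) UNIV \<subseteq> W"
        by (rule ideal_add_subset[OF W(1)]) (use W(2) IdealsD(7)[OF W(1) w(1)] in auto)
      then have "ideal_add J (w * r) UNIV = W"
        using none ideal_add_in[OF J UNIV_in] psubset_ideal_add[OF J wr] by blast
      then obtain j r' where "w = j + w * r * r'" "j \<in> J" using w(1) by (auto elim: ideal_addE)
      then have "w * (r * r' - 1) = - j" by (simp add: algebra_simps)
      then have "w * (r * r' - 1) \<in> J" using IdealsD(6)[OF J \<open>j \<in> J\<close>, of "- 1"] by simp
      then show "\<exists>r'. r * r' - 1 \<in> colon J w" by (auto simp: colon_def)
    qed
    then have "w \<in> K" by (rule K(4))
    then obtain f where f: "f \<in> F" "w - f \<in> J" using F(2) by blast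
    then have "f \<notin> J" using w(2) Ideals_cancel(2)[OF J] by blast
    moreover have "f \<in> W" using f(2) W(2) w(1) Ideals_cancel(2)[OF W(1)] by blast
    ultimately show False using f(1) J' W(3) by blast
  qed
  then show ?thesis using F(1) that[of "F - J"] by blast
qed

text \<open>
  \<open>butlast\<close> is the division of an ordinal by \<open>\<omega>\<close>. If it had the same value at \<open>J\<close> and at some \<open>J' \<supset> J\<close>,
  then the ideals between \<open>J\<close> and \<open>J'\<close> would be distinguished by the last entry, and one
  where this is greatest would be minimal over \<open>J\<close>.
\<close>

lemma butlast_len_upper:
  assumes J: "has_len (Suc e) J"
  obtains F where "finite F" "F \<inter> J = {}"
    "\<And>J'. J' \<in> Ideals \<Longrightarrow> J \<subset> J' \<Longrightarrow> J' \<inter> F = {} \<Longrightarrow> butlast (len (Suc e) J') \<lless> butlast (len (Suc e) J)"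
proof -
  let ?l = "len (Suc e)"
  have JI: "J \<in> Ideals" using J by (simp add: has_len_def)
  obtain F where F: "finite F" "F \<inter> J = {}"
    "\<And>J' W. J' \<inter> F = {} \<Longrightarrow> W \<in> Ideals \<Longrightarrow> J \<subset> W \<Longrightarrow> W \<subseteq> J' \<Longrightarrow> \<exists>W'\<in>Ideals. J \<subset> W' \<and> W' \<subset> W"
    by (rule avoid_minimal_ideals[OF JI]) blast
  have snoc: "?l W = butlast (?l W) @ [last (?l W)]" "length (butlast (?l W)) = e"
    if "W \<in> Ideals" "J \<subseteq> W" for W
    using len(1)[of "Suc e" W] len_mono(1)[OF J that(1)] J that(2)
    by (cases "J = W"; auto intro!: append_butlast_last_id[symmetric])+
  have lex_less: "butlast (?l W) \<lless> butlast (?l V) \<or> butlast (?l W) = butlast (?l V) \<and> last (?l W) < last (?l V)"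
    if "W \<in> Ideals" "V \<in> Ideals" "J \<subseteq> V" "V \<subset> W" for V W
  proof -
    have "has_len (Suc e) V" using len_mono(1)[OF J that(2)] J that(3) by (cases "J = V") auto
    then have "?l W \<lless> ?l V" using len_mono(2) that(1,4) by blast
    moreover have "J \<subseteq> W" using that(3,4) by blast
    ultimately have "butlast (?l W) @ [last (?l W)] \<lless> butlast (?l V) @ [last (?l V)]"
      using snoc(1)[OF that(1)] snoc(1)[OF that(2,3)] by metis
    then show ?thesis
      using list_less_snoc snoc(2)[OF that(1) \<open>J \<subseteq> W\<close>] snoc(2)[OF that(2,3)] by simp
  qed
  have "butlast (?l J') \<lless> butlast (?l J)" if J': "J' \<in> Ideals" "J \<subset> J'" "J' \<inter> F = {}" for J'
  proof (rule ccontr)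
    assume not: "\<not> ?thesis"
    \<comment> \<open>Each \<open>W\<close> contains a smaller \<open>W'\<close> still strictly
      above \<open>J\<close>. Passing to it raises the last entry, which stays below that of
      \<open>J\<close>, so the difference \<open>k\<close> would decrease forever.\<close>
    have "False" if "W \<in> Ideals" "J \<subset> W" "W \<subseteq> J'" "last (?l J) - last (?l W) = k" for W k
      using that
    proof (induction k arbitrary: W rule: less_induct)
      case (less k)
      have head: "butlast (?l V) = butlast (?l J) \<and> last (?l V) < last (?l J)"
        if V: "V \<in> Ideals" "J \<subset> V" "V \<subseteq> J'" for V
      proof -
        have "butlast (?l J') = butlast (?l V) \<or> butlast (?l J') \<lless> butlast (?l V)"
          using lex_less[of J' V] V J'(1)
          by (cases "V = J'") auto
        then have "\<not> butlast (?l V) \<lless> butlast (?l J)" using not list_less_trans by metis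
        then show ?thesis
          using lex_less[OF V(1) JI _ V(2)] by auto
      qed
      obtain W' where W': "W' \<in> Ideals" "J \<subset> W'" "W' \<subset> W"
        using F(3)[OF J'(3) less.prems(1-3)] by blast
      have W'J: "W' \<subseteq> J'" using W'(3) less.prems(3) by blast
      have "J \<subseteq> W'" using W'(2) by blast
      then have "last (?l W) < last (?l W')"
        using lex_less[OF less.prems(1) W'(1) _ W'(3)] head[OF less.prems(1-3)] head[OF W'(1,2) W'J] by auto
      then have "last (?l J) - last (?l W') < k"
        using head[OF W'(1,2) W'J] head[OF less.prems(1-3)] less.prems(4) by arith
      then show False using less.IH[OF _ W'(1,2) W'J refl] by blast
    qed
    then show False using J' by blast
  qed
  then show ?thesis using F(1,2) that by blast
qed

text \<open>In the domain R/Q, an \<open>f\<close> in all these ideals is a^n h_n with h_n = a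
  h_(n+1), so the ideals of the h_n ascend. Where they stop, h_(n+1) is a multiple of a h_(n+1), and
  \<open>a\<close> is a unit.\<close>

lemma krull_intersection:
  assumes Q: "Q \<in> Ideals" "is_prime Q" and a: "ideal_add Q a UNIV \<noteq> UNIV" and f: "f \<notin> Q"
  shows "\<exists>n. f \<notin> ideal_add Q (a ^ n) UNIV"
proof (rule ccontr)
  interpret Q: prime_modulus Q using Q(2) by unfold_locales
  assume *: "\<not> ?thesis"
  have "\<forall>n. \<exists>h. f - a ^ n * h \<in> Q"
  proof
    fix n
    have "f \<in> ideal_add Q (a ^ n) UNIV" using * by blast
    then obtain q h where "f = q + a ^ n * h" "q \<in> Q" by (rule ideal_addE)
    then show "\<exists>h. f - a ^ n * h \<in> Q" by (intro exI[of _ h]) simp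
  qed
  then obtain h where h: "\<And>n. f - a ^ n * h n \<in> Q" by metis
  have hQ: "h n \<notin> Q" for n
    using h[of n] f Ideals_cancel(2)[OF Q(1)] by (auto simp: Q.prime_mult)
  have "a \<notin> Q" using h[of 1] f Ideals_cancel(2)[OF Q(1)] by (auto simp: Q.prime_mult)
  have step: "h n - a * h (Suc n) \<in> Q" for n
  proof -
    have "(f - a ^ Suc n * h (Suc n)) - (f - a ^ n * h n) = a ^ n * (h n - a * h (Suc n))"
      by (simp add: algebra_simps)
    then have "a ^ n * (h n - a * h (Suc n)) \<in> Q" using Q.diff_in[OF h h] by metis
    then show ?thesis using \<open>a \<notin> Q\<close> by (simp add: Q.prime_mult Q.power_in_iff)
  qed
  define H where "H n = ideal_add Q (h n) UNIV" for n
  have H: "H n \<in> Ideals" for n unfolding H_def by (rule ideal_add_in[OF Q(1) UNIV_in])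
  have "range H \<subseteq> Ideals" using H by auto
  then obtain K where K: "K \<in> range H" "\<And>K'. K' \<in> range H \<Longrightarrow> \<not> K \<subset> K'"
    using Ideals_maximal[of "H 0" "range H"] by (metis rangeI)
  then obtain n where "K = H n" by auto
  then have n: "\<not> H n \<subset> H (Suc n)" using K(2)[OF rangeI, of "Suc n"] by simp
  have "H n \<subseteq> H (Suc n)"
    unfolding H_def
  proof (rule ideal_add_subset[OF ideal_add_in[OF Q(1) UNIV_in] subset_ideal_add[OF UNIV_in]])
    show "h n \<in> ideal_add Q (h (Suc n)) UNIV"
      using ideal_addI[OF step[of n] UNIV_I, of "h (Suc n)" a] by (simp add: mult.commute)
  qed
  then have "h (Suc n) \<in> H n"
    using n gen_in_ideal_add[OF Q(1), of "h (Suc n)" 1] by (auto simp: H_def)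
  then obtain q r where qr: "h (Suc n) = q + h n * r" "q \<in> Q" by (auto simp: H_def elim: ideal_addE)
  have "h (Suc n) * (1 - a * r) = q + r * (h n - a * h (Suc n))"
    using qr(1) by (simp add: algebra_simps)
  then have "h (Suc n) * (1 - a * r) \<in> Q" using Q.add_in[OF qr(2) Q.mult_in(1)[OF step[of n]]] by simp
  then have "1 - a * r \<in> Q" using hQ by (simp add: Q.prime_mult)
  then have "1 \<in> ideal_add Q a UNIV" using ideal_addI[of "1 - a * r" Q r UNIV a] by simp
  then show False using a one_in_iff[OF ideal_add_in[OF Q(1) UNIV_in]] by blast
qed

text \<open>(J + xR)/J is a copy of the domain R/(J : x), in which the powers of the nonunit
  \<open>a\<close> generate ideals with zero intersection. The ideals decrease, so one exponent
  works for all of \<open>F\<close>.\<close>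

lemma small_ideal_avoiding:
  assumes J: "J \<in> Ideals" and Q: "is_prime (colon J x)" and a: "a \<notin> colon J x"
    "ideal_add (colon J x) a UNIV \<noteq> UNIV" and F: "finite F" "F \<inter> J = {}"
  shows "\<exists>J'\<in>Ideals. J \<subset> J' \<and> J' \<subseteq> ideal_add J x UNIV \<and> J' \<inter> F = {}"
proof -
  let ?Q = "colon J x"
  note QI = colon_in[OF J, of x]
  interpret Q: prime_modulus ?Q using Q by unfold_locales
  define W where "W n = ideal_add J (x * a ^ n) UNIV" for n
  have W: "W n \<in> Ideals" for n unfolding W_def by (rule ideal_add_in[OF J UNIV_in])
  have "x * a ^ n \<notin> J" for n
    using Q.power_in_iff[of a n] a(1) by (simp add: colon_def)
  then have JW: "J \<subset> W n" for n unfolding W_def by (rule psubset_ideal_add[OF J])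
  have anti: "W (Suc n) \<subseteq> W n" for n
    using gen_in_ideal_add[OF J, of "x * a ^ n" a] subset_ideal_add[OF UNIV_in, of J]
    unfolding W_def[of "Suc n"] by (intro ideal_add_subset[OF W]) (auto simp: W_def mult_ac)
  have anti': "W n \<subseteq> W m" if "m \<le> n" for m n
    using that by (induction rule: dec_induct) (use anti in auto)
  have "\<exists>n. W n \<inter> F = {}"
    using F
  proof (induction F)
    case (insert f F)
    then obtain n where n: "W n \<inter> F = {}" by auto
    have "\<exists>m. f \<notin> W m"
    proof (rule ccontr)
      assume f: "\<not> ?thesis"
      then obtain j f' where f': "f = j + x * f'" "j \<in> J"
        unfolding W_def by (metis ideal_addE mult.assoc)
      then have "f' \<notin> ?Q" using insert.prems IdealsD(4)[OF J] by (auto simp: colon_def)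
      then obtain m where m: "f' \<notin> ideal_add ?Q (a ^ m) UNIV"
        using krull_intersection[OF QI Q a(2)] by blast
      obtain j' r where "f = j' + x * a ^ m * r" "j' \<in> J"
        using f unfolding W_def by (metis ideal_addE)
      then have "x * (f' - a ^ m * r) = j' - j" using f'(1) by (simp add: algebra_simps)
      then have "f' - a ^ m * r \<in> ?Q"
        using IdealsD(5)[OF J \<open>j' \<in> J\<close> f'(2)] by (simp add: colon_def)
      then show False using m ideal_addI[of "f' - a ^ m * r" ?Q r UNIV "a ^ m"] by simp
    qed
    then obtain m where "f \<notin> W m" by blast
    then have "W (max m n) \<inter> insert f F = {}" using n anti'[of m "max m n"] anti'[of n "max m n"] by auto
    then show ?case by blast
  qed simp
  then obtain n where "W n \<inter> F = {}" by blast
  moreover have "W n \<subseteq> ideal_add J x UNIV"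
    unfolding W_def
    by (rule ideal_add_subset[OF ideal_add_in[OF J UNIV_in] subset_ideal_add[OF UNIV_in] gen_in_ideal_add[OF J]])
  ultimately show ?thesis using W[of n] JW[of n] by blast
qed

text \<open>The usual argument that a maximal annihilator is prime, among the colon ideals of
  infinite index. Maximality only says that (P : a) is \<open>P\<close> or has finite index; it
  remains to exclude nonzero elements in the finite part of R/P.\<close>

lemma infinite_prime_colon:
  assumes J: "J \<in> Ideals" "\<not> finite_mod J UNIV"
  shows "\<exists>x. is_prime (colon J x) \<and> \<not> finite_mod (colon J x) UNIV"
proof -
  have colon_mult: "colon J (x * y) = colon (colon J x) y" for x y
    by (auto simp: colon_def mult.assoc)
  define \<S> where "\<S> = {colon J x | x. \<not> finite_mod (colon J x) UNIV}"
  have "colon J 1 \<in> \<S>" using J(2) by (auto simp: \<S>_def colon_def intro!: exI[of _ 1])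
  moreover have "\<S> \<subseteq> Ideals" using colon_in[OF J(1)] by (auto simp: \<S>_def)
  ultimately obtain P where P: "P \<in> \<S>" "\<And>P'. P' \<in> \<S> \<Longrightarrow> \<not> P \<subset> P'" using Ideals_maximal by metis
  have PI: "P \<in> Ideals" using P(1) \<open>\<S> \<subseteq> Ideals\<close> by blast
  obtain x where x: "P = colon J x" "\<not> finite_mod P UNIV" using P(1) by (auto simp: \<S>_def)
  have dich: "colon P a = P \<or> finite_mod (colon P a) UNIV" for a
  proof (rule disjCI)
    assume "\<not> finite_mod (colon P a) UNIV"
    then have "colon P a \<in> \<S>" unfolding \<S>_def x(1) colon_mult[symmetric] by blast
    then show "colon P a = P" using P(2) subset_colon[OF PI] by blast
  qed
  obtain K where K: "K \<in> Ideals" "P \<subseteq> K" "finite_mod P K" "\<And>x. finite_mod (colon P x) UNIV \<Longrightarrow> x \<in> K"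
    by (rule finite_part[OF PI]) blast
  have KP: "K \<subseteq> P"
  proof (rule ccontr)
    assume "\<not> K \<subseteq> P"
    then obtain k where k: "k \<in> K" "k \<notin> P" by blast
    have fin: "finite_mod (colon P k) UNIV"
      by (rule finite_mod_colon[OF K(3) IdealsD(1)[OF PI] IdealsD(1)[OF K(1)] k(1)])
    \<comment> \<open>Otherwise R/K and K/P, hence R/P, would be finite. So some \<open>c\<close>
      outside \<open>K\<close> multiplies \<open>k\<close> into \<open>P\<close>; but then (P : c)
      contains \<open>k\<close>, is larger than \<open>P\<close>, has finite index, and puts
      \<open>c\<close> into \<open>K\<close>.\<close>
    have "\<not> colon P k \<subseteq> K"
      using finite_mod_trans[OF K(3) finite_mod_mono[OF fin]] x(2) by blast
    then obtain c where c: "k * c \<in> P" "c \<notin> K" by (auto simp: colon_def)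
    then have "k \<in> colon P c" by (simp add: colon_def mult.commute)
    then have "finite_mod (colon P c) UNIV" using dich[of c] k(2) by auto
    then show False using K(4) c(2) by blast
  qed
  have "is_prime P"
    unfolding is_prime_def
  proof (intro conjI allI impI)
    show "is_ideal UNIV P" by (rule IdealsD(1)[OF PI])
    have "finite_mod UNIV UNIV" unfolding finite_mod_def by (intro exI[of _ "{0}"]) auto
    then show "1 \<notin> P" using one_in_iff[OF PI] x(2) by auto
    fix a b assume "a * b \<in> P"
    then have "b \<in> colon P a" by (simp add: colon_def)
    then show "a \<in> P \<or> b \<in> P" using dich[of a] K(4)[of a] KP by auto
  qed
  then show ?thesis using x by blast
qed

lemma smaller_ideal_avoiding:
  assumes J: "J \<in> Ideals" and L: "L \<in> Ideals" "J \<subseteq> L" "\<not> finite_mod J L"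
    and F: "finite F" "F \<inter> J = {}"
  shows "\<exists>J'\<in>Ideals. J \<subset> J' \<and> J' \<subseteq> L \<and> J' \<inter> F = {}"
proof -
  obtain K where K: "finite_mod J K" "\<And>x. finite_mod (colon J x) UNIV \<Longrightarrow> x \<in> K"
    by (rule finite_part[OF J]) blast
  have "\<not> L \<subseteq> K" using finite_mod_mono[OF K(1)] L(3) by blast
  then obtain x where x: "x \<in> L" "\<not> finite_mod (colon J x) UNIV" using K(2) by blast
  then obtain y where y: "is_prime (colon (colon J x) y)" "\<not> finite_mod (colon (colon J x) y) UNIV"
    using infinite_prime_colon[OF colon_in[OF J]] by blast
  define Q where "Q = colon J (x * y)"
  have Q_eq: "Q = colon (colon J x) y" by (simp add: Q_def colon_def mult.assoc)
  have Q: "is_prime Q" "\<not> finite_mod Q UNIV" "Q \<in> Ideals"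
    using y colon_in[OF colon_in[OF J]] unfolding Q_eq by auto
  \<comment> \<open>If every nonzero class were a unit, R/Q would be a field finitely generated as a
    ring, hence finite.\<close>
  have "\<exists>a. a \<notin> Q \<and> ideal_add Q a UNIV \<noteq> UNIV"
  proof (rule ccontr)
    assume *: "\<not> ?thesis"
    have "finite_mod Q UNIV"
    proof (rule finite_mod_maximal[OF Q(3)])
      show "Q \<noteq> UNIV" using Q(1) by (auto simp: is_prime_def)
      fix r assume "r \<notin> Q"
      then have "1 \<in> ideal_add Q r UNIV" using * by auto
      then obtain q s where "1 = q + r * s" "q \<in> Q" by (auto elim: ideal_addE)
      then have "r * s - 1 = - 1 * q" by (simp add: algebra_simps)
      then have "r * s - 1 \<in> Q" using IdealsD(6)[OF Q(3) \<open>q \<in> Q\<close>] by metis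
      then show "\<exists>s. r * s - 1 \<in> Q" by blast
    qed
    then show False using Q(2) by blast
  qed
  then obtain a where a: "a \<notin> Q" "ideal_add Q a UNIV \<noteq> UNIV" by blast
  obtain J' where "J' \<in> Ideals" "J \<subset> J'" "J' \<subseteq> ideal_add J (x * y) UNIV" "J' \<inter> F = {}"
    using small_ideal_avoiding[OF J Q(1)[unfolded Q_def] a[unfolded Q_def] F] by blast
  moreover have "ideal_add J (x * y) UNIV \<subseteq> L"
    by (rule ideal_add_subset[OF L(1,2) IdealsD(7)[OF L(1) x(1)]])
  ultimately show ?thesis by blast
qed

text \<open>
  If every \<open>L \<supset> J\<close> of infinite index had length below \<open>\<omega> \<cdot> v\<close>, then only the finitely many ideals inside
  the finite part of \<open>R/J\<close> could raise the length of \<open>J\<close> above \<open>\<omega> \<cdot> v\<close>.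
\<close>

lemma butlast_len_lower:
  assumes J: "has_len (Suc e) J" and v: "v \<lless> butlast (len (Suc e) J)" and F: "finite F" "F \<inter> J = {}"
  shows "\<exists>J'\<in>Ideals. J \<subset> J' \<and> J' \<inter> F = {} \<and> \<not> butlast (len (Suc e) J') \<lless> v"
proof -
  let ?l = "len (Suc e)"
  have JI: "J \<in> Ideals" using J by (simp add: has_len_def)
  have lv: "length v = e" using list_less_length[OF v] len(1)[OF J] by simp
  have has: "has_len (Suc e) W" if "W \<in> Ideals" "J \<subset> W" for W by (rule len_mono(1)[OF J that])
  obtain K where K: "K \<in> Ideals" "J \<subseteq> K" "finite_mod J K" "\<And>x. finite_mod (colon J x) UNIV \<Longrightarrow> x \<in> K"
    by (rule finite_part[OF JI]) blast
  obtain G where G: "finite G" "\<And>a. a \<in> K \<Longrightarrow> \<exists>f\<in>G. a - f \<in> J"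
    using K(3) by (auto simp: finite_mod_def)
  have "\<exists>L\<in>Ideals. J \<subset> L \<and> \<not> finite_mod J L \<and> \<not> ?l L \<lless> v @ [0]"
  proof (rule ccontr)
    assume none: "\<not> ?thesis"
    \<comment> \<open>Enlarging \<open>W\<close> inside \<open>K\<close> absorbs a further
      representative from \<open>G\<close> and lowers the last entry. Leaving \<open>K\<close> gives
      infinite index over \<open>J\<close>, where the length is below omega times \<open>v\<close>
      by assumption.\<close>
    have "bounded_by W (v @ [card (G - W)])" if "W \<in> Ideals" "J \<subseteq> W" "W \<subseteq> K" for W
      using that
    proof (induction "card (G - W)" arbitrary: W rule: less_induct)
      case less
      show ?case
      proof (rule bounded_byI)
        fix W' assume W': "W' \<in> Ideals" "W \<subset> W'"
        show "\<exists>u. u \<lless> v @ [card (G - W)] \<and> bounded_by W' u"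
        proof (cases "W' \<subseteq> K")
          case True
          obtain x where x: "x \<in> W'" "x \<notin> W" using W'(2) by blast
          then obtain g where g: "g \<in> G" "x - g \<in> J" using G(2) True by blast
          have "g \<in> W'" using Ideals_cancel(2)[OF W'(1), of x g] g(2) x(1) W'(2) less.prems(2) by blast
          moreover have "g \<notin> W"
            using Ideals_cancel(2)[OF less.prems(1), of x g] g(2) x(2) less.prems(2) by blast
          ultimately have "card (G - W') < card (G - W)"
            using g(1) W'(2) G(1) by (intro psubset_card_mono) auto
          moreover from this have "bounded_by W' (v @ [card (G - W')])"
            using less.hyps[of W'] W' less.prems True by blast
          ultimately show ?thesis using list_less_snoc by blast
        next
          case False
          then obtain x where x: "x \<in> W'" "x \<notin> K" by blast
          have "\<not> finite_mod J W'"
            using finite_mod_colon[OF _ IdealsD(1)[OF JI] IdealsD(1)[OF W'(1)] x(1)] K(4) x(2) by blast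
          then have *: "?l W' \<lless> v @ [0]" using none W' less.prems(2) by blast
          have "v @ [0] = v @ [card (G - W)] \<or> v @ [0] \<lless> v @ [card (G - W)]"
            using list_less_snoc[of v v 0] by auto
          then have "?l W' \<lless> v @ [card (G - W)]" using * list_less_trans by metis
          then show ?thesis using len(2)[OF has[OF W'(1)]] W'(2) less.prems(2) by blast
        qed
      qed
    qed
    then have "bounded_by J (v @ [card (G - J)])" using JI K(2) by blast
    then have "\<not> v @ [card (G - J)] \<lless> ?l J" using len(3)[OF J] by blast
    moreover have "?l J = butlast (?l J) @ [last (?l J)]"
      using len(1)[OF J] by (cases "?l J") auto
    ultimately show False using v list_less_snoc[OF list_less_length[OF v]] by metis
  qed
  then obtain L where L: "L \<in> Ideals" "J \<subset> L" "\<not> finite_mod J L" "\<not> ?l L \<lless> v @ [0]" by blast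
  obtain J' where J': "J' \<in> Ideals" "J \<subset> J'" "J' \<subseteq> L" "J' \<inter> F = {}"
    using smaller_ideal_avoiding[OF JI L(1) _ L(3) F] L(2) by blast
  have "\<not> butlast (?l J') \<lless> v"
  proof
    assume *: "butlast (?l J') \<lless> v"
    have "?l J' = butlast (?l J') @ [last (?l J')]"
      using len(1)[OF has[OF J'(1,2)]] by (cases "?l J'") auto
    then have "?l J' \<lless> v @ [0]" using * list_less_snoc[OF list_less_length[OF *]] by metis
    then show False using len_mono_le[OF has[OF J'(1,2)] L(1) J'(3)] L(4) by blast
  qed
  then show ?thesis using J' by blast
qed

end

subsection \<open>Evaluation of integer polynomials\<close>

definition type_ring :: "'r::comm_ring_1 ring" where
  "type_ring = \<lparr>carrier = UNIV, monoid.mult = (*), one = 1, ring.zero = 0, add = (+)\<rparr>"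

lemma type_ring_simps [simp]:
  "carrier type_ring = UNIV" "\<one>\<^bsub>type_ring\<^esub> = 1" "\<zero>\<^bsub>type_ring\<^esub> = 0"
  "a \<otimes>\<^bsub>type_ring\<^esub> b = a * b" "a \<oplus>\<^bsub>type_ring\<^esub> b = a + b"
  by (simp_all add: type_ring_def)

lemma cring_type_ring: "cring (type_ring :: 'r::comm_ring_1 ring)"
proof (rule cringI)
  show "abelian_group (type_ring :: 'r ring)"
    by (rule abelian_groupI) (auto simp: algebra_simps intro: exI[of _ "- x" for x])
  show "Group.comm_monoid (type_ring :: 'r ring)"
    by (rule comm_monoidI) (auto simp: algebra_simps)
qed (simp add: algebra_simps)

definition indet :: "nat \<Rightarrow> int_mpoly" where
  "indet i = Poly_Mapping.single (Poly_Mapping.single i 1) 1"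

lemma poly_mapping_update_eq_add:
  "k \<notin> Poly_Mapping.keys p \<Longrightarrow> Poly_Mapping.update k v p = p + Poly_Mapping.single k v"
  by (rule poly_mapping_eqI) (auto simp: lookup_update lookup_add lookup_single in_keys_iff when_def)

lemma of_int_in_subring: "is_subring S \<Longrightarrow> of_int k \<in> S"
proof -
  assume S: "is_subring S"
  have "of_nat n \<in> S" for n by (induction n) (auto simp: is_subringD[OF S])
  then show ?thesis by (cases k) (auto simp: is_subringD[OF S])
qed

text \<open>Serves as an induction principle: a property of integer polynomials that defines a
  subring holds everywhere once it holds for the variables.\<close>

lemma mpoly_in_subring:
  assumes S: "is_subring S" and indet: "\<And>i. indet i \<in> S"
  shows "P \<in> S"
proof -
  have pow: "Poly_Mapping.single (Poly_Mapping.single i k) 1 \<in> S" for i k :: nat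
  proof (induction k)
    case (Suc k)
    have "(Poly_Mapping.single (Poly_Mapping.single i (Suc k)) 1 :: int_mpoly)
        = Poly_Mapping.single (Poly_Mapping.single i k) 1 * indet i"
      by (simp add: indet_def mult_single flip: single_add)
    then show ?case using Suc indet is_subringD(5)[OF S] by metis
  qed (simp add: is_subringD[OF S])
  have mon: "Poly_Mapping.single m 1 \<in> S" for m :: "nat \<Rightarrow>\<^sub>0 nat"
  proof (induction m rule: update_induct)
    case (update m i k)
    have "(Poly_Mapping.single (Poly_Mapping.update i k m) 1 :: int_mpoly)
        = Poly_Mapping.single m 1 * Poly_Mapping.single (Poly_Mapping.single i k) 1"
      by (simp add: poly_mapping_update_eq_add[OF update(1)] mult_single)
    then show ?case using update(3) pow is_subringD(5)[OF S] by metis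
  qed (simp add: is_subringD[OF S])
  have const: "Poly_Mapping.single 0 c \<in> S" for c :: int
  proof -
    have nat: "(Poly_Mapping.single 0 (int n) :: int_mpoly) = of_nat n" for n
      using single_of_nat[of n] by simp
    have "(Poly_Mapping.single 0 c :: int_mpoly) = of_int c"
      by (cases c) (simp_all only: single_uminus nat of_int_minus of_int_of_nat_eq)
    then show ?thesis using of_int_in_subring[OF S, of c] by metis
  qed
  show "P \<in> S"
  proof (induction P rule: update_induct)
    case (update P m c)
    have "Poly_Mapping.update m c P = P + Poly_Mapping.single 0 c * Poly_Mapping.single m 1"
      by (simp add: poly_mapping_update_eq_add[OF update(1)] mult_single)
    then show ?case using update(3) mon const is_subringD(3,5)[OF S] by metis
  qed (simp add: is_subringD[OF S])
qed

lemma ring_hom_mpoly_unique: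
  assumes B: "ring B" and h: "h \<in> ring_hom type_ring B" and h': "h' \<in> ring_hom type_ring B"
    and eq: "\<And>i. h (indet i) = h' (indet i)"
  shows "h P = h' P"
proof -
  interpret B: ring B by fact
  interpret h: ring_hom_ring type_ring B h
    using h cring.axioms(1)[OF cring_type_ring] B by (intro ring_hom_ringI2)
  interpret h': ring_hom_ring type_ring B h'
    using h' cring.axioms(1)[OF cring_type_ring] B by (intro ring_hom_ringI2)
  have neg: "\<ominus>\<^bsub>type_ring\<^esub> P = - P" for P :: int_mpoly
    by (rule h.R.minus_equality) simp_all
  have diff: "k (P - Q) = k P \<oplus>\<^bsub>B\<^esub> \<ominus>\<^bsub>B\<^esub> k Q" if "ring_hom_ring type_ring B k" for k and P Q :: int_mpoly
  proof -
    interpret k: ring_hom_ring type_ring B k by fact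
    show ?thesis using k.hom_add[of P "- Q"] k.hom_a_inv[of Q] by (simp add: neg)
  qed
  have "is_subring {P. h P = h' P}"
    unfolding is_subring_def
  proof (intro conjI ballI; clarsimp)
    fix P Q assume PQ: "h P = h' P" "h Q = h' Q"
    show "h (P - Q) = h' (P - Q)"
      using PQ diff[OF h.ring_hom_ring_axioms] diff[OF h'.ring_hom_ring_axioms] by simp
    show "h (P * Q) = h' (P * Q)"
      using PQ h.hom_mult[of P Q] h'.hom_mult[of P Q] by simp
  qed (use h.hom_one h'.hom_one in simp)
  then show ?thesis using mpoly_in_subring[of "{P. h P = h' P}" P] eq by blast
qed

section \<open>Evaluation as a ring homomorphism\<close>

context cring
begin

definition mono_val :: "(nat \<Rightarrow> 'a) \<Rightarrow> (nat \<Rightarrow>\<^sub>0 nat) \<Rightarrow> 'a" where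
  "mono_val g m = (\<Otimes>i\<in>Poly_Mapping.keys m. g i [^] Poly_Mapping.lookup m i)"

definition poly_val :: "(nat \<Rightarrow> 'a) \<Rightarrow> int_mpoly \<Rightarrow> 'a" where
  "poly_val g P = (\<Oplus>m\<in>Poly_Mapping.keys P. [Poly_Mapping.lookup P m] \<cdot> mono_val g m)"

text \<open>Variables with exponent 0 contribute the factor 1, so two monomials can be evaluated
  over a common index set.\<close>

lemma mono_val_superset:
  assumes "g \<in> UNIV \<rightarrow> carrier R" "finite A" "Poly_Mapping.keys m \<subseteq> A"
  shows "mono_val g m = (\<Otimes>i\<in>A. g i [^] Poly_Mapping.lookup m i)"
  unfolding mono_val_def
  by (rule finprod_mono_neutral_cong_left) (use assms in \<open>auto simp: in_keys_iff Pi_iff\<close>)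

lemma mono_val_closed: "g \<in> UNIV \<rightarrow> carrier R \<Longrightarrow> mono_val g m \<in> carrier R"
  unfolding mono_val_def by (rule finprod_closed) auto

lemma mono_val_add:
  assumes g: "g \<in> UNIV \<rightarrow> carrier R"
  shows "mono_val g (m + m') = mono_val g m \<otimes> mono_val g m'"
proof -
  let ?A = "Poly_Mapping.keys m \<union> Poly_Mapping.keys m'"
  have "mono_val g (m + m') = (\<Otimes>i\<in>?A. g i [^] Poly_Mapping.lookup (m + m') i)"
    by (rule mono_val_superset[OF g]) (use Poly_Mapping.keys_add[of m m'] in auto)
  also have "\<dots> = (\<Otimes>i\<in>?A. g i [^] Poly_Mapping.lookup m i \<otimes> g i [^] Poly_Mapping.lookup m' i)"
    by (rule finprod_cong') (use g in \<open>auto simp: lookup_add nat_pow_mult Pi_iff\<close>)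
  also have "\<dots> = (\<Otimes>i\<in>?A. g i [^] Poly_Mapping.lookup m i) \<otimes> (\<Otimes>i\<in>?A. g i [^] Poly_Mapping.lookup m' i)"
    by (rule finprod_multf) (use g in \<open>auto simp: Pi_iff\<close>)
  finally show ?thesis by (simp add: mono_val_superset[OF g, of ?A])
qed

lemma poly_val_superset:
  assumes "g \<in> UNIV \<rightarrow> carrier R" "finite A" "Poly_Mapping.keys P \<subseteq> A"
  shows "poly_val g P = (\<Oplus>m\<in>A. [Poly_Mapping.lookup P m] \<cdot> mono_val g m)"
  unfolding poly_val_def
  by (rule add.finprod_mono_neutral_cong_left)
    (use assms mono_val_closed in \<open>auto simp: in_keys_iff Pi_iff add_pow_int_ge\<close>)

lemma poly_val_closed: "g \<in> UNIV \<rightarrow> carrier R \<Longrightarrow> poly_val g P \<in> carrier R"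
  unfolding poly_val_def by (rule finsum_closed) (auto intro: mono_val_closed)

lemma poly_val_add:
  assumes g: "g \<in> UNIV \<rightarrow> carrier R"
  shows "poly_val g (P + Q) = poly_val g P \<oplus> poly_val g Q"
proof -
  let ?A = "Poly_Mapping.keys P \<union> Poly_Mapping.keys Q"
  have "poly_val g (P + Q) = (\<Oplus>m\<in>?A. [Poly_Mapping.lookup (P + Q) m] \<cdot> mono_val g m)"
    by (rule poly_val_superset[OF g]) (use Poly_Mapping.keys_add[of P Q] in auto)
  also have "\<dots> = (\<Oplus>m\<in>?A. [Poly_Mapping.lookup P m] \<cdot> mono_val g m \<oplus> [Poly_Mapping.lookup Q m] \<cdot> mono_val g m)"
    by (rule finsum_cong') (use g mono_val_closed in \<open>auto simp: lookup_add add.int_pow_mult\<close>)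
  also have "\<dots> = (\<Oplus>m\<in>?A. [Poly_Mapping.lookup P m] \<cdot> mono_val g m) \<oplus> (\<Oplus>m\<in>?A. [Poly_Mapping.lookup Q m] \<cdot> mono_val g m)"
    by (rule finsum_addf) (use g mono_val_closed in auto)
  finally show ?thesis by (simp add: poly_val_superset[OF g, of ?A])
qed

lemma poly_val_single:
  assumes g: "g \<in> UNIV \<rightarrow> carrier R"
  shows "poly_val g (Poly_Mapping.single m c) = [c] \<cdot> mono_val g m"
  using poly_val_superset[OF g, of "{m}"] mono_val_closed[OF g] by simp

lemma poly_val_mult:
  assumes g: "g \<in> UNIV \<rightarrow> carrier R"
  shows "poly_val g (P * Q) = poly_val g P \<otimes> poly_val g Q"
proof -
  note cl = poly_val_closed[OF g] mono_val_closed[OF g]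
  have zero: "poly_val g 0 = \<zero>" by (simp add: poly_val_def)
  have single: "poly_val g (Poly_Mapping.single m c * Poly_Mapping.single m' c')
      = poly_val g (Poly_Mapping.single m c) \<otimes> poly_val g (Poly_Mapping.single m' c')" for m c m' c'
    using cl by (simp add: mult_single poly_val_single[OF g] mono_val_add[OF g]
        add_pow_ldistr_int add_pow_rdistr_int add.int_pow_pow mult.commute m_comm)
  have single_left: "poly_val g (Poly_Mapping.single m c * Q) = poly_val g (Poly_Mapping.single m c) \<otimes> poly_val g Q"
    for m c
  proof (induction Q rule: update_induct)
    case (update Q k v)
    then show ?case
      using cl by (simp add: poly_mapping_update_eq_add distrib_left poly_val_add[OF g] single r_distr)
  qed (simp add: zero cl)
  show ?thesis
  proof (induction P rule: update_induct)
    case (update P k v)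
    then show ?case
      using cl by (simp add: poly_mapping_update_eq_add distrib_right poly_val_add[OF g] single_left l_distr)
  qed (simp add: zero cl)
qed

lemma poly_val_indet: "g \<in> UNIV \<rightarrow> carrier R \<Longrightarrow> poly_val g (indet i) = g i"
  by (auto simp: indet_def poly_val_single mono_val_def Pi_iff)

lemma poly_val_ring_hom:
  assumes g: "g \<in> UNIV \<rightarrow> carrier R"
  shows "poly_val g \<in> ring_hom type_ring R"
proof (rule ring_hom_memI)
  have "poly_val g (Poly_Mapping.single 0 1) = \<one>"
    by (simp only: poly_val_single[OF g]) (simp add: mono_val_def)
  then show "poly_val g \<one>\<^bsub>type_ring\<^esub> = \<one>" by simp
qed (auto simp: poly_val_closed[OF g] poly_val_add[OF g] poly_val_mult[OF g])

end

text \<open>Sending the surplus variables to 0 gives a homomorphism on the whole polynomial type; it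
  agrees with \<open>eval_mpoly\<close> on polynomials in the first \<open>length ys\<close>
  variables, and its kernel contains all later ones.\<close>

definition tuple_val :: "('a, 'm) ring_scheme \<Rightarrow> 'a list \<Rightarrow> int_mpoly \<Rightarrow> 'a" where
  "tuple_val B ys = cring.poly_val B (\<lambda>i. if i < length ys then ys ! i else \<zero>\<^bsub>B\<^esub>)"

lemma tuple_val_ring_hom:
  assumes "cring B" "set ys \<subseteq> carrier B"
  shows "tuple_val B ys \<in> ring_hom type_ring B"
proof -
  interpret cring B by fact
  show ?thesis
    unfolding tuple_val_def by (rule poly_val_ring_hom) (auto intro: subsetD[OF assms(2) nth_mem])
qed

lemma tuple_val_indet:
  assumes "cring B" "set ys \<subseteq> carrier B"
  shows "tuple_val B ys (indet i) = (if i < length ys then ys ! i else \<zero>\<^bsub>B\<^esub>)"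
proof -
  interpret cring B by fact
  show ?thesis
    unfolding tuple_val_def by (rule poly_val_indet) (auto intro: subsetD[OF assms(2) nth_mem])
qed

lemma eval_mpoly_eq_tuple_val:
  assumes "cring B" "set ys \<subseteq> carrier B" "P \<in> int_mpolys (length ys)"
  shows "eval_mpoly B ys P = tuple_val B ys P"
proof -
  interpret cring B by fact
  let ?g = "\<lambda>i. if i < length ys then ys ! i else \<zero>\<^bsub>B\<^esub>"
  have g: "?g \<in> UNIV \<rightarrow> carrier B" by (auto intro: subsetD[OF assms(2) nth_mem])
  have "(\<Otimes>\<^bsub>B\<^esub>i\<in>Poly_Mapping.keys m. (ys ! i) [^]\<^bsub>B\<^esub> Poly_Mapping.lookup m i) = mono_val ?g m"
    if "m \<in> Poly_Mapping.keys P" for m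
    unfolding mono_val_def
    by (rule finprod_cong') (use that assms(3) in \<open>auto simp: int_mpolys_def intro!: nat_pow_closed subsetD[OF assms(2) nth_mem]\<close>)
  then show ?thesis
    unfolding eval_mpoly_def tuple_val_def poly_val_def
    by (intro finsum_cong') (auto intro: mono_val_closed[OF g])
qed

lemma ring_hom_tuple_val:
  assumes "cring B" "cring C" "set ys \<subseteq> carrier B" "h \<in> ring_hom B C"
  shows "h (tuple_val B ys P) = tuple_val C (map h ys) P"
proof -
  interpret h: ring_hom_ring B C h
    using assms by (intro ring_hom_ringI2) (auto simp: cring_def)
  have sub: "set (map h ys) \<subseteq> carrier C" using assms(3) by auto
  have "h \<circ> tuple_val B ys \<in> ring_hom type_ring C"
    by (rule ring_hom_trans[OF tuple_val_ring_hom[OF assms(1,3)] assms(4)])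
  then have "(h \<circ> tuple_val B ys) P = tuple_val C (map h ys) P"
    by (rule ring_hom_mpoly_unique[OF _ _ tuple_val_ring_hom[OF assms(2) sub], rotated])
      (use assms(2) in \<open>auto simp: cring_def tuple_val_indet[OF assms(1,3)] tuple_val_indet[OF assms(2) sub]\<close>)
  then show ?thesis by simp
qed

lemma tuple_val_surj:
  assumes "cring B" "ring_generators B ys"
  shows "range (tuple_val B ys) = carrier B"
proof -
  have sub: "set ys \<subseteq> carrier B" using assms(2) by (simp add: ring_generators_def)
  interpret B: cring B by fact
  interpret h: ring_hom_ring type_ring B "tuple_val B ys"
    by (rule ring_hom_ringI2[OF cring.axioms(1)[OF cring_type_ring] B.ring_axioms tuple_val_ring_hom[OF assms(1) sub]])
  have "b \<in> range (tuple_val B ys)" if "b \<in> generate_ring B (set ys)" for b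
    using that
  proof induction
    case one
    then show ?case using h.hom_one by (metis type_ring_simps(2) rangeI)
  next
    case (incl b)
    then obtain i where "i < length ys" "b = ys ! i" by (auto simp: in_set_conv_nth)
    then show ?case using tuple_val_indet[OF assms(1) sub, of i] by (metis rangeI)
  next
    case (a_inv b)
    then obtain P where "b = tuple_val B ys P" by blast
    then have "\<ominus>\<^bsub>B\<^esub> b = tuple_val B ys (\<ominus>\<^bsub>type_ring\<^esub> P)" using h.hom_a_inv[of P] by simp
    then show ?case by (metis rangeI)
  next
    case (eng_add a b)
    then obtain P Q where "a = tuple_val B ys P" "b = tuple_val B ys Q" by blast
    then have "a \<oplus>\<^bsub>B\<^esub> b = tuple_val B ys (P + Q)" using h.hom_add[of P Q] by simp
    then show ?case by simp
  next
    case (eng_mult a b)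
    then obtain P Q where "a = tuple_val B ys P" "b = tuple_val B ys Q" by blast
    then have "a \<otimes>\<^bsub>B\<^esub> b = tuple_val B ys (P * Q)" using h.hom_mult[of P Q] by simp
    then show ?case by simp
  qed
  then show ?thesis using h.hom_closed assms(2) by (auto simp: ring_generators_def)
qed

section \<open>Kernels of evaluation\<close>

definition tuple_kernel :: "('a, 'm) ring_scheme \<Rightarrow> 'a list \<Rightarrow> int_mpoly set" where
  "tuple_kernel B ys = {P. tuple_val B ys P = \<zero>\<^bsub>B\<^esub>}"

lemma tuple_val_arith:
  assumes "cring B" "set ys \<subseteq> carrier B"
  shows "tuple_val B ys P \<in> carrier B" "tuple_val B ys 0 = \<zero>\<^bsub>B\<^esub>" "tuple_val B ys 1 = \<one>\<^bsub>B\<^esub>"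
    "tuple_val B ys (P + Q) = tuple_val B ys P \<oplus>\<^bsub>B\<^esub> tuple_val B ys Q"
    "tuple_val B ys (P * Q) = tuple_val B ys P \<otimes>\<^bsub>B\<^esub> tuple_val B ys Q"
    "tuple_val B ys (P - Q) = tuple_val B ys P \<ominus>\<^bsub>B\<^esub> tuple_val B ys Q"
proof -
  interpret B: cring B by fact
  interpret h: ring_hom_ring type_ring B "tuple_val B ys"
    by (rule ring_hom_ringI2[OF cring.axioms(1)[OF cring_type_ring] B.ring_axioms tuple_val_ring_hom[OF assms]])
  show cl: "tuple_val B ys P \<in> carrier B" for P using h.hom_closed[of P] by simp
  show "tuple_val B ys 0 = \<zero>\<^bsub>B\<^esub>" "tuple_val B ys 1 = \<one>\<^bsub>B\<^esub>"
    using h.hom_zero h.hom_one by simp_all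
  show add: "tuple_val B ys (P + Q) = tuple_val B ys P \<oplus>\<^bsub>B\<^esub> tuple_val B ys Q" for P Q
    using h.hom_add[of P Q] by simp
  show "tuple_val B ys (P * Q) = tuple_val B ys P \<otimes>\<^bsub>B\<^esub> tuple_val B ys Q"
    using h.hom_mult[of P Q] by simp
  have "tuple_val B ys P = tuple_val B ys (P - Q) \<oplus>\<^bsub>B\<^esub> tuple_val B ys Q"
    using add[of "P - Q" Q] by simp
  then show "tuple_val B ys (P - Q) = tuple_val B ys P \<ominus>\<^bsub>B\<^esub> tuple_val B ys Q"
    using cl by (simp add: B.minus_eq B.a_assoc B.r_neg)
qed

lemma tuple_val_eq_iff:
  assumes "cring B" "set ys \<subseteq> carrier B"
  shows "tuple_val B ys P = tuple_val B ys Q \<longleftrightarrow> P - Q \<in> tuple_kernel B ys"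
proof -
  interpret B: cring B by fact
  show ?thesis
    using tuple_val_arith(1)[OF assms] by (simp add: tuple_kernel_def tuple_val_arith(6)[OF assms] B.r_right_minus_eq)
qed

lemma is_ideal_tuple_kernel:
  assumes "cring B" "set ys \<subseteq> carrier B"
  shows "is_ideal UNIV (tuple_kernel B ys)"
proof -
  interpret B: cring B by fact
  show ?thesis
    using tuple_val_arith[OF assms] by (auto simp: is_ideal_def tuple_kernel_def)
qed

lemma indet_in_tuple_kernel:
  assumes "cring B" "set ys \<subseteq> carrier B" "length ys \<le> i"
  shows "indet i \<in> tuple_kernel B ys"
  using tuple_val_indet[OF assms(1,2), of i] assms(3) by (simp add: tuple_kernel_def)

lemma is_subring_int_mpolys: "is_subring (int_mpolys n)"
proof -
  have "P * Q \<in> int_mpolys n" if "P \<in> int_mpolys n" "Q \<in> int_mpolys n" for P Q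
  proof -
    have "Poly_Mapping.keys m \<subseteq> {..<n}" if m: "m \<in> Poly_Mapping.keys (P * Q)" for m
    proof -
      obtain a b where "m = a + b" "a \<in> Poly_Mapping.keys P" "b \<in> Poly_Mapping.keys Q"
        using keys_mult[of P Q] m by auto
      then show ?thesis
        using \<open>P \<in> int_mpolys n\<close> \<open>Q \<in> int_mpolys n\<close> Poly_Mapping.keys_add[of a b]
        by (fastforce simp: int_mpolys_def)
    qed
    then show ?thesis by (simp add: int_mpolys_def)
  qed
  moreover have "P - Q \<in> int_mpolys n" if "P \<in> int_mpolys n" "Q \<in> int_mpolys n" for P Q
  proof -
    have "Poly_Mapping.keys m \<subseteq> {..<n}" if m: "m \<in> Poly_Mapping.keys (P - Q)" for m
    proof -
      have "m \<in> Poly_Mapping.keys P \<or> m \<in> Poly_Mapping.keys Q"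
        using keys_diff[of P Q] m by blast
      then show ?thesis
        using \<open>P \<in> int_mpolys n\<close> \<open>Q \<in> int_mpolys n\<close> unfolding int_mpolys_def by blast
    qed
    then show ?thesis by (simp add: int_mpolys_def)
  qed
  moreover have "1 \<in> int_mpolys n" by (simp add: int_mpolys_def)
  ultimately show ?thesis unfolding is_subring_def by blast
qed

lemma int_adjoin_least: "is_subring S \<Longrightarrow> set xs \<subseteq> S \<Longrightarrow> int_adjoin xs \<subseteq> S"
proof (induction xs)
  case Nil
  then show ?case using of_int_in_subring by auto
next
  case (Cons x xs)
  then have sub: "int_adjoin xs \<subseteq> S" by simp
  have "poly p x \<in> S" if "p \<in> polys_over (int_adjoin xs)" for p
    unfolding poly_altdef
    using that sub Cons.prems
    by (intro is_subring_sum is_subringD(5,7)) (auto simp: polys_over_def)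
  then show ?case by (auto simp: adjoin_def)
qed

abbreviation indets :: "nat \<Rightarrow> int_mpoly list" where
  "indets n \<equiv> map indet [0..<n]"

lemma int_adjoin_indets: "int_adjoin (indets n) \<subseteq> int_mpolys n"
  by (rule int_adjoin_least[OF is_subring_int_mpolys]) (auto simp: indet_def int_mpolys_def)

lemma finitely_generated_mod_indets:
  assumes N: "is_ideal UNIV N" "\<And>i. n \<le> i \<Longrightarrow> indet i \<in> N"
  shows "finitely_generated_mod N (indets n)"
proof
  show "is_ideal UNIV N" by fact
  note S = is_subring_int_adjoin[of "indets n"]
  fix P :: int_mpoly
  have "is_subring {P. \<exists>q\<in>int_adjoin (indets n). P - q \<in> N}"
    unfolding is_subring_def
  proof (intro conjI ballI; clarsimp)
    show "\<exists>q\<in>int_adjoin (indets n). 1 - q \<in> N"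
      using is_subringD(2)[OF S] is_idealD(1)[OF N(1)] by (intro bexI[of _ 1]) auto
    fix P Q p q assume pq: "p \<in> int_adjoin (indets n)" "P - p \<in> N" "q \<in> int_adjoin (indets n)" "Q - q \<in> N"
    have "(P - p) - (Q - q) \<in> N" by (rule is_ideal_diff[OF is_subring_UNIV N(1) pq(2,4)])
    then show "\<exists>r\<in>int_adjoin (indets n). P - Q - r \<in> N"
      using is_subringD(4)[OF S pq(1,3)] by (intro bexI[of _ "p - q"]) (auto simp: algebra_simps)
    have "Q * (P - p) + p * (Q - q) \<in> N"
      using is_idealD[OF N(1)] pq by simp
    then show "\<exists>r\<in>int_adjoin (indets n). P * Q - r \<in> N"
      using is_subringD(5)[OF S pq(1,3)] by (intro bexI[of _ "p * q"]) (auto simp: algebra_simps)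
  qed
  moreover have "indet i \<in> {P. \<exists>q\<in>int_adjoin (indets n). P - q \<in> N}" for i
  proof (cases "i < n")
    case True
    then have "indet i \<in> int_adjoin (indets n)" using set_subset_int_adjoin[of "indets n"] by auto
    then show ?thesis using is_idealD(1)[OF N(1)] by (auto intro!: bexI[of _ "indet i"])
  next
    case False
    then show ?thesis using N(2) is_subringD(1)[OF S] by (auto intro!: bexI[of _ 0])
  qed
  ultimately show "\<exists>q\<in>int_adjoin (indets n). P - q \<in> N" using mpoly_in_subring[of _ P] by blast
qed

subsection \<open>Marked rings and ideals of polynomials\<close>

lemma tuple_kernel_iso:
  assumes "cring B" "cring C" "set ys \<subseteq> carrier B" "marked_iso (B, ys) (C, zs)"
  shows "tuple_kernel B ys = tuple_kernel C zs"
proof -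
  obtain h where h: "h \<in> ring_iso B C" "map h ys = zs" using assms(4) by (auto simp: marked_iso_def)
  have hom: "h \<in> ring_hom B C" and inj: "inj_on h (carrier B)"
    using h(1) by (auto simp: ring_iso_def bij_betw_def)
  interpret B: cring B by fact
  interpret C: cring C by fact
  interpret h: ring_hom_ring B C h
    by (rule ring_hom_ringI2[OF B.ring_axioms C.ring_axioms hom])
  have "tuple_val C zs P = \<zero>\<^bsub>C\<^esub> \<longleftrightarrow> tuple_val B ys P = \<zero>\<^bsub>B\<^esub>" for P
    using ring_hom_tuple_val[OF assms(1,2,3) hom, of P] h(2) h.hom_zero
      inj_onD[OF inj _ tuple_val_arith(1)[OF assms(1,3)] B.zero_closed] by metis
  then show ?thesis by (simp add: tuple_kernel_def)
qed

lemma tuple_kernel_eq_imp_iso: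
  assumes B: "cring B" "ring_generators B ys" and C: "cring C" "ring_generators C zs"
    and eq: "tuple_kernel B ys = tuple_kernel C zs" and len: "length ys = length zs"
  shows "marked_iso (B, ys) (C, zs)"
proof -
  have ys: "set ys \<subseteq> carrier B" and zs: "set zs \<subseteq> carrier C"
    using B(2) C(2) by (auto simp: ring_generators_def)
  define h where "h b = tuple_val C zs (SOME P. tuple_val B ys P = b)" for b
  have h: "h (tuple_val B ys P) = tuple_val C zs P" for P
  proof -
    have "tuple_val B ys (SOME Q. tuple_val B ys Q = tuple_val B ys P) = tuple_val B ys P"
      by (rule someI) (rule refl)
    then show ?thesis
      unfolding h_def using tuple_val_eq_iff[OF B(1) ys] tuple_val_eq_iff[OF C(1) zs] eq by blast
  qed
  have ex: "\<exists>P. b = tuple_val B ys P" if "b \<in> carrier B" for b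
    using tuple_val_surj[OF B] that by blast
  have "h \<in> ring_hom B C"
  proof (rule ring_hom_memI)
    fix a b assume "a \<in> carrier B" "b \<in> carrier B"
    then obtain P Q where PQ: "a = tuple_val B ys P" "b = tuple_val B ys Q" using ex by blast
    show "h a \<in> carrier C" unfolding PQ h by (rule tuple_val_arith(1)[OF C(1) zs])
    show "h (a \<otimes>\<^bsub>B\<^esub> b) = h a \<otimes>\<^bsub>C\<^esub> h b"
      unfolding PQ tuple_val_arith(5)[OF B(1) ys, symmetric] h by (rule tuple_val_arith(5)[OF C(1) zs])
    show "h (a \<oplus>\<^bsub>B\<^esub> b) = h a \<oplus>\<^bsub>C\<^esub> h b"
      unfolding PQ tuple_val_arith(4)[OF B(1) ys, symmetric] h by (rule tuple_val_arith(4)[OF C(1) zs])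
  next
    show "h \<one>\<^bsub>B\<^esub> = \<one>\<^bsub>C\<^esub>"
      unfolding tuple_val_arith(3)[OF B(1) ys, symmetric] h by (rule tuple_val_arith(3)[OF C(1) zs])
  qed
  moreover have "bij_betw h (carrier B) (carrier C)"
    unfolding bij_betw_def
  proof
    show "inj_on h (carrier B)"
    proof (rule inj_onI)
      fix a b assume ab: "a \<in> carrier B" "b \<in> carrier B" "h a = h b"
      obtain P Q where PQ: "a = tuple_val B ys P" "b = tuple_val B ys Q" using ex ab by blast
      then show "a = b"
        using ab(3) tuple_val_eq_iff[OF B(1) ys] tuple_val_eq_iff[OF C(1) zs] eq by (simp add: h)
    qed
    have "h ` carrier B = range (tuple_val C zs)"
      unfolding tuple_val_surj[OF B, symmetric] image_image h ..
    then show "h ` carrier B = carrier C" by (simp only: tuple_val_surj[OF C])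
  qed
  ultimately have iso: "h \<in> ring_iso B C" by (simp add: ring_iso_def)
  have "map h ys = zs"
  proof (rule nth_equalityI)
    fix i assume i: "i < length (map h ys)"
    then have "map h ys ! i = h (tuple_val B ys (indet i))"
      by (simp add: tuple_val_indet[OF B(1) ys])
    also have "\<dots> = zs ! i" using i len by (simp add: h tuple_val_indet[OF C(1) zs])
    finally show "map h ys ! i = zs ! i" .
  qed (simp add: len)
  then show ?thesis using iso by (auto simp: marked_iso_def)
qed

lemma marked_rings_memD:
  assumes "(B, ys) \<in> marked_rings n"
  shows "cring B" "set ys \<subseteq> carrier B" "ring_generators B ys" "length ys = n"
  using assms by (auto simp: marked_rings_def ring_generators_def)

lemma marked_ring_classes_mem:
  assumes "c \<in> marked_ring_classes n"
  shows "c \<noteq> {}" "c \<subseteq> marked_rings n"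
    "p \<in> c \<Longrightarrow> q \<in> marked_rings n \<Longrightarrow> q \<in> c \<longleftrightarrow> marked_iso p q"
proof -
  let ?r = "{(p, q). p \<in> marked_rings n \<and> q \<in> marked_rings n \<and> marked_iso p q}"
  have c: "c \<in> marked_rings n // ?r" using assms by (simp add: marked_ring_classes_def)
  show "c \<noteq> {}" using in_quotient_imp_non_empty[OF equiv_marked_iso c] .
  show sub: "c \<subseteq> marked_rings n" using in_quotient_imp_subset[OF equiv_marked_iso c] .
  show "q \<in> c \<longleftrightarrow> marked_iso p q" if p: "p \<in> c" and q: "q \<in> marked_rings n"
  proof
    assume "q \<in> c"
    then have "(p, q) \<in> ?r" using in_quotient_imp_in_rel[OF equiv_marked_iso c, of p q] p by simp
    then show "marked_iso p q" by simp
  next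
    assume "marked_iso p q"
    then have "(p, q) \<in> ?r" using p q sub by auto
    then show "q \<in> c" by (rule in_quotient_imp_closed[OF equiv_marked_iso c p])
  qed
qed

text \<open>Isomorphic marked rings have the same kernel, so the intersection is the common value
  and requires no choice of a representative.\<close>

definition class_ideal :: "(nat ring \<times> nat list) set \<Rightarrow> int_mpoly set" where
  "class_ideal c = (\<Inter>(B, ys)\<in>c. tuple_kernel B ys)"

lemma class_ideal_eq:
  assumes c: "c \<in> marked_ring_classes n" and p: "(B, ys) \<in> c"
  shows "class_ideal c = tuple_kernel B ys"
proof -
  have "tuple_kernel C zs = tuple_kernel B ys" if q: "(C, zs) \<in> c" for C zs
  proof -
    have B: "(B, ys) \<in> marked_rings n" and C: "(C, zs) \<in> marked_rings n"
      using marked_ring_classes_mem(2)[OF c] p q by auto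
    have "marked_iso (B, ys) (C, zs)" using marked_ring_classes_mem(3)[OF c p C] q by simp
    then show ?thesis
      using tuple_kernel_iso marked_rings_memD[OF B] marked_rings_memD[OF C] by metis
  qed
  then have "(case p of (C, zs) \<Rightarrow> tuple_kernel C zs) = tuple_kernel B ys" if "p \<in> c" for p
    using that by (cases p) simp
  then show ?thesis using p unfolding class_ideal_def by (subst INF_cong[OF refl]) auto
qed

lemma class_idealE:
  assumes "c \<in> marked_ring_classes n"
  obtains B ys where "(B, ys) \<in> c" "cring B" "set ys \<subseteq> carrier B" "ring_generators B ys" "length ys = n"
    "class_ideal c = tuple_kernel B ys"
proof -
  obtain B ys where p: "(B, ys) \<in> c" using marked_ring_classes_mem(1)[OF assms] by auto
  then have "(B, ys) \<in> marked_rings n" using marked_ring_classes_mem(2)[OF assms] by blast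
  then show ?thesis using that[OF p] marked_rings_memD class_ideal_eq[OF assms p] by blast
qed

lemma is_ideal_class_ideal: "c \<in> marked_ring_classes n \<Longrightarrow> is_ideal UNIV (class_ideal c)"
  by (erule class_idealE) (simp add: is_ideal_tuple_kernel)

lemma indet_in_class_ideal: "c \<in> marked_ring_classes n \<Longrightarrow> n \<le> i \<Longrightarrow> indet i \<in> class_ideal c"
  by (erule class_idealE) (simp add: indet_in_tuple_kernel)

lemma class_ideal_inj:
  assumes c: "c \<in> marked_ring_classes n" and c': "c' \<in> marked_ring_classes n"
    and eq: "class_ideal c = class_ideal c'"
  shows "c = c'"
proof -
  obtain B ys where B: "(B, ys) \<in> c" "cring B" "ring_generators B ys" "length ys = n"
    "class_ideal c = tuple_kernel B ys" using class_idealE[OF c] by metis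
  obtain C zs where C: "(C, zs) \<in> c'" "cring C" "ring_generators C zs" "length zs = n"
    "class_ideal c' = tuple_kernel C zs" using class_idealE[OF c'] by metis
  have "marked_iso (B, ys) (C, zs)"
    using tuple_kernel_eq_imp_iso[OF B(2,3) C(2,3)] B(4,5) C(4,5) eq by simp
  moreover have "(C, zs) \<in> marked_rings n" using marked_ring_classes_mem(2)[OF c'] C(1) by blast
  ultimately have "(C, zs) \<in> c" using marked_ring_classes_mem(3)[OF c B(1)] by simp
  then have "c \<inter> c' \<noteq> {}" using C(1) by blast
  then show ?thesis
    using quotient_disj[OF equiv_marked_iso] c c' unfolding marked_ring_classes_def by blast
qed

lemma class_ideal_marked_class:
  assumes A: "cring A" "ring_generators A xs"
  shows "class_ideal (marked_class A xs) = tuple_kernel A xs"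
proof -
  note c = marked_class_in_marked_ring_classes[OF A]
  obtain B ys where B: "(B, ys) \<in> marked_class A xs" "cring B"
    "class_ideal (marked_class A xs) = tuple_kernel B ys" using class_idealE[OF c] by metis
  have "marked_iso (A, xs) (B, ys)" using B(1) by (simp add: marked_class_def)
  then show ?thesis
    using tuple_kernel_iso[OF A(1) B(2)] B(3) A(2) by (simp add: ring_generators_def)
qed

lemma is_ideal_imp_ideal:
  assumes "is_ideal UNIV J"
  shows "ideal J (type_ring :: 'r::comm_ring_1 ring)"
proof -
  interpret cring "type_ring :: 'r ring" by (rule cring_type_ring)
  show ?thesis
  proof (rule idealI[OF ring_axioms])
    show "subgroup J (add_monoid type_ring)"
    proof (rule add.subgroupI)
      show "\<ominus>\<^bsub>type_ring\<^esub> a \<in> J" if "a \<in> J" for a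
      proof -
        have "\<ominus>\<^bsub>type_ring\<^esub> a = 0 - a" by (rule minus_equality) simp_all
        then show ?thesis
          using is_ideal_diff[OF is_subring_UNIV assms is_idealD(1)[OF assms] that] by simp
      qed
    qed (use is_idealD[OF assms] in auto)
  qed (use is_idealD[OF assms] in auto)
qed

text \<open>The witness is the quotient ring marked by the first \<open>n\<close> variables. Its
  carrier consists of cosets, and \<open>marked_class\<close> moves it to the carrier type
  \<open>nat\<close>.\<close>

lemma class_ideal_surj:
  assumes J: "is_ideal UNIV J" and indet: "\<And>i. n \<le> i \<Longrightarrow> indet i \<in> J"
  shows "\<exists>c\<in>marked_ring_classes n. class_ideal c = J"
proof -
  interpret U: cring "type_ring :: int_mpoly ring" by (rule cring_type_ring)
  interpret J: ideal J type_ring by (rule is_ideal_imp_ideal[OF J])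
  let ?Q = "type_ring Quot J"
  interpret Q: cring ?Q by (rule J.quotient_is_cring[OF cring_type_ring])
  define \<pi> where "\<pi> P = J +>\<^bsub>type_ring\<^esub> P" for P
  have hom: "\<pi> \<in> ring_hom type_ring ?Q"
    using J.rcos_ring_hom by (simp add: \<pi>_def[abs_def])
  have ker: "\<pi> P = \<zero>\<^bsub>?Q\<^esub> \<longleftrightarrow> P \<in> J" for P
  proof
    assume "\<pi> P = \<zero>\<^bsub>?Q\<^esub>"
    then have "J +>\<^bsub>type_ring\<^esub> P = J" by (simp add: \<pi>_def FactRing_def)
    then show "P \<in> J" using J.a_rcos_self[of P] by simp
  next
    assume "P \<in> J"
    then show "\<pi> P = \<zero>\<^bsub>?Q\<^esub>" using J.a_rcos_const[of P] by (simp add: \<pi>_def FactRing_def)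
  qed
  define ys where "ys = map \<pi> (indets n)"
  have ys: "set ys \<subseteq> carrier ?Q" using ring_hom_closed[OF hom] by (auto simp: ys_def)
  have val: "tuple_val ?Q ys P = \<pi> P" for P
  proof (rule ring_hom_mpoly_unique[OF Q.ring_axioms tuple_val_ring_hom[OF Q.cring_axioms ys] hom])
    show "tuple_val ?Q ys (indet i) = \<pi> (indet i)" for i
    proof (cases "i < n")
      case True
      then show ?thesis by (simp add: tuple_val_indet[OF Q.cring_axioms ys]) (simp add: ys_def)
    next
      case False
      then have "\<pi> (indet i) = \<zero>\<^bsub>?Q\<^esub>" using ker indet by simp
      then show ?thesis
        using False tuple_val_indet[OF Q.cring_axioms ys, of i] by (simp add: ys_def)
    qed
  qed
  have gen: "ring_generators ?Q ys"
  proof -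
    interpret h: ring_hom_ring type_ring ?Q \<pi>
      by (rule ring_hom_ringI2[OF U.ring_axioms Q.ring_axioms hom])
    let ?G = "generate_ring ?Q (set ys)"
    have "is_subring {P. \<pi> P \<in> ?G}"
      unfolding is_subring_def
    proof (intro conjI ballI; clarsimp)
      show "\<pi> 1 \<in> ?G" using generate_ring.one[of ?Q "set ys"] h.hom_one by simp
      fix P R assume PR: "\<pi> P \<in> ?G" "\<pi> R \<in> ?G"
      have "\<pi> P \<oplus>\<^bsub>?Q\<^esub> \<ominus>\<^bsub>?Q\<^esub> \<pi> R \<in> ?G" by (intro generate_ring.eng_add generate_ring.a_inv PR)
      then show "\<pi> (P - R) \<in> ?G"
        using tuple_val_arith(6)[OF Q.cring_axioms ys, of P R] by (simp add: val a_minus_def)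
      show "\<pi> (P * R) \<in> ?G"
        using tuple_val_arith(5)[OF Q.cring_axioms ys, of P R] generate_ring.eng_mult[OF PR] by (simp add: val)
    qed
    moreover have "indet i \<in> {P. \<pi> P \<in> ?G}" for i
    proof (cases "i < n")
      case True
      then show ?thesis by (auto simp: ys_def intro!: generate_ring.incl)
    next
      case False
      then have "\<pi> (indet i) = \<zero>\<^bsub>?Q\<^esub>" using ker indet by simp
      \<comment> \<open>\<open>generate_ring\<close> has no rule for zero, so zero is obtained as 1
        - 1.\<close>
      also have "\<dots> = \<one>\<^bsub>?Q\<^esub> \<oplus>\<^bsub>?Q\<^esub> \<ominus>\<^bsub>?Q\<^esub> \<one>\<^bsub>?Q\<^esub>" by (simp add: Q.r_neg)
      also have "\<dots> \<in> ?G" by (intro generate_ring.eng_add generate_ring.a_inv generate_ring.one)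
      finally show ?thesis by simp
    qed
    ultimately have "\<pi> P \<in> ?G" for P using mpoly_in_subring[of "{P. \<pi> P \<in> ?G}" P] by blast
    moreover have "carrier ?Q \<subseteq> range \<pi>" by (auto simp: FactRing_def A_RCOSETS_def' \<pi>_def)
    ultimately have "carrier ?Q \<subseteq> ?G" by blast
    then show ?thesis using ys Q.generate_ring_incl[OF ys] by (auto simp: ring_generators_def)
  qed
  have "tuple_kernel ?Q ys = J" by (simp add: tuple_kernel_def val ker)
  then show ?thesis
    using class_ideal_marked_class[OF Q.cring_axioms gen] marked_class_in_marked_ring_classes[OF Q.cring_axioms gen]
    by (auto simp: ys_def)
qed

lemma vanishing_set_iff:
  assumes "P \<in> int_mpolys n" "c \<in> marked_ring_classes n"
  shows "c \<in> vanishing_set n P \<longleftrightarrow> P \<in> class_ideal c" "c \<in> nonvanishing_set n P \<longleftrightarrow> P \<notin> class_ideal c"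
proof -
  have "eval_mpoly B ys P = \<zero>\<^bsub>B\<^esub> \<longleftrightarrow> P \<in> class_ideal c" if p: "(B, ys) \<in> c" for B ys
  proof -
    have B: "(B, ys) \<in> marked_rings n" using p marked_ring_classes_mem(2)[OF assms(2)] by blast
    show ?thesis
      using marked_rings_memD[OF B] eval_mpoly_eq_tuple_val[of B ys P] assms(1)
      by (simp add: class_ideal_eq[OF assms(2) p] tuple_kernel_def)
  qed
  then have *: "(case p of (B, ys) \<Rightarrow> eval_mpoly B ys P = \<zero>\<^bsub>B\<^esub>) \<longleftrightarrow> P \<in> class_ideal c"
      "(case p of (B, ys) \<Rightarrow> eval_mpoly B ys P \<noteq> \<zero>\<^bsub>B\<^esub>) \<longleftrightarrow> P \<notin> class_ideal c" if "p \<in> c" for p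
    using that by (cases p; simp)+
  obtain p where "p \<in> c" using marked_ring_classes_mem(1)[OF assms(2)] by blast
  then have "(\<forall>p\<in>c. case p of (B, ys) \<Rightarrow> eval_mpoly B ys P = \<zero>\<^bsub>B\<^esub>) \<longleftrightarrow> P \<in> class_ideal c"
      "(\<forall>p\<in>c. case p of (B, ys) \<Rightarrow> eval_mpoly B ys P \<noteq> \<zero>\<^bsub>B\<^esub>) \<longleftrightarrow> P \<notin> class_ideal c"
    using * by blast+
  then show "c \<in> vanishing_set n P \<longleftrightarrow> P \<in> class_ideal c" "c \<in> nonvanishing_set n P \<longleftrightarrow> P \<notin> class_ideal c"
    using assms(2) by (simp_all add: vanishing_set_def nonvanishing_set_def)
qed

text \<open>A larger ideal keeps all vanishing conditions of \<open>c\<close>, so only the finitely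
  many nonvanishing conditions are left as a constraint.\<close>

lemma marked_ring_space_neighborhood:
  assumes "openin (marked_ring_space n) U" "c \<in> U"
  shows "\<exists>F. finite F \<and> F \<inter> class_ideal c = {} \<and>
    (\<forall>c'\<in>marked_ring_classes n. class_ideal c \<subseteq> class_ideal c' \<longrightarrow> F \<inter> class_ideal c' = {} \<longrightarrow> c' \<in> U)"
proof -
  have "generate_topology_on (vanishing_set n ` int_mpolys n \<union> nonvanishing_set n ` int_mpolys n) U"
    using assms(1) by (simp add: marked_ring_space_def openin_topology_generated_by_iff)
  then show ?thesis
    using assms(2)
  proof (induction U)
    case (Int U V)
    then obtain F G where "finite F" "F \<inter> class_ideal c = {}"
        "\<forall>c'\<in>marked_ring_classes n. class_ideal c \<subseteq> class_ideal c' \<longrightarrow> F \<inter> class_ideal c' = {} \<longrightarrow> c' \<in> U"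
      "finite G" "G \<inter> class_ideal c = {}"
        "\<forall>c'\<in>marked_ring_classes n. class_ideal c \<subseteq> class_ideal c' \<longrightarrow> G \<inter> class_ideal c' = {} \<longrightarrow> c' \<in> V"
      by auto
    then show ?case by (intro exI[of _ "F \<union> G"]) (auto simp: Int_Un_distrib2)
  next
    case (UN K)
    then obtain U where "U \<in> K" "c \<in> U" by blast
    then obtain F where "finite F" "F \<inter> class_ideal c = {}"
        "\<forall>c'\<in>marked_ring_classes n. class_ideal c \<subseteq> class_ideal c' \<longrightarrow> F \<inter> class_ideal c' = {} \<longrightarrow> c' \<in> U"
      using UN.IH[OF \<open>U \<in> K\<close> \<open>c \<in> U\<close>] by (elim exE conjE)
    then show ?case using \<open>U \<in> K\<close> by (intro exI[of _ F]) auto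
  next
    case (Basis U)
    then obtain P where P: "P \<in> int_mpolys n" "U = vanishing_set n P \<or> U = nonvanishing_set n P" by auto
    have c: "c \<in> marked_ring_classes n"
      using Basis P(2) by (auto simp: vanishing_set_def nonvanishing_set_def)
    show ?case
    proof (cases "P \<in> class_ideal c")
      case True
      then have "U = vanishing_set n P" using P vanishing_set_iff[OF P(1) c] Basis(2) by auto
      then show ?thesis using True vanishing_set_iff(1)[OF P(1)] by (intro exI[of _ "{}"]) auto
    next
      case False
      then have "U = nonvanishing_set n P" using P vanishing_set_iff[OF P(1) c] Basis(2) by auto
      then show ?thesis using False vanishing_set_iff(2)[OF P(1)] by (intro exI[of _ "{P}"]) auto
    qed
  qed simp
qed

text \<open>
  Each ideal is finitely generated modulo the variables beyond the first \<open>n\<close>, and modulo these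
  variables the polynomials of \<open>F\<close> may be replaced by polynomials in the first \<open>n\<close> variables.
\<close>

lemma openin_marked_ring_space:
  assumes J: "is_ideal UNIV J" "\<And>i. n \<le> i \<Longrightarrow> indet i \<in> J" and F: "finite F"
  shows "openin (marked_ring_space n) {c \<in> marked_ring_classes n. J \<subseteq> class_ideal c \<and> F \<inter> class_ideal c = {}}"
proof -
  let ?X = "marked_ring_space n"
  interpret U: cring "type_ring :: int_mpoly ring" by (rule cring_type_ring)
  \<comment> \<open>The kernel of the endomorphism that fixes the first \<open>n\<close> variables
    and sends the others to 0.\<close>
  define N where "N = tuple_kernel (type_ring :: int_mpoly ring) (indets n)"
  have N: "is_ideal UNIV N" "\<And>i. n \<le> i \<Longrightarrow> indet i \<in> N"
    using is_ideal_tuple_kernel[OF U.cring_axioms, of "indets n"]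
      indet_in_tuple_kernel[OF U.cring_axioms, of "indets n"] by (auto simp: N_def)
  interpret finitely_generated_mod N "indets n" by (rule finitely_generated_mod_indets[OF N])
  \<comment> \<open>\<open>I\<close> is the kernel of an evaluation that kills the later variables;
    such an evaluation factors through the endomorphism defining \<open>N\<close>.\<close>
  have above: "I \<in> Ideals" if I: "is_ideal UNIV I" "\<And>i. n \<le> i \<Longrightarrow> indet i \<in> I" for I
  proof -
    obtain c where c: "c \<in> marked_ring_classes n" "class_ideal c = I" using class_ideal_surj[OF I] by blast
    obtain B ys where "(B, ys) \<in> c" and B: "cring B" "set ys \<subseteq> carrier B"
      and "ring_generators B ys" and B': "length ys = n" "class_ideal c = tuple_kernel B ys"
      by (rule class_idealE[OF c(1)])
    have "map (tuple_val B ys) (indets n) = ys"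
      by (rule nth_equalityI) (auto simp: B'(1) tuple_val_indet[OF B(1,2)])
    then have "tuple_val B ys (tuple_val type_ring (indets n) P) = tuple_val B ys P" for P
      using ring_hom_tuple_val[OF U.cring_axioms B(1) _ tuple_val_ring_hom[OF B(1,2)], of "indets n" P] by simp
    then have "N \<subseteq> tuple_kernel B ys"
      using tuple_val_arith(2)[OF B(1,2)] by (auto simp: N_def tuple_kernel_def) metis
    then show ?thesis using B'(2) c(2) I(1) by (simp add: Ideals_def)
  qed
  have cI: "class_ideal c \<in> Ideals" if "c \<in> marked_ring_classes n" for c
    using above[OF is_ideal_class_ideal[OF that] indet_in_class_ideal[OF that]] by blast
  have op: "openin ?X (vanishing_set n P)" "openin ?X (nonvanishing_set n P)" if "P \<in> int_mpolys n" for P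
    using that unfolding marked_ring_space_def by (auto intro!: topology_generated_by_Basis)
  obtain G where G: "finite G" "G \<subseteq> J \<inter> int_adjoin (indets n)" "\<And>I. I \<in> Ideals \<Longrightarrow> G \<subseteq> I \<Longrightarrow> J \<subseteq> I"
    using generators[OF above[OF J]] by metis
  obtain q where q: "\<And>P. q P \<in> int_adjoin (indets n) \<and> P - q P \<in> N" using generated by metis
  let ?L = "{c \<in> marked_ring_classes n. J \<subseteq> class_ideal c \<and> F \<inter> class_ideal c = {}}"
  \<comment> \<open>The whole space is included so that the intersection is right even when
    \<open>G\<close> and \<open>F\<close> are empty.\<close>
  let ?R = "\<Inter>(insert (topspace ?X) (vanishing_set n ` G \<union> (\<lambda>P. nonvanishing_set n (q P)) ` F))"
  have "?L = ?R"
  proof (rule Set.set_eqI)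
    fix c
    show "c \<in> ?L \<longleftrightarrow> c \<in> ?R"
    proof (cases "c \<in> marked_ring_classes n")
      case c: True
      have "J \<subseteq> class_ideal c \<longleftrightarrow> G \<subseteq> class_ideal c" using G(2) G(3)[OF cI[OF c]] by blast
      also have "\<dots> \<longleftrightarrow> (\<forall>P\<in>G. c \<in> vanishing_set n P)"
        using vanishing_set_iff(1)[OF _ c] G(2) int_adjoin_indets[of n] by blast
      finally have 1: "J \<subseteq> class_ideal c \<longleftrightarrow> (\<forall>P\<in>G. c \<in> vanishing_set n P)" .
      have "P \<in> class_ideal c \<longleftrightarrow> q P \<in> class_ideal c" for P
        using Ideals_cancel(2)[OF cI[OF c]] IdealsD(2)[OF cI[OF c]] q by blast
      then have "F \<inter> class_ideal c = {} \<longleftrightarrow> (\<forall>P\<in>F. q P \<notin> class_ideal c)" by blast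
      also have "\<dots> \<longleftrightarrow> (\<forall>P\<in>F. c \<in> nonvanishing_set n (q P))"
        using vanishing_set_iff(2)[OF _ c] q int_adjoin_indets[of n] by blast
      finally show ?thesis using 1 c by (auto simp: topspace_marked_ring_space)
    qed (simp add: topspace_marked_ring_space)
  qed
  moreover have "openin ?X ?R"
    by (rule openin_Inter) (use G(1,2) F op q int_adjoin_indets[of n] in auto)
  ultimately show ?thesis by simp
qed

subsection \<open>Chains of prime ideals\<close>

text \<open>A finite supremum of a nonempty set in \<open>enat\<close> is attained. The prime
  \<open>P0\<close> makes the set nonempty; over the empty set the supremum 0 would not provide a
  chain.\<close>

lemma krull_dim_enatD:
  assumes "krull_dim A = enat d" and prime: "primeideal P0 A"
  shows "\<exists>P. (\<forall>i\<le>d. primeideal (P i) A) \<and> (\<forall>i<d. P i \<subset> P (Suc i))"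
    "(\<forall>i\<le>n. primeideal (P i) A) \<Longrightarrow> (\<forall>i<n. P i \<subset> P (Suc i)) \<Longrightarrow> n \<le> d"
proof -
  define S where "S = {enat n | n. \<exists>P. (\<forall>i\<le>n. primeideal (P i) A) \<and> (\<forall>i<n. P i \<subset> P (Suc i))}"
  have Sup: "Sup S = enat d" using assms(1) by (simp add: krull_dim_def S_def)
  have "enat 0 \<in> S" unfolding S_def using prime by (auto intro!: exI[of _ "\<lambda>_. P0"])
  then have ne: "S \<noteq> {}" by blast
  then have "finite S" "Max S = enat d" using Sup by (auto simp: Sup_enat_def split: if_splits)
  then have "enat d \<in> S" using Max_in[OF _ ne] by metis
  then show "\<exists>P. (\<forall>i\<le>d. primeideal (P i) A) \<and> (\<forall>i<d. P i \<subset> P (Suc i))" by (auto simp: S_def)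
  assume "\<forall>i\<le>n. primeideal (P i) A" "\<forall>i<n. P i \<subset> P (Suc i)"
  then have "enat n \<in> S" by (auto simp: S_def)
  then show "n \<le> d" using Sup_upper[of "enat n" S] Sup by simp
qed

section \<open>Primes of the ring and primes above the kernel\<close>

context
  fixes A :: "('a, 'm) ring_scheme" and xs :: "'a list"
  assumes A: "cring A" and gen: "ring_generators A xs"
begin

lemma gen_sub: "set xs \<subseteq> carrier A"
  using gen by (simp add: ring_generators_def)

lemma is_prime_vimage:
  assumes "primeideal P A"
  shows "is_prime (tuple_val A xs -` P)" "tuple_kernel A xs \<subseteq> tuple_val A xs -` P"
proof -
  interpret P: primeideal P A by fact
  note v = tuple_val_arith[OF A gen_sub]
  show "is_prime (tuple_val A xs -` P)"
    unfolding is_prime_def is_ideal_def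
    using v P.I_prime[OF v(1) v(1)] P.I_l_closed[OF _ v(1)] P.one_imp_carrier P.I_notcarr P.a_closed
    by auto
  show "tuple_kernel A xs \<subseteq> tuple_val A xs -` P" by (auto simp: tuple_kernel_def)
qed

lemma vimage_psubset:
  assumes "P \<subset> P'" "P' \<subseteq> carrier A"
  shows "tuple_val A xs -` P \<subset> tuple_val A xs -` P'"
proof -
  obtain a where a: "a \<in> P'" "a \<notin> P" using assms(1) by blast
  then obtain Q where "a = tuple_val A xs Q" using tuple_val_surj[OF A gen] assms(2) by blast
  then show ?thesis using a assms(1) by auto
qed

lemma prime_chain_vimage:
  assumes "\<forall>i\<le>n. primeideal (P i) A" "\<forall>i<n. P i \<subset> P (Suc i)"
  shows "prime_chain n (tuple_val A xs -` P 0)"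
  using assms
proof (induction n arbitrary: P)
  case (Suc n)
  have "prime_chain n (tuple_val A xs -` P (Suc 0))"
    using Suc.IH[of "\<lambda>i. P (Suc i)"] Suc.prems by simp
  moreover have P1: "primeideal (P (Suc 0)) A" using Suc.prems by simp
  then have "is_prime (tuple_val A xs -` P (Suc 0))" by (rule is_prime_vimage(1))
  moreover have "P (Suc 0) \<subseteq> carrier A"
    using primeideal.axioms(1)[OF P1] by (simp add: additive_subgroup.a_subset ideal.axioms(1))
  then have "tuple_val A xs -` P 0 \<subset> tuple_val A xs -` P (Suc 0)"
    using Suc.prems(2) by (intro vimage_psubset) auto
  ultimately show ?case unfolding prime_chain.simps by blast
qed simp

lemma primeideal_image:
  assumes Q: "is_prime Q" "tuple_kernel A xs \<subseteq> Q"
  shows "primeideal (tuple_val A xs ` Q) A" "tuple_val A xs P \<in> tuple_val A xs ` Q \<longleftrightarrow> P \<in> Q"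
proof -
  interpret A: cring A by (rule A)
  interpret Q: prime_modulus Q using Q(1) by unfold_locales
  note v = tuple_val_arith[OF A gen_sub]
  show mem: "tuple_val A xs P \<in> tuple_val A xs ` Q \<longleftrightarrow> P \<in> Q" for P
    using tuple_val_eq_iff[OF A gen_sub] Q(2) Q.cong_in_iff by blast
  have surj: "\<exists>P. a = tuple_val A xs P" if "a \<in> carrier A" for a
    using tuple_val_surj[OF A gen] that by blast
  show "primeideal (tuple_val A xs ` Q) A"
  proof (rule primeidealI)
    show "ideal (tuple_val A xs ` Q) A"
    proof (rule idealI[OF A.ring_axioms])
      show "subgroup (tuple_val A xs ` Q) (add_monoid A)"
      proof (rule A.add.subgroupI)
        show "tuple_val A xs ` Q \<noteq> {}" using Q.zero_in by blast
        fix a assume "a \<in> tuple_val A xs ` Q"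
        then obtain P where P: "a = tuple_val A xs P" "P \<in> Q" by blast
        have "\<ominus>\<^bsub>A\<^esub> a = tuple_val A xs (0 - P)"
          unfolding v(6) v(2) P(1) using v(1)[of P] by (simp add: a_minus_def)
        then show "\<ominus>\<^bsub>A\<^esub> a \<in> tuple_val A xs ` Q" using Q.diff_in[OF Q.zero_in P(2)] by simp
      next
        fix a b assume "a \<in> tuple_val A xs ` Q" "b \<in> tuple_val A xs ` Q"
        then show "a \<oplus>\<^bsub>A\<^esub> b \<in> tuple_val A xs ` Q"
          using Q.add_in by (auto simp: v(4)[symmetric])
      qed (use v(1) in auto)
      fix a b assume ab: "a \<in> tuple_val A xs ` Q" "b \<in> carrier A"
      obtain P R where "a = tuple_val A xs P" "P \<in> Q" "b = tuple_val A xs R" using ab surj by blast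
      then show "b \<otimes>\<^bsub>A\<^esub> a \<in> tuple_val A xs ` Q" "a \<otimes>\<^bsub>A\<^esub> b \<in> tuple_val A xs ` Q"
        using Q.mult_in by (auto simp: v(5)[symmetric])
    qed
    show "carrier A \<noteq> tuple_val A xs ` Q"
      using mem[of 1] Q.one_notin v(1) by metis
    fix a b assume ab: "a \<in> carrier A" "b \<in> carrier A" "a \<otimes>\<^bsub>A\<^esub> b \<in> tuple_val A xs ` Q"
    obtain P R where PR: "a = tuple_val A xs P" "b = tuple_val A xs R" using ab(1,2) surj by blast
    then have "P * R \<in> Q" using ab(3) mem by (simp add: v(5)[symmetric])
    then show "a \<in> tuple_val A xs ` Q \<or> b \<in> tuple_val A xs ` Q" unfolding PR mem by (simp add: Q.prime_mult)
  qed (rule A)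
qed

lemma prime_chain_image:
  assumes "is_prime Q" "tuple_kernel A xs \<subseteq> Q" "prime_chain n Q"
  shows "\<exists>P. P 0 = tuple_val A xs ` Q \<and> (\<forall>i\<le>n. primeideal (P i) A) \<and> (\<forall>i<n. P i \<subset> P (Suc i))"
  using assms
proof (induction n arbitrary: Q)
  case 0
  then show ?case using primeideal_image(1) by (intro exI[of _ "\<lambda>_. tuple_val A xs ` Q"]) auto
next
  case (Suc n)
  obtain Q' where Q': "is_prime Q'" "Q \<subset> Q'" "prime_chain n Q'" using Suc.prems(3) by auto
  have ker: "tuple_kernel A xs \<subseteq> Q'" using Suc.prems(2) Q'(2) by blast
  obtain P where P: "P 0 = tuple_val A xs ` Q'" "\<forall>i\<le>n. primeideal (P i) A" "\<forall>i<n. P i \<subset> P (Suc i)"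
    using Suc.IH[OF Q'(1) ker Q'(3)] by blast
  obtain R where "R \<in> Q'" "R \<notin> Q" using Q'(2) by blast
  then have "tuple_val A xs ` Q \<subset> tuple_val A xs ` Q'"
    using primeideal_image(2)[OF Suc.prems(1,2), of R] Q'(2) by blast
  then show ?case
    using P primeideal_image(1)[OF Suc.prems(1,2)]
    by (intro exI[of _ "\<lambda>i. case i of 0 \<Rightarrow> tuple_val A xs ` Q | Suc j \<Rightarrow> P j"])
      (auto simp: less_Suc_eq_0_disj split: nat.splits)
qed

end

subsection \<open>The rank\<close>

context finitely_generated_mod
begin

text \<open>A proper ideal strictly above \<open>P\<close> would lie in a maximal one, which is
  prime. This settles dimension 0.\<close>

lemma maximal_if_no_prime_above:
  assumes P: "P \<in> Ideals" "is_prime P" "\<And>Q. is_prime Q \<Longrightarrow> \<not> P \<subset> Q" and J: "J \<in> Ideals" "P \<subset> J"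
  shows "J = UNIV"
proof (rule ccontr)
  assume "J \<noteq> UNIV"
  define \<S> where "\<S> = {J \<in> Ideals. J \<noteq> UNIV \<and> P \<subset> J}"
  have "J \<in> \<S>" using J \<open>J \<noteq> UNIV\<close> by (simp add: \<S>_def)
  moreover have "\<S> \<subseteq> Ideals" by (auto simp: \<S>_def)
  ultimately obtain M where "M \<in> \<S>" "\<And>K. K \<in> \<S> \<Longrightarrow> \<not> M \<subset> K" using Ideals_maximal by metis
  then have M: "M \<in> Ideals" "M \<noteq> UNIV" "P \<subset> M"
      "\<And>K. K \<in> Ideals \<Longrightarrow> K \<noteq> UNIV \<Longrightarrow> P \<subset> K \<Longrightarrow> \<not> M \<subset> K"
    by (auto simp: \<S>_def)
  have "is_prime M"
    unfolding is_prime_def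
  proof (intro conjI allI impI)
    show "is_ideal UNIV M" by (rule IdealsD(1)[OF M(1)])
    show "1 \<notin> M" using one_in_iff[OF M(1)] M(2) by blast
    fix a b assume ab: "a * b \<in> M"
    show "a \<in> M \<or> b \<in> M"
    proof (rule ccontr)
      assume "\<not> ?thesis"
      then have ab': "a \<notin> M" "b \<notin> M" by auto
      then have "M \<subset> colon M a" using ab subset_colon[OF M(1), of a] by (auto simp: colon_def)
      then have "colon M a = UNIV" using M(3) M(4)[OF colon_in[OF M(1)]] by blast
      then have "1 \<in> colon M a" by simp
      then show False using ab'(1) by (simp add: colon_def)
    qed
  qed
  then show False using P(3) M(3) by blast
qed

end

section \<open>From ideals back to marked rings\<close>

context
  fixes A :: "('a, 'm) ring_scheme" and xs :: "'a list" and N n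
  assumes A: "domain A" and gen: "ring_generators A xs"
  defines "N \<equiv> tuple_kernel A xs" and "n \<equiv> length xs"
begin

lemma A_cring: "cring A"
  using A by (simp add: domain_def)

lemma N_ideal: "is_ideal UNIV N" "n \<le> i \<Longrightarrow> indet i \<in> N"
  using is_ideal_tuple_kernel[OF A_cring] indet_in_tuple_kernel[OF A_cring] gen
  by (auto simp: N_def n_def ring_generators_def)

interpretation finitely_generated_mod N "indets n"
  by (rule finitely_generated_mod_indets[OF N_ideal])

lemma N_prime: "is_prime N"
proof -
  interpret A: domain A by (rule A)
  have "N = tuple_val A xs -` {\<zero>\<^bsub>A\<^esub>}" by (auto simp: N_def tuple_kernel_def)
  then show ?thesis using is_prime_vimage(1)[OF A_cring gen A.zeroprimeideal] by simp
qed

text \<open>Moves a rank function from ideals to marked rings through the injective map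
  \<open>class_ideal\<close>. The set \<open>E\<close> cuts out the open set on which ranks are
  known: it is empty in positive dimension, and \<open>{1}\<close> in dimension 0, where it leaves
  only \<open>N\<close>. The guard in \<open>lower\<close> is harmless, because \<open>E\<close> is
  added to the set that \<open>J'\<close> must avoid.\<close>

lemma rank_from_ideals:
  fixes \<rho> :: "int_mpoly set \<Rightarrow> 'b rel"
  assumes ideals: "\<S> \<subseteq> Ideals" "N \<in> \<S>" "finite E" "\<And>J. J \<in> Ideals \<Longrightarrow> J \<in> \<S> \<longleftrightarrow> J \<inter> E = {}"
    and wo: "\<And>J. J \<in> \<S> \<Longrightarrow> Well_order (\<rho> J)"
    and upper: "\<And>J. J \<in> \<S> \<Longrightarrow>
      \<exists>F. finite F \<and> F \<inter> J = {} \<and> (\<forall>J'\<in>\<S>. J \<subset> J' \<longrightarrow> J' \<inter> F = {} \<longrightarrow> (\<rho> J', \<rho> J) \<in> ordLess)"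
    and lower: "\<And>J (r :: 'b rel) F. J \<in> \<S> \<Longrightarrow> (r, \<rho> J) \<in> ordLess \<Longrightarrow> finite F \<Longrightarrow> F \<inter> J = {} \<Longrightarrow>
      \<exists>J'\<in>Ideals. J \<subset> J' \<and> J' \<inter> F = {} \<and> (J' \<in> \<S> \<longrightarrow> (\<rho> J', r) \<notin> ordLess)"
  shows "has_CB_rank (marked_ring_space n) (marked_class A xs) (\<rho> N)"
proof -
  let ?X = "marked_ring_space n"
  define S where "S = {c \<in> marked_ring_classes n. N \<subseteq> class_ideal c \<and> E \<inter> class_ideal c = {}}"
  have S_iff: "c \<in> S \<longleftrightarrow> c \<in> marked_ring_classes n \<and> class_ideal c \<in> \<S>" for c
  proof (cases "c \<in> marked_ring_classes n \<and> N \<subseteq> class_ideal c")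
    case True
    then have "class_ideal c \<in> Ideals" using is_ideal_class_ideal by (auto simp: Ideals_def)
    then show ?thesis using True ideals(4) by (auto simp: S_def)
  next
    case False
    then show ?thesis using IdealsD(2) ideals(1) by (auto simp: S_def)
  qed
  have in_S: "class_ideal c \<in> \<S>" "c \<in> marked_ring_classes n" if "c \<in> S" for c
    using that S_iff by auto
  have indet_in: "indet i \<in> J" if "J \<in> Ideals" "n \<le> i" for J i
    using N_ideal(2)[OF that(2)] IdealsD(2)[OF that(1)] by blast
  have class_of: "\<exists>c\<in>marked_ring_classes n. class_ideal c = J" if "J \<in> Ideals" for J
    by (rule class_ideal_surj[OF IdealsD(1)[OF that] indet_in[OF that]])
  have N_class: "class_ideal (marked_class A xs) = N"
    using class_ideal_marked_class[OF A_cring gen] by (simp add: N_def)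
  have marked: "marked_class A xs \<in> marked_ring_classes n"
    using marked_class_in_marked_ring_classes[OF A_cring gen] by (simp add: n_def)
  have "marked_class A xs \<in> CB_level ?X (\<rho> (class_ideal (marked_class A xs)))"
  proof (rule CB_level_rank_function[where S = S])
    show "openin ?X S" unfolding S_def by (rule openin_marked_ring_space[OF N_ideal ideals(3)])
    show "Well_order (\<rho> (class_ideal c))" if "c \<in> S" for c using wo in_S(1)[OF that] by blast
    show "marked_class A xs \<in> S" using S_iff marked N_class ideals(2) by simp
  next
    fix c assume c: "c \<in> S"
    let ?J = "class_ideal c"
    have J: "?J \<in> Ideals" using in_S(1)[OF c] ideals(1) by blast
    obtain F where F: "finite F" "F \<inter> ?J = {}"
        "\<forall>J'\<in>\<S>. ?J \<subset> J' \<longrightarrow> J' \<inter> F = {} \<longrightarrow> (\<rho> J', \<rho> ?J) \<in> ordLess"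
      using upper[OF in_S(1)[OF c]] by (elim exE conjE) (rule that)
    define U where "U = {c' \<in> marked_ring_classes n. ?J \<subseteq> class_ideal c' \<and> (F \<union> E) \<inter> class_ideal c' = {}}"
    have "openin ?X U"
      unfolding U_def
      by (rule openin_marked_ring_space[OF IdealsD(1)[OF J] indet_in[OF J]]) (use F(1) ideals(3) in auto)
    moreover have "c \<in> U" using c F(2) by (auto simp: U_def S_def)
    moreover have "U \<subseteq> S" using IdealsD(2)[OF J] by (auto simp: U_def S_def)
    moreover have "(\<rho> (class_ideal y), \<rho> ?J) \<in> ordLess" if y: "y \<in> U - {c}" for y
    proof (rule F(3)[rule_format])
      have yU: "y \<in> marked_ring_classes n" "?J \<subseteq> class_ideal y" "(F \<union> E) \<inter> class_ideal y = {}"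
        using y by (auto simp: U_def)
      show "class_ideal y \<in> \<S>" using y \<open>U \<subseteq> S\<close> in_S(1)[of y] by blast
      show "class_ideal y \<inter> F = {}" using yU(3) by blast
      have "class_ideal y \<noteq> ?J" using class_ideal_inj[OF yU(1) in_S(2)[OF c]] y by blast
      then show "?J \<subset> class_ideal y" using yU(2) by blast
    qed
    ultimately show "\<exists>U. openin ?X U \<and> c \<in> U \<and> U \<subseteq> S \<and> (\<forall>y\<in>U - {c}. (\<rho> (class_ideal y), \<rho> ?J) \<in> ordLess)"
      by (intro exI[of _ U]) simp
  next
    fix c U and r :: "'b rel"
    assume c: "c \<in> S" and r: "(r, \<rho> (class_ideal c)) \<in> ordLess" and U: "openin ?X U" "c \<in> U"
    let ?J = "class_ideal c"
    obtain F where F: "finite F" "F \<inter> ?J = {}"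
        "\<forall>c'\<in>marked_ring_classes n. ?J \<subseteq> class_ideal c' \<longrightarrow> F \<inter> class_ideal c' = {} \<longrightarrow> c' \<in> U"
      using marked_ring_space_neighborhood[OF U] by (elim exE conjE) (rule that)
    have FE: "finite (F \<union> E)" "(F \<union> E) \<inter> ?J = {}"
      using F(1,2) ideals(3) c by (auto simp: S_def)
    obtain J' where J': "J' \<in> Ideals" "?J \<subset> J'" "J' \<inter> (F \<union> E) = {}" "J' \<in> \<S> \<longrightarrow> (\<rho> J', r) \<notin> ordLess"
      using lower[OF in_S(1)[OF c] r FE] by (elim bexE conjE) (rule that)
    obtain c' where c': "c' \<in> marked_ring_classes n" "class_ideal c' = J'" using class_of[OF J'(1)] by blast
    have J'S: "J' \<in> \<S>" using ideals(4)[OF J'(1)] J'(3) by blast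
    have "c' \<in> U"
      by (rule F(3)[rule_format, OF c'(1)]) (use c'(2) J'(2,3) in auto)
    moreover have "c' \<in> S" using S_iff c' J'S by simp
    moreover have "c' \<noteq> c" using c'(2) J'(2) by blast
    ultimately show "\<exists>y\<in>U \<inter> S - {c}. (\<rho> (class_ideal y), r) \<notin> ordLess"
      using J'(4) J'S c'(2) by (intro bexI[of _ c']) auto
  qed
  then show ?thesis using wo[OF ideals(2)] by (simp add: has_CB_rank_def N_class)
qed

lemma rank_domain:
  assumes dim: "krull_dim A = enat d"
  shows "has_CB_rank (marked_ring_space n) (marked_class A xs) (if d = 0 then {} else omega_power (d - 1))"
proof -
  interpret A: domain A by (rule A)
  note krull = krull_dim_enatD[OF dim A.zeroprimeideal]
  have N_least: "N \<subseteq> tuple_val A xs -` P" if "primeideal P A" for P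
    using is_prime_vimage(2)[OF A_cring gen that] by (simp add: N_def)
  have no_chain: "\<not> prime_chain d Q" if Q: "is_prime Q" "N \<subset> Q" for Q
  proof
    assume "prime_chain d Q"
    then have "prime_chain (Suc d) N" using Q by auto
    then obtain P where "\<forall>i\<le>Suc d. primeideal (P i) A" "\<forall>i<Suc d. P i \<subset> P (Suc i)"
      using prime_chain_image[OF A_cring gen, of N "Suc d"] N_prime by (auto simp: N_def)
    then show False using krull(2)[of "Suc d" P] by simp
  qed
  show ?thesis
  proof (cases d)
    case 0
    have "J = UNIV" if J: "J \<in> Ideals" "N \<subset> J" for J
      by (rule maximal_if_no_prime_above[OF N_in N_prime _ J]) (use no_chain 0 in auto)
    moreover have "1 \<notin> N" using N_prime by (simp add: is_prime_def)
    ultimately have only: "J = N" if "J \<in> Ideals" "1 \<notin> J" for J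
      using IdealsD(2)[OF that(1)] that by blast
    \<comment> \<open>Forbidding 1 excludes the unit ideal, so \<open>N\<close> is isolated; the
      condition from below is vacuous since no ordinal is below the empty one.\<close>
    have "has_CB_rank (marked_ring_space n) (marked_class A xs) ((\<lambda>_. {} :: nat list rel) N)"
    proof (rule rank_from_ideals[where \<S> = "{N}" and E = "{1}"])
      show "J \<in> {N} \<longleftrightarrow> J \<inter> {1} = {}" if "J \<in> Ideals" for J
        using only[OF that] \<open>1 \<notin> N\<close> by auto
      show "Well_order ({} :: nat list rel)"
        by (simp add: order_on_defs refl_on_def trans_def antisym_def total_on_def)
    next
      fix J F and r :: "nat list rel"
      assume r: "(r, {} :: nat list rel) \<in> ordLess"
      then have "Well_order r" "Well_order ({} :: nat list rel)" by (auto simp: ordLess_def)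
      then have False using ordLess_iff_ordIso_Restr[of "{} :: nat list rel" r] r by (auto simp: Field_def)
      then show "\<exists>J'\<in>Ideals. J \<subset> J' \<and> J' \<inter> F = {} \<and> (J' \<in> {N} \<longrightarrow> ({}, r) \<notin> ordLess)" ..
    qed (use N_in in auto)
    then show ?thesis using 0 by simp
  next
    case (Suc e)
    have N_chain: "prime_chain (Suc e) N"
    proof -
      obtain P where P: "\<forall>i\<le>d. primeideal (P i) A" "\<forall>i<d. P i \<subset> P (Suc i)" using krull(1) by blast
      then have "prime_chain (Suc e) (tuple_val A xs -` P 0)"
        using prime_chain_vimage[OF A_cring gen P] by (simp add: Suc)
      moreover have "N \<subseteq> tuple_val A xs -` P 0" by (rule N_least) (use P(1) in simp)
      ultimately show ?thesis unfolding prime_chain.simps by (meson subset_psubset_trans)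
    qed
    define l where "l J = butlast (len (Suc e) J)" for J
    have has: "has_len (Suc e) J" if J: "J \<in> Ideals" "N \<subset> J" for J
    proof -
      have "\<exists>u. length u = d \<and> bounded_by J u"
        by (rule bounded_by_dimension[OF J(1)]) (use no_chain J(2) in blast)
      then show ?thesis using J(1) by (simp add: has_len_def Suc)
    qed
    have ll: "length (l J) = e" if "J \<in> Ideals" "N \<subset> J" for J
      using len(1)[OF has[OF that]] by (simp add: l_def)
    \<comment> \<open>The length of \<open>N\<close> is omega^(e+1), for which \<open>len\<close>
      has no list; its quotient by omega is omega^e. Every other ideal has a list of
      \<open>e + 1\<close> entries, and \<open>l\<close> drops the last.\<close>
    define \<rho> where "\<rho> J = (if J = N then omega_power e else omega_segment e (l J))" for J
    have "has_CB_rank (marked_ring_space n) (marked_class A xs) (\<rho> N)"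
    proof (rule rank_from_ideals[where \<S> = Ideals and E = "{}"])
      show "Well_order (\<rho> J)" for J
        by (simp add: \<rho>_def Well_order_omega_power Well_order_omega_segment)
    next
      fix J assume J: "J \<in> Ideals"
      show "\<exists>F. finite F \<and> F \<inter> J = {} \<and> (\<forall>J'\<in>Ideals. J \<subset> J' \<longrightarrow> J' \<inter> F = {} \<longrightarrow> (\<rho> J', \<rho> J) \<in> ordLess)"
      proof (cases "J = N")
        case True
        then show ?thesis by (intro exI[of _ "{}"]) (auto simp: \<rho>_def omega_segment_less_power)
      next
        case False
        then have NJ: "N \<subset> J" using IdealsD(2)[OF J] by blast
        obtain F where F: "finite F" "F \<inter> J = {}"
            "\<And>J'. J' \<in> Ideals \<Longrightarrow> J \<subset> J' \<Longrightarrow> J' \<inter> F = {} \<Longrightarrow> l J' \<lless> l J"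
          using butlast_len_upper[OF has[OF J NJ]] unfolding l_def by metis
        have "(\<rho> J', \<rho> J) \<in> ordLess" if J': "J' \<in> Ideals" "J \<subset> J'" "J' \<inter> F = {}" for J'
          using omega_segment_mono[OF F(3)[OF J'] ll[OF J NJ]] NJ J'(2) False by (auto simp: \<rho>_def)
        then show ?thesis using F(1,2) by blast
      qed
    next
      fix J F and r :: "nat list rel"
      assume J: "J \<in> Ideals" and r: "(r, \<rho> J) \<in> ordLess" and F: "finite F" "F \<inter> J = {}"
      obtain v where v: "length v = e" "(r, omega_segment e v) \<in> ordIso"
        and vJ: "J \<noteq> N \<Longrightarrow> v \<lless> l J"
      proof (cases "J = N")
        case True
        then show ?thesis using r less_omega_power_segment[of r e] that by (auto simp: \<rho>_def)
      next
        case False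
        then have NJ: "N \<subset> J" using IdealsD(2)[OF J] by blast
        have "(r, omega_segment e (l J)) \<in> ordLess" using r False by (simp add: \<rho>_def)
        then obtain v where "v \<lless> l J" "(r, omega_segment e v) \<in> ordIso"
          using less_omega_segment[OF _ ll[OF J NJ]] by metis
        then show ?thesis using that[of v] list_less_length[of v "l J"] ll[OF J NJ] by simp
      qed
      have "\<exists>J'\<in>Ideals. J \<subset> J' \<and> J' \<inter> F = {} \<and> \<not> l J' \<lless> v"
      proof (cases "J = N")
        case False
        then have NJ: "N \<subset> J" using IdealsD(2)[OF J] by blast
        show ?thesis
          using butlast_len_lower[OF has[OF J NJ] vJ[OF False, unfolded l_def] F] by (simp add: l_def)
      next
        case True
        interpret N: prime_modulus N using N_prime by unfold_locales
        \<comment> \<open>\<open>v @ [0]\<close> is omega times \<open>v\<close>, so every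
          \<open>J'\<close> with N \<subset> J' \<subseteq> L has quotient at least
          \<open>v\<close>. To find one that avoids \<open>F\<close>, an \<open>x\<close> in
          \<open>L\<close> outside the prime \<open>N\<close> has colon ideal \<open>N\<close>, and
          the powers of a nonunit \<open>a\<close> produce small ideals inside N + xR.\<close>
        obtain L where L: "L \<in> Ideals" "N \<subset> L" "bounding L (v @ [0])"
          using bounding_dimension[OF N_in N_prime N_chain, of "v @ [0]"] v(1) by auto
        obtain x where x: "x \<in> L" "x \<notin> N" using L(2) by blast
        have col: "colon N x = N" using x(2) by (auto simp: colon_def N.prime_mult)
        obtain Q where Q: "is_prime Q" "N \<subset> Q" using N_chain by auto
        then obtain a where a: "a \<in> Q" "a \<notin> N" by blast
        have QI: "Q \<in> Ideals" using Q by (auto simp: Ideals_def is_prime_def)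
        have "ideal_add N a UNIV \<subseteq> Q" by (rule ideal_add_subset[OF QI]) (use Q(2) a(1) in auto)
        then have "ideal_add N a UNIV \<noteq> UNIV" using Q(1) by (auto simp: is_prime_def)
        then obtain J' where J': "J' \<in> Ideals" "N \<subset> J'" "J' \<subseteq> ideal_add N x UNIV" "J' \<inter> F = {}"
          using small_ideal_avoiding[OF N_in, of x a F] N_prime a(2) F True by (auto simp: col)
        have "J' \<subseteq> L" using J'(3) ideal_add_subset[OF L(1) _ x(1), of N UNIV] L(2) by blast
        then have "\<not> len (Suc e) J' \<lless> v @ [0]"
          using len_not_less_bounding[OF has[OF J'(1,2)] bounding_antimono[OF L(3)]] by blast
        moreover have "len (Suc e) J' = l J' @ [last (len (Suc e) J')]"
          using len(1)[OF has[OF J'(1,2)]] by (cases "len (Suc e) J'") (auto simp: l_def)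
        ultimately have "\<not> l J' \<lless> v"
          using list_less_snoc[of "l J'" v] ll[OF J'(1,2)] v(1) by metis
        then show ?thesis using J' True by blast
      qed
      then obtain J' where J': "J' \<in> Ideals" "J \<subset> J'" "J' \<inter> F = {}" "\<not> l J' \<lless> v" by blast
      have NJ': "N \<subset> J'" using IdealsD(2)[OF J] J'(2) by blast
      have "(\<rho> J', r) \<notin> ordLess"
        using not_less_omega_segment[OF v(2,1) ll[OF J'(1) NJ'] J'(4)] NJ' by (auto simp: \<rho>_def)
      then show "\<exists>J'\<in>Ideals. J \<subset> J' \<and> J' \<inter> F = {} \<and> (J' \<in> Ideals \<longrightarrow> (\<rho> J', r) \<notin> ordLess)"
        using J' by blast
    qed (use N_in in auto)
    then show ?thesis by (simp add: \<rho>_def Suc)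
  qed
qed

end

theorem corollary2:
  fixes A :: "('a, 'm) ring_scheme" and d :: nat
  assumes "domain A"
    and "finitely_generated_ring A"
    and "krull_dim A = enat d"
  shows "ring_has_CB_rank A (if d = 0 then {} else omega_power (d - 1))"
  unfolding ring_has_CB_rank_def using assms rank_domain by blast

end
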